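(* Let $\sigma>0$, let $\lambda\in\mathcal D$ satisfy $\rho_\sigma(\lambda)<1$, let $\Lambda$ be an antiderivative of $\lambda$, and set $D_T=\mathrm d\mathbb P^x/\mathrm d\mathbb Q_0=Z_{0,T}^{-1}$. For every $T>0$ and starting state $x\in\mathbb R$, $$0<D_T\le\exp\Big\{\frac{\Lambda(\theta)-\Lambda(x)}{\sigma^2}+T\sup_{y\in\mathbb R}\Psi_0(y)\Big\}<\infty\qquad\mathbb Q_0\text{-a.s.}$$ Thus $D_T\in L^\infty(\mathbb Q_0)$; in particular, $\mathbb E^{\mathbb Q_0}[D_T^m]<\infty$ for every $m>0$.
   Context: Class $\mathcal D$: all $\lambda\in C^1(\mathbb R)$ that are strictly decreasing with $\lambda(\theta)=0$ for some (unique) $\theta\in\mathbb R$; $q:=-\lambda'\ge0$. Set $\rho_\sigma(\lambda):=\limsup_{|y|\to\infty}\sigma^2q(y)/\lambda(y)^2\in[0,\infty]$ and $$\Psi_0(y):=\frac{q(y)}2-\frac{\lambda(y)^2}{2\sigma^2}.$$ For $\lambda\in\mathcal D$ the SDE $\mathrm dX_t=\lambda(X_t)\,\mathrm dt+\sigma\,\mathrm dW_t$, $X_0=x$ ($W$ a standard Brownian motion) has a unique non-explosive strong solution; $\mathbb P^x$ is its law on $C([0,T])$, and $\mathbb Q_0$ is the law on $C([0,T])$ of $x+\sigma W$; $X$ also denotes the coordinate process. The two laws are equivalent on $[0,T]$, with $\mathrm d\mathbb Q_0/\mathrm d\mathbb P^x=Z_{0,T}$, where, with $\eta=\lambda/\sigma$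 and $W$ the driving Brownian motion under $\mathbb P^x$, $$Z_{0,T}:=\exp\Big(-\int_0^T\eta(X_r)\,\mathrm dW_r-\frac12\int_0^T\eta(X_r)^2\,\mathrm dr\Big).$$ *)

theory Defs
  imports "HOL-Probability.Probability"
begin

definition drift_class :: "(real \<Rightarrow> real) set" where
  "drift_class = {lam. (\<forall>y. lam differentiable at y) \<and> continuous_on UNIV (deriv lam) \<and>
      (\<forall>y z. y < z \<longrightarrow> lam z < lam y) \<and> (\<exists>\<theta>. lam \<theta> = 0)}"

definition slope :: "(real \<Rightarrow> real) \<Rightarrow> real \<Rightarrow> real" where
  "slope lam y = - deriv lam y"

text \<open>On the real line \<^const>\<open>at_infinity\<close> is the filter of \<open>\<bar>y\<bar> \<rightarrow> \<infinity>\<close>.\<close>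

definition rho :: "real \<Rightarrow> (real \<Rightarrow> real) \<Rightarrow> ereal" where
  "rho \<sigma> lam = Limsup at_infinity (\<lambda>y. ereal (\<sigma>\<^sup>2 * slope lam y / (lam y)\<^sup>2))"

definition Psi0 :: "real \<Rightarrow> (real \<Rightarrow> real) \<Rightarrow> real \<Rightarrow> real" where
  "Psi0 \<sigma> lam y = slope lam y / 2 - (lam y)\<^sup>2 / (2 * \<sigma>\<^sup>2)"

text \<open>Processes are indexed by all reals, but only the values at times \<open>t \<ge> 0\<close> matter.
  The natural filtration at time \<open>t\<close> is the \<open>\<sigma>\<close>-algebra generated by the \<open>X s\<close>, \<open>0 \<le> s \<le> t\<close>.\<close>

definition natural_filtration :: "'a measure \<Rightarrow> (real \<Rightarrow> 'a \<Rightarrow> real) \<Rightarrow> real \<Rightarrow> 'a measure" where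
  "natural_filtration M X t =
     vimage_algebra (space M) (\<lambda>\<omega>. \<lambda>s\<in>{0..t}. X s \<omega>) (Pi\<^sub>M {0..t} (\<lambda>_. borel))"

definition brownian_motion :: "'a measure \<Rightarrow> (real \<Rightarrow> 'a \<Rightarrow> real) \<Rightarrow> bool" where
  "brownian_motion M W \<longleftrightarrow>
     prob_space M \<and>
     (\<forall>t\<ge>0. W t \<in> borel_measurable M) \<and>
     (\<forall>\<omega>\<in>space M. continuous_on {0..} (\<lambda>t. W t \<omega>)) \<and>
     (AE \<omega> in M. W 0 \<omega> = 0) \<and>
     (\<forall>s t. 0 \<le> s \<longrightarrow> s < t \<longrightarrow>
        distributed M lborel (\<lambda>\<omega>. W t \<omega> - W s \<omega>) (normal_density 0 (sqrt (t - s))) \<and>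
        prob_space.indep_set M (sets (natural_filtration M W s))
          (sets (vimage_algebra (space M) (\<lambda>\<omega>. W t \<omega> - W s \<omega>) borel)))"

text \<open>Since the noise is additive, the equation \<open>dX = lam(X) dt + \<sigma> dW\<close>, \<open>X\<^sub>0 = x\<close> is
  meaningful pathwise. Strong solutions are adapted to the filtration of \<open>W\<close> completed by the
  null sets, i.e. every \<open>X t\<close> agrees almost surely with a random variable that is measurable
  with respect to the natural filtration.\<close>

definition strong_solution ::
  "'a measure \<Rightarrow> (real \<Rightarrow> 'a \<Rightarrow> real) \<Rightarrow> real \<Rightarrow> (real \<Rightarrow> real) \<Rightarrow> real \<Rightarrow> (real \<Rightarrow> 'a \<Rightarrow> real) \<Rightarrow> bool"
where
  "strong_solution M W \<sigma> lam x X \<longleftrightarrow>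
     (\<forall>t\<ge>0. X t \<in> borel_measurable M) \<and>
     (\<forall>\<omega>\<in>space M. continuous_on {0..} (\<lambda>t. X t \<omega>)) \<and>
     (\<forall>t\<ge>0. \<exists>Y\<in>borel_measurable (natural_filtration M W t). AE \<omega> in M. X t \<omega> = Y \<omega>) \<and>
     (AE \<omega> in M. \<forall>t\<ge>0. X t \<omega> = x + integral {0..t} (\<lambda>s. lam (X s \<omega>)) + \<sigma> * W t \<omega>)"

text \<open>\<open>C([0,T])\<close> with the \<open>\<sigma>\<close>-algebra generated by the coordinates, which is the Borel
  \<open>\<sigma>\<close>-algebra of the supremum norm. A path is represented by a function that is
  \<^const>\<open>undefined\<close> outside \<open>[0,T]\<close>.\<close>

definition path_space :: "real \<Rightarrow> (real \<Rightarrow> real) measure" where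
  "path_space T = restrict_space (Pi\<^sub>M {0..T} (\<lambda>_. borel)) {w. continuous_on {0..T} w}"

definition path_law :: "'a measure \<Rightarrow> (real \<Rightarrow> 'a \<Rightarrow> real) \<Rightarrow> real \<Rightarrow> (real \<Rightarrow> real) measure" where
  "path_law M X T = distr M (path_space T) (\<lambda>\<omega>. \<lambda>t\<in>{0..T}. X t \<omega>)"

definition conv_in_prob :: "'a measure \<Rightarrow> (nat \<Rightarrow> 'a \<Rightarrow> real) \<Rightarrow> ('a \<Rightarrow> real) \<Rightarrow> bool" where
  "conv_in_prob M Y Y' \<longleftrightarrow>
     (\<forall>n. Y n \<in> borel_measurable M) \<and> Y' \<in> borel_measurable M \<and>
     (\<forall>\<epsilon>>0. (\<lambda>n. measure M {\<omega>\<in>space M. \<bar>Y n \<omega> - Y' \<omega>\<bar> > \<epsilon>}) \<longlonglongrightarrow> 0)"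

text \<open>The list entry \<open>(s, u, \<xi>)\<close> stands for the integrand \<open>\<xi> 1\<^bsub>(s,u]\<^esub>\<close>, and a list for the sum
  of its entries.\<close>

type_synonym 'a simple_process = "(real \<times> real \<times> ('a \<Rightarrow> real)) list"

definition simple_integrand :: "(real \<Rightarrow> 'a measure) \<Rightarrow> real \<Rightarrow> 'a simple_process \<Rightarrow> bool" where
  "simple_integrand F T K \<longleftrightarrow>
     (\<forall>(s, u, \<xi>)\<in>set K. 0 \<le> s \<and> s \<le> u \<and> u \<le> T \<and>
        \<xi> \<in> borel_measurable (F s) \<and> (\<exists>B. \<forall>\<omega>\<in>space (F s). \<bar>\<xi> \<omega>\<bar> \<le> B))"

definition simple_value :: "'a simple_process \<Rightarrow> real \<Rightarrow> 'a \<Rightarrow> real" where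
  "simple_value K t \<omega> = (\<Sum>(s, u, \<xi>)\<leftarrow>K. \<xi> \<omega> * indicator {s<..u} t)"

definition simple_integral :: "(real \<Rightarrow> 'a \<Rightarrow> real) \<Rightarrow> 'a simple_process \<Rightarrow> 'a \<Rightarrow> real" where
  "simple_integral W K \<omega> = (\<Sum>(s, u, \<xi>)\<leftarrow>K. \<xi> \<omega> * (W u \<omega> - W s \<omega>))"

text \<open>\<open>I\<close> is a version of \<open>\<integral>\<^sub>0\<^sup>T H dW\<close>, for \<open>H\<close> continuous and adapted to \<open>F\<close> and \<open>W\<close> a Brownian
  motion relative to \<open>F\<close>: it is the limit in probability of the integrals of simple integrands
  that converge to \<open>H\<close> in \<open>L\<^sup>2([0,T])\<close>, in probability.\<close>

definition is_ito_integral ::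
  "'a measure \<Rightarrow> (real \<Rightarrow> 'a measure) \<Rightarrow> (real \<Rightarrow> 'a \<Rightarrow> real) \<Rightarrow> real \<Rightarrow>
   (real \<Rightarrow> 'a \<Rightarrow> real) \<Rightarrow> ('a \<Rightarrow> real) \<Rightarrow> bool"
where
  "is_ito_integral M F W T H I \<longleftrightarrow>
     (\<forall>t\<in>{0..T}. H t \<in> borel_measurable (F t)) \<and>
     (\<forall>\<omega>\<in>space M. continuous_on {0..T} (\<lambda>t. H t \<omega>)) \<and>
     (\<exists>K. (\<forall>n. simple_integrand F T (K n)) \<and>
        conv_in_prob M (\<lambda>n \<omega>. integral {0..T} (\<lambda>t. (simple_value (K n) t \<omega> - H t \<omega>)\<^sup>2)) (\<lambda>_. 0) \<and>
        conv_in_prob M (\<lambda>n. simple_integral W (K n)) I)"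

definition ito_integral ::
  "'a measure \<Rightarrow> (real \<Rightarrow> 'a measure) \<Rightarrow> (real \<Rightarrow> 'a \<Rightarrow> real) \<Rightarrow> real \<Rightarrow>
   (real \<Rightarrow> 'a \<Rightarrow> real) \<Rightarrow> 'a \<Rightarrow> real"
where
  "ito_integral M F W T H = (SOME I. is_ito_integral M F W T H I)"

text \<open>Under the law of the solution, the coordinate process \<open>w\<close> solves the equation with driving
  Brownian motion \<open>(w t - x - \<integral>\<^sub>0\<^sup>t lam(w r) dr) / \<sigma>\<close>.\<close>

definition driving_bm :: "real \<Rightarrow> (real \<Rightarrow> real) \<Rightarrow> real \<Rightarrow> real \<Rightarrow> (real \<Rightarrow> real) \<Rightarrow> real" where
  "driving_bm \<sigma> lam x t w = (w t - x - integral {0..t} (\<lambda>r. lam (w r))) / \<sigma>"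

definition Z :: "real \<Rightarrow> (real \<Rightarrow> real) \<Rightarrow> real \<Rightarrow> real \<Rightarrow> (real \<Rightarrow> real) measure \<Rightarrow> (real \<Rightarrow> real) \<Rightarrow> real"
where
  "Z \<sigma> lam x T P w =
     exp (- ito_integral P (natural_filtration P (\<lambda>t w. w t)) (driving_bm \<sigma> lam x) T
              (\<lambda>t w. lam (w t) / \<sigma>) w
          - 1 / 2 * integral {0..T} (\<lambda>r. (lam (w r) / \<sigma>)\<^sup>2))"

end

theory Submission
  imports Defs
begin

text \<open>
  Write \<open>h = T / 2 ^ n\<close>. The grid values of an Euler scheme for \<open>dX = lam(X) dt + \<sigma> dW\<close> have, with
  respect to those of \<open>x + \<sigma> W\<close>, the density \<open>exp (\<Sum> lam(y\<^sub>k) (y\<^sub>k\<^sub>+\<^sub>1 - y\<^sub>k) / \<sigma>\<^sup>2 - h lam(y\<^sub>k)\<^sup>2 / (2 \<sigma>\<^sup>2))\<close>: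
  one Gaussian shift per step. Dyadic quadratic variations of \<open>W\<close> converge almost surely, so by a
  second-order Taylor expansion of \<open>Lam\<close> (Foellmer's pathwise Ito formula) the density converges
  along almost every path to
    \<open>\<Phi> = exp ((Lam(w\<^sub>T) - Lam(x)) / \<sigma>\<^sup>2 + \<integral> \<Psi>\<^sub>0(w\<^sub>r) dr)\<close>,
  both along \<open>x + \<sigma> W\<close> and along the Euler scheme, which itself converges uniformly to \<open>X\<close> because
  \<open>lam\<close> decreases. Since \<open>lam\<close> decreases through \<open>\<theta>\<close>, \<open>Lam\<close> is maximal there, and \<open>\<rho> < 1\<close> makes
  \<open>\<Psi>\<^sub>0\<close> nonpositive near infinity; hence \<open>\<Phi>\<close> is bounded. Truncating the discrete densities above this
  bound allows dominated convergence on both sides and gives \<open>dP/dQ = \<Phi>\<close> without any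
  uniform-integrability argument.

  The Ito integral in \<open>Z\<close> is chosen by \<open>SOME\<close>, so every version has to be identified with the
  pathwise limit \<open>J = ln \<Phi> - 1/2 \<integral> (lam/\<sigma>)\<^sup>2\<close>. This can be done under \<open>Q\<close>, where simple integrals have
  exponential martingales with respect to a Brownian motion.
\<close>

section \<open>Riemann sums on dyadic grids\<close>

text \<open>The drift may grow faster than linearly, so the argument rests on deterministic facts
  about single paths instead of global Lipschitz or Novikov bounds. Near a given path an Euler step
  is non-expansive once the mesh is small, and \<open>\<Phi> w \<le> C\<close> holds for every
  continuous \<open>w\<close>, hence along \<open>X\<close> as well as along
  \<open>x + \<sigma> W\<close>. The cutoff at \<open>K = C + 1\<close> depends on the grid values
  alone, so it is the same test function on both sides of the discrete identity, and it becomes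
  inactive in the limit on both. Dyadic levels make the squared errors of the quadratic variation
  summable, which gives convergence along the whole sequence of grids. Requiring the quadratic
  variation only on the countably many initial segments \<open>i / m\<close> keeps the exceptional
  set null and still controls every continuous weight. Products of continuous ramps turn limits of
  grid values into an identity of laws on path space. Since \<open>\<Phi>\<close> is positive the
  laws are equivalent, so almost sure limits move freely between \<open>P\<close> and
  \<open>Q\<close>.\<close>

definition grid :: "real \<Rightarrow> nat \<Rightarrow> nat \<Rightarrow> real" where
  "grid T n k = T * real k / 2 ^ n"

lemma LIMSEQ_eventuallyI:
  "(\<And>e. e > 0 \<Longrightarrow> \<forall>\<^sub>F n in sequentially. norm (X n - L) < e) \<Longrightarrow> X \<longlonglongrightarrow> L"
  by (rule tendstoI) (simp add: dist_norm)

text \<open>Closeness is asked at every point of the closed cell, uniformly in the cell, so that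
  left endpoints, right endpoints and intermediate points of a cell can all serve as sampling
  points.\<close>

definition approx_on_cells :: "real \<Rightarrow> (nat \<Rightarrow> nat \<Rightarrow> real) \<Rightarrow> (real \<Rightarrow> real) \<Rightarrow> bool" where
  "approx_on_cells T c g \<longleftrightarrow>
     (\<forall>e>0. \<forall>\<^sub>F n in sequentially. \<forall>k<2^n. \<forall>r\<in>{grid T n k..grid T n (Suc k)}. \<bar>c n k - g r\<bar> < e)"

lemma grid_0 [simp]: "grid T n 0 = 0"
  by (simp add: grid_def)

lemma grid_last [simp]: "grid T n (2 ^ n) = T"
  by (simp add: grid_def)

lemma grid_Suc: "grid T n (Suc k) = grid T n k + T / 2 ^ n"
  by (simp add: grid_def field_simps)

lemma grid_mono: "0 \<le> T \<Longrightarrow> j \<le> k \<Longrightarrow> grid T n j \<le> grid T n k"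
  by (simp add: grid_def divide_right_mono mult_left_mono)

lemma grid_nonneg [simp]: "0 \<le> T \<Longrightarrow> 0 \<le> grid T n k"
  by (simp add: grid_def)

lemma grid_le: "0 \<le> T \<Longrightarrow> k \<le> 2 ^ n \<Longrightarrow> grid T n k \<le> T"
  using grid_mono[of T k "2^n" n] by simp

lemma grid_cell_subset:
  assumes "0 \<le> T" "k < 2 ^ n"
  shows "{grid T n k..grid T n (Suc k)} \<subseteq> {0..T}"
proof -
  have "grid T n (Suc k) \<le> T" using assms by (intro grid_le) auto
  then show ?thesis using grid_nonneg[OF assms(1), of n k] by (auto simp del: grid_nonneg)
qed

lemma mesh_tendsto_0: "(\<lambda>n. T / 2 ^ n :: real) \<longlonglongrightarrow> 0"
  by (rule LIMSEQ_divide_realpow_zero) simp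

lemma eventually_mesh_less: "d > 0 \<Longrightarrow> \<forall>\<^sub>F n in sequentially. T / 2 ^ n < (d::real)"
  by (rule order_tendstoD(2)[OF mesh_tendsto_0])

lemma sum_integral_cells:
  fixes f :: "real \<Rightarrow> real"
  assumes f: "f integrable_on {0..T}" and T: "0 \<le> T" and j: "j \<le> 2 ^ n"
  shows "(\<Sum>k<j. integral {grid T n k..grid T n (Suc k)} f) = integral {0..grid T n j} f"
  using j
proof (induction j)
  case (Suc j)
  have "f integrable_on {0..grid T n (Suc j)}"
    using integrable_subinterval_real[OF f, of 0 "grid T n (Suc j)"] grid_le[OF T Suc.prems] by auto
  then have "integral {0..grid T n j} f + integral {grid T n j..grid T n (Suc j)} f
      = integral {0..grid T n (Suc j)} f"
    using T grid_mono[OF T, of j "Suc j" n] by (intro Henstock_Kurzweil_Integration.integral_combine) auto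
  then show ?case using Suc by simp
qed simp

lemma approx_on_cellsD:
  "approx_on_cells T c g \<Longrightarrow> e > 0 \<Longrightarrow>
    \<forall>\<^sub>F n in sequentially. \<forall>k<2^n. \<forall>r\<in>{grid T n k..grid T n (Suc k)}. \<bar>c n k - g r\<bar> < e"
  by (simp add: approx_on_cells_def)

text \<open>Uniform continuity of \<open>g\<close> spreads closeness at the grid points over the
  adjacent cells. The shifted version serves to enclose points lying between \<open>y n k\<close>
  and \<open>y n (Suc k)\<close>.\<close>

lemma approx_on_cellsI:
  assumes g: "continuous_on {0..T} g" and T: "0 < T"
    and y: "\<And>e. e > 0 \<Longrightarrow> \<forall>\<^sub>F n in sequentially. \<forall>k\<le>2^n. \<bar>y n k - g (grid T n k)\<bar> < e"
  shows "approx_on_cells T y g" and "approx_on_cells T (\<lambda>n k. y n (Suc k)) g"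
proof -
  have uc: "uniformly_continuous_on {0..T} g"
    using g by (intro compact_uniformly_continuous) auto
  have *: "\<forall>\<^sub>F n in sequentially. \<forall>k<2^n. \<forall>r\<in>{grid T n k..grid T n (Suc k)}.
      \<bar>y n k - g r\<bar> < e \<and> \<bar>y n (Suc k) - g r\<bar> < e" if e: "e > 0" for e
  proof -
    obtain d where d: "d > 0"
      "\<And>r s. r \<in> {0..T} \<Longrightarrow> s \<in> {0..T} \<Longrightarrow> dist s r < d \<Longrightarrow> dist (g s) (g r) < e / 2"
      using uc e unfolding uniformly_continuous_on_def by (metis half_gt_zero)
    show ?thesis
      using y[OF half_gt_zero[OF e]] eventually_mesh_less[OF d(1), of T]
    proof eventually_elim
      case 2: (elim n)
      show ?case
      proof (intro allI impI ballI)
        fix k r assume k: "k < 2 ^ n" and r: "r \<in> {grid T n k..grid T n (Suc k)}"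
        have in0: "grid T n k \<in> {0..T}" "grid T n (Suc k) \<in> {0..T}" "r \<in> {0..T}"
          using r subsetD[OF grid_cell_subset[OF less_imp_le[OF T] k]] grid_mono[of T k "Suc k" n] T by auto
        have "dist (grid T n k) r < d" "dist (grid T n (Suc k)) r < d"
          using r 2(2) by (auto simp: dist_real_def grid_Suc)
        then have "dist (g (grid T n k)) (g r) < e/2" "dist (g (grid T n (Suc k))) (g r) < e/2"
          using d(2) in0 by auto
        moreover have "\<bar>y n k - g (grid T n k)\<bar> < e/2" "\<bar>y n (Suc k) - g (grid T n (Suc k))\<bar> < e/2"
          using 2(1) k by auto
        ultimately show "\<bar>y n k - g r\<bar> < e \<and> \<bar>y n (Suc k) - g r\<bar> < e"
          unfolding dist_real_def by linarith
      qed
    qed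
  qed
  show "approx_on_cells T y g" "approx_on_cells T (\<lambda>n k. y n (Suc k)) g"
    unfolding approx_on_cells_def using * by (fastforce elim: eventually_mono)+
qed

lemma approx_on_cells_grid:
  "continuous_on {0..T} g \<Longrightarrow> 0 < T \<Longrightarrow> approx_on_cells T (\<lambda>n k. g (grid T n k)) g"
  by (rule approx_on_cellsI(1)) auto

text \<open>Meant for the intermediate points of Taylor's formula, about which nothing is known
  except that they lie between two consecutive values of the scheme.\<close>

lemma approx_on_cells_between:
  assumes "approx_on_cells T a g" "approx_on_cells T b g"
    and c: "\<And>n k. k < 2 ^ n \<Longrightarrow> min (a n k) (b n k) \<le> c n k \<and> c n k \<le> max (a n k) (b n k)"
  shows "approx_on_cells T c g"
  unfolding approx_on_cells_def
proof (intro allI impI)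
  fix e :: real assume "e > 0"
  show "\<forall>\<^sub>F n in sequentially. \<forall>k<2^n. \<forall>r\<in>{grid T n k..grid T n (Suc k)}. \<bar>c n k - g r\<bar> < e"
    using approx_on_cellsD[OF assms(1) \<open>e > 0\<close>] approx_on_cellsD[OF assms(2) \<open>e > 0\<close>]
  proof eventually_elim
    case (elim n)
    show ?case
    proof (intro allI impI ballI)
      fix k r assume k: "k < 2 ^ n" and r: "r \<in> {grid T n k..grid T n (Suc k)}"
      then have "\<bar>a n k - g r\<bar> < e" "\<bar>b n k - g r\<bar> < e" using elim by auto
      then show "\<bar>c n k - g r\<bar> < e" using c[OF k] by linarith
    qed
  qed
qed

lemma continuous_on_Icc_bounded:
  fixes g :: "real \<Rightarrow> real"
  assumes "continuous_on {a..b} g"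
  obtains R where "R > 0" "\<And>r. r \<in> {a..b} \<Longrightarrow> \<bar>g r\<bar> \<le> R"
  using compact_imp_bounded[OF compact_continuous_image[OF assms compact_Icc]]
  unfolding bounded_pos by (auto simp: image_iff)

lemma approx_on_cells_compose:
  assumes c: "approx_on_cells T c g" and g: "continuous_on {0..T} g" and T: "0 < T"
    and f: "continuous_on UNIV (f :: real \<Rightarrow> real)"
  shows "approx_on_cells T (\<lambda>n k. f (c n k)) (\<lambda>r. f (g r))"
  unfolding approx_on_cells_def
proof (intro allI impI)
  fix e :: real assume e: "e > 0"
  obtain R where R: "R > 0" "\<And>r. r \<in> {0..T} \<Longrightarrow> \<bar>g r\<bar> \<le> R"
    using continuous_on_Icc_bounded[OF g] by blast
  have "uniformly_continuous_on {-R-1..R+1} f"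
    by (intro compact_uniformly_continuous continuous_on_subset[OF f]) auto
  then obtain d where d: "d > 0"
    "\<And>r s. r \<in> {-R-1..R+1} \<Longrightarrow> s \<in> {-R-1..R+1} \<Longrightarrow> dist s r < d \<Longrightarrow> dist (f s) (f r) < e"
    using e unfolding uniformly_continuous_on_def by metis
  \<comment> \<open>The cap 1 keeps the approximating values in \<open>{-R-1..R+1}\<close>, where
    \<open>f\<close> is uniformly continuous.\<close>
  have "min d 1 > 0" using d by simp
  from approx_on_cellsD[OF c this]
  show "\<forall>\<^sub>F n in sequentially. \<forall>k<2^n. \<forall>r\<in>{grid T n k..grid T n (Suc k)}. \<bar>f (c n k) - f (g r)\<bar> < e"
  proof eventually_elim
    case (elim n)
    show ?case
    proof (intro allI impI ballI)
      fix k r assume k: "k < 2 ^ n" and r: "r \<in> {grid T n k..grid T n (Suc k)}"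
      have "r \<in> {0..T}" using subsetD[OF grid_cell_subset[OF less_imp_le[OF T] k] r] .
      then have "\<bar>g r\<bar> \<le> R" using R by auto
      moreover have "\<bar>c n k - g r\<bar> < min d 1" using elim k r by auto
      ultimately have "c n k \<in> {-R-1..R+1}" "g r \<in> {-R-1..R+1}" "dist (c n k) (g r) < d"
        by (auto simp: dist_real_def)
      from d(2)[OF this(2,1,3)] show "\<bar>f (c n k) - f (g r)\<bar> < e" by (simp add: dist_real_def)
    qed
  qed
qed

text \<open>A general continuous weight \<open>f\<close> is allowed because the drift part of
  \<open>driving_bm\<close> enters simple integrals through cell integrals of \<open>H\<close>; the
  weight 1 gives Riemann sums.\<close>

lemma weighted_integral_sum_tendsto:
  assumes c: "approx_on_cells T c g" and g: "continuous_on {0..T} g"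
    and f: "continuous_on {0..T} f" and T: "0 < T"
  shows "(\<lambda>n. \<Sum>k<2^n. c n k * integral {grid T n k..grid T n (Suc k)} f)
    \<longlonglongrightarrow> integral {0..T} (\<lambda>r. g r * f r)"
proof (rule LIMSEQ_eventuallyI)
  fix e :: real assume e: "e > 0"
  obtain R where R: "R > 0" "\<And>r. r \<in> {0..T} \<Longrightarrow> \<bar>f r\<bar> \<le> R"
    using continuous_on_Icc_bounded[OF f] by blast
  \<comment> \<open>Each cell contributes an error of at most \<open>d * R * (T / 2 ^ n)\<close>;
    over all cells this is \<open>d * R * T\<close>, that is \<open>e / 2\<close>.\<close>
  define d where "d = e / (2 * T * R)"
  have d: "d > 0" using e T R by (simp add: d_def)
  have gf: "continuous_on {0..T} (\<lambda>r. g r * f r)"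
    using g f by (intro continuous_intros)
  from approx_on_cellsD[OF c d]
  show "\<forall>\<^sub>F n in sequentially. norm ((\<Sum>k<2^n. c n k * integral {grid T n k..grid T n (Suc k)} f)
      - integral {0..T} (\<lambda>r. g r * f r)) < e"
  proof eventually_elim
    case (elim n)
    have "norm (c n k * integral {grid T n k..grid T n (Suc k)} f
        - integral {grid T n k..grid T n (Suc k)} (\<lambda>r. g r * f r)) \<le> d * R * (T / 2 ^ n)"
      if k: "k < 2 ^ n" for k
    proof -
      let ?S = "{grid T n k..grid T n (Suc k)}"
      have sub: "?S \<subseteq> {0..T}" using grid_cell_subset T k by simp
      have i: "f integrable_on ?S" "(\<lambda>r. g r * f r) integrable_on ?S"
        using continuous_on_subset[OF f sub] continuous_on_subset[OF gf sub]
        by (auto intro: integrable_continuous_real)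
      have "c n k * integral ?S f - integral ?S (\<lambda>r. g r * f r)
          = integral ?S (\<lambda>r. (c n k - g r) * f r)"
        using Henstock_Kurzweil_Integration.integral_diff[OF integrable_on_mult_right[OF i(1), of "c n k"] i(2)]
      by (simp add: left_diff_distrib)
      also have "norm \<dots> \<le> d * R * (grid T n (Suc k) - grid T n k)"
      proof (rule integral_bound)
        show "grid T n k \<le> grid T n (Suc k)" using grid_mono[of T k "Suc k" n] T by simp
        show "continuous_on ?S (\<lambda>r. (c n k - g r) * f r)"
          using continuous_on_subset[OF f sub] continuous_on_subset[OF g sub]
          by (intro continuous_intros)
        fix r assume "r \<in> ?S"
        then have "\<bar>c n k - g r\<bar> \<le> d" "\<bar>f r\<bar> \<le> R" using elim k sub R(2)
          by (auto intro: less_imp_le)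
        then show "norm ((c n k - g r) * f r) \<le> d * R"
          using d by (auto simp: abs_mult intro!: mult_mono)
      qed
      finally show ?thesis by (simp add: grid_Suc)
    qed
    then have "norm (\<Sum>k<2^n. c n k * integral {grid T n k..grid T n (Suc k)} f
        - integral {grid T n k..grid T n (Suc k)} (\<lambda>r. g r * f r)) \<le> (\<Sum>k<(2::nat)^n. d * R * (T / 2 ^ n))"
      by (intro order_trans[OF norm_sum] sum_mono) auto
    also have "\<dots> = d * R * T" by simp
    also have "\<dots> < e" using e T R by (simp add: d_def)
    finally show ?case
      using sum_integral_cells[OF integrable_continuous_real[OF gf], of "2^n" n] T by (simp add: sum_subtractf)
  qed
qed

corollary riemann_sum_tendsto:
  assumes c: "approx_on_cells T c g" and g: "continuous_on {0..T} g" and T: "0 < T"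
  shows "(\<lambda>n. \<Sum>k<2^n. c n k * (T / 2 ^ n)) \<longlonglongrightarrow> integral {0..T} g"
  using weighted_integral_sum_tendsto[OF c g, of "\<lambda>_. 1"] T
  by (simp add: grid_Suc)

section \<open>Pathwise quadratic variation and the Foellmer integral\<close>

text \<open>The array \<open>u\<close> holds the increments on level \<open>n\<close>, and up to
  every rational fraction \<open>i / m\<close> of \<open>T\<close> their squares add up to elapsed
  time in the limit. This is a countable family of conditions, so it can hold almost surely, and it
  suffices for weights that are step functions.\<close>

definition unit_quadratic_variation :: "real \<Rightarrow> (nat \<Rightarrow> nat \<Rightarrow> real) \<Rightarrow> bool" where
  "unit_quadratic_variation T u \<longleftrightarrow>
     (\<forall>m>0. \<forall>i\<le>m. (\<lambda>n. \<Sum>k<(i * 2^n) div m. (u n k)\<^sup>2 - T / 2 ^ n) \<longlonglongrightarrow> 0)"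

lemma unit_quadratic_variationD:
  "unit_quadratic_variation T u \<Longrightarrow> (m::nat) > 0 \<Longrightarrow> i \<le> m \<Longrightarrow>
    (\<lambda>n. \<Sum>k<(i * 2^n) div m. (u n k)\<^sup>2 - T / 2 ^ n) \<longlonglongrightarrow> 0"
  by (simp add: unit_quadratic_variation_def)

lemma sum_blocks:
  fixes f :: "nat \<Rightarrow> real"
  assumes "mono p" "p 0 = 0"
  shows "(\<Sum>k<p J. f k) = (\<Sum>j<J. \<Sum>k=p j..<p (Suc j). f k)"
proof (induction J)
  case (Suc J)
  have "{..<p (Suc J)} = {..<p J} \<union> {p J..<p (Suc J)}"
    using monoD[OF assms(1), of J "Suc J"] by auto
  then have "(\<Sum>k<p (Suc J). f k) = (\<Sum>k<p J. f k) + (\<Sum>k=p J..<p (Suc J). f k)"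
    by (simp add: sum.union_disjoint ivl_disj_int)
  then show ?case using Suc by simp
qed (simp add: assms)

lemma sum_diff_ivl:
  fixes f :: "nat \<Rightarrow> real"
  assumes "i \<le> j"
  shows "(\<Sum>k=i..<j. f k) = (\<Sum>k<j. f k) - (\<Sum>k<i. f k)"
proof -
  have "{..<j} = {..<i} \<union> {i..<j}" using assms by auto
  then show ?thesis by (simp add: sum.union_disjoint ivl_disj_int)
qed

lemma quadratic_variation_deviation_tendsto_0:
  assumes u: "unit_quadratic_variation T u" and c: "approx_on_cells T c g"
    and g: "continuous_on {0..T} g" and T: "0 < T"
  shows "(\<lambda>n. \<Sum>k<2^n. c n k * ((u n k)\<^sup>2 - T / 2 ^ n)) \<longlonglongrightarrow> 0"
proof (rule LIMSEQ_eventuallyI)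
  fix e :: real assume e: "e > 0"
  define \<epsilon> where "\<epsilon> = e / (4 * (2 * T + 1))"
  have \<epsilon>: "\<epsilon> > 0" using e T by (simp add: \<epsilon>_def)
  have "uniformly_continuous_on {0..T} g"
    using g by (intro compact_uniformly_continuous) auto
  then obtain d where d: "d > 0"
    "\<And>r s. r \<in> {0..T} \<Longrightarrow> s \<in> {0..T} \<Longrightarrow> dist s r < d \<Longrightarrow> dist (g s) (g r) < \<epsilon>"
    using \<epsilon> unfolding uniformly_continuous_on_def by metis
  obtain m0 :: nat where "T / d < m0" using reals_Archimedean2 by blast
  moreover have "0 < T / d" using d(1) T by simp
  ultimately have "0 < real m0" by linarith
  with \<open>T / d < m0\<close> obtain m :: nat where m: "m > 0" "T / m < d"
    using d(1) by (intro that[of m0]) (auto simp: field_simps)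
  \<comment> \<open>Block \<open>j\<close> consists of the cells from \<open>p n j\<close> up to,
    but not including, \<open>p n (Suc j)\<close>; the rounding is the one in
    \<open>unit_quadratic_variation\<close>.\<close>
  define p where "p n j = (j * 2^n) div m" for n j :: nat
  have p: "mono (p n)" "p n 0 = 0" "p n m = 2 ^ n" for n
    using m by (auto simp: p_def mono_def intro!: div_le_mono)
  define v where "v n k = (u n k)\<^sup>2 - T / 2 ^ n" for n k
  have pre: "(\<lambda>n. \<Sum>k<p n j. v n k) \<longlonglongrightarrow> 0" if "j \<le> m" for j
    using unit_quadratic_variationD[OF u m(1) that] by (simp add: p_def v_def)
  have blk: "(\<lambda>n. \<Sum>k=p n j..<p n (Suc j). v n k) \<longlonglongrightarrow> 0" if "j < m" for j
    using tendsto_diff[OF pre[of "Suc j"] pre[of j]] that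
    by (simp add: sum_diff_ivl monoD[OF p(1)])
  have "(\<lambda>n. \<Sum>j<m. g (T * j / m) * (\<Sum>k=p n j..<p n (Suc j). v n k))
      \<longlonglongrightarrow> (\<Sum>j<m. g (T * j / m) * 0)"
    by (intro tendsto_sum tendsto_mult tendsto_const blk) auto
  then have main: "\<forall>\<^sub>F n in sequentially.
      \<bar>\<Sum>j<m. g (T * j / m) * (\<Sum>k=p n j..<p n (Suc j). v n k)\<bar> < e / 2"
    using e by (auto dest!: tendstoD[where e="e/2"] simp: dist_real_def)
  have tot: "\<forall>\<^sub>F n in sequentially. \<bar>\<Sum>k<2^n. v n k\<bar> < 1"
    using tendstoD[OF pre[of m] zero_less_one] by (simp add: p dist_real_def)
  show "\<forall>\<^sub>F n in sequentially. norm ((\<Sum>k<2^n. c n k * ((u n k)\<^sup>2 - T / 2 ^ n)) - 0) < e"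
    unfolding v_def[symmetric]
    using main tot approx_on_cellsD[OF c \<epsilon>] eventually_mesh_less[OF d(1), of T]
  proof eventually_elim
    case (elim n)
    \<comment> \<open>One \<open>\<epsilon>\<close> pays for moving from \<open>c n k\<close> to
      \<open>g\<close> at the grid point, the other for moving on to the start of the block. Because
      of the rounding, the first grid point may precede \<open>T * j / m\<close> by less than one
      mesh width, so both \<open>T / m\<close> and the mesh must be below \<open>d\<close>.\<close>
    have close: "\<bar>c n k - g (T * j / m)\<bar> \<le> 2 * \<epsilon>"
      if j: "j < m" and k: "k \<in> {p n j..<p n (Suc j)}" for j k
    proof -
      have "k < p n m" using k monoD[OF p(1), of "Suc j" m n] j by auto
      then have kn: "k < 2 ^ n" using p by simp
      have "j * 2 ^ n < m * Suc k"
      proof -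
        have "(j * 2^n) div m < Suc k" using k by (simp add: p_def)
        then show ?thesis using m(1) by (simp add: div_less_iff_less_mult mult.commute)
      qed
      then have lo: "real j * 2 ^ n < m * (k + 1)"
        by (simp flip: of_nat_less_iff[where 'a=real] add: algebra_simps)
      have "k * m \<le> Suc j * 2 ^ n"
      proof -
        have "k \<le> (Suc j * 2^n) div m" using k by (simp add: p_def)
        then show ?thesis using m(1) by (simp add: less_eq_div_iff_mult_less_eq)
      qed
      then have hi: "real k * m \<le> (j + 1) * 2 ^ n"
        by (simp flip: of_nat_le_iff[where 'a=real] add: algebra_simps)
      have "T * j / m < grid T n k + T / 2 ^ n"
        using lo T m(1) mult_strict_left_mono[OF lo T] by (simp add: grid_def field_simps)
      moreover have "grid T n k \<le> T * j / m + T / m"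
        using mult_left_mono[OF hi less_imp_le[OF T]] m(1) by (simp add: grid_def field_simps)
      ultimately have dd: "dist (T * j / m) (grid T n k) < d"
        using m(2) elim(4) by (simp add: dist_real_def abs_if)
      have "T * j / m \<in> {0..T}" "grid T n k \<in> {0..T}"
        using T m j kn grid_le[of T k n] by (auto simp: field_simps)
      from d(2)[OF this(2,1) dd] have "\<bar>g (T * j / m) - g (grid T n k)\<bar> < \<epsilon>"
        by (simp add: dist_real_def)
      moreover have "\<bar>c n k - g (grid T n k)\<bar> < \<epsilon>"
        using elim(3) kn grid_mono[of T k "Suc k" n] T by auto
      ultimately show ?thesis by linarith
    qed
    have "\<bar>\<Sum>j<m. \<Sum>k=p n j..<p n (Suc j). (c n k - g (T * j / m)) * v n k\<bar>
        \<le> (\<Sum>j<m. \<Sum>k=p n j..<p n (Suc j). 2 * \<epsilon> * ((u n k)\<^sup>2 + T / 2 ^ n))"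
    proof (intro order_trans[OF sum_abs] sum_mono)
      fix j k assume "j \<in> {..<m}" "k \<in> {p n j..<p n (Suc j)}"
      then have "\<bar>c n k - g (T * j / m)\<bar> \<le> 2 * \<epsilon>" using close by auto
      moreover have "\<bar>v n k\<bar> \<le> (u n k)\<^sup>2 + T / 2 ^ n"
        using T by (auto simp: v_def abs_le_iff)
      ultimately show "\<bar>(c n k - g (T * j / m)) * v n k\<bar> \<le> 2 * \<epsilon> * ((u n k)\<^sup>2 + T / 2 ^ n)"
        unfolding abs_mult by (intro mult_mono) auto
    qed
    also have "\<dots> = 2 * \<epsilon> * (\<Sum>k<2^n. (u n k)\<^sup>2 + T / 2 ^ n)"
      using sum_blocks[OF p(1)[of n] p(2)[of n], of "\<lambda>k. 2 * \<epsilon> * ((u n k)\<^sup>2 + T / 2 ^ n)" m]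
      by (simp add: p sum_distrib_left)
    also have "(\<Sum>k<2^n. (u n k)\<^sup>2 + T / 2 ^ n) = (\<Sum>k<2^n. v n k) + 2 * T"
      by (simp add: v_def sum.distrib sum_subtractf)
    also have "2 * \<epsilon> * ((\<Sum>k<2^n. v n k) + 2 * T) \<le> 2 * \<epsilon> * (1 + 2 * T)"
      using elim(2) \<epsilon> by (intro mult_left_mono) auto
    also have "\<dots> = e / 2" using T by (simp add: \<epsilon>_def field_simps)
    finally have "\<bar>\<Sum>j<m. \<Sum>k=p n j..<p n (Suc j). (c n k - g (T * j / m)) * v n k\<bar> \<le> e / 2" .
    moreover have "(\<Sum>k<2^n. c n k * v n k)
        = (\<Sum>j<m. \<Sum>k=p n j..<p n (Suc j). (c n k - g (T * j / m)) * v n k)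
        + (\<Sum>j<m. g (T * j / m) * (\<Sum>k=p n j..<p n (Suc j). v n k))"
      using sum_blocks[OF p(1)[of n] p(2)[of n], of "\<lambda>k. c n k * v n k" m]
      by (simp add: p sum_distrib_left left_diff_distrib sum_subtractf)
    ultimately show ?case using elim(1) by simp
  qed
qed

corollary quadratic_variation_sum_tendsto:
  assumes u: "unit_quadratic_variation T u" and c: "approx_on_cells T c g"
    and g: "continuous_on {0..T} g" and T: "0 < T"
  shows "(\<lambda>n. \<Sum>k<2^n. c n k * (u n k)\<^sup>2) \<longlonglongrightarrow> integral {0..T} g"
  using tendsto_add[OF quadratic_variation_deviation_tendsto_0[OF assms] riemann_sum_tendsto[OF c g T]]
  by (simp add: right_diff_distrib sum_subtractf)

text \<open>Squaring adds cross terms and squared drifts. In total they are of order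
  \<open>sup \<bar>u\<bar> * B * T\<close> and \<open>B * B * T\<close> times the mesh, and both
  vanish.\<close>

lemma unit_quadratic_variation_add_drift:
  assumes u: "unit_quadratic_variation T u" and T: "0 < T"
    and small: "\<And>e. e > 0 \<Longrightarrow> \<forall>\<^sub>F n in sequentially. \<forall>k<2^n. \<bar>u n k\<bar> < e"
    and b: "\<forall>\<^sub>F n in sequentially. \<forall>k<2^n. \<bar>b n k\<bar> \<le> B"
  shows "unit_quadratic_variation T (\<lambda>n k. u n k + b n k * (T / 2 ^ n))"
  unfolding unit_quadratic_variation_def
proof (intro allI impI)
  fix m i :: nat assume m: "0 < m" "i \<le> m"
  \<comment> \<open>Enlarging the bound to at least 1 makes it positive, so that it may be divided
    by.\<close>
  define B' where "B' = max B 1"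
  have B': "B' > 0" "\<forall>\<^sub>F n in sequentially. \<forall>k<2^n. \<bar>b n k\<bar> \<le> B'"
    using b by (auto simp: B'_def elim!: eventually_mono)
  have "(\<lambda>n. \<Sum>k<(i * 2^n) div m. 2 * u n k * (b n k * (T / 2 ^ n)) + (b n k * (T / 2 ^ n))\<^sup>2) \<longlonglongrightarrow> 0"
  proof (rule LIMSEQ_eventuallyI)
    fix e :: real assume e: "e > 0"
    \<comment> \<open>A summand is at most \<open>3 * d * B'\<close> times the mesh: two parts from
      the cross term and one from the squared drift, where \<open>B'\<close> times the mesh is below
      \<open>d\<close>. The sum is then at most \<open>e / 2\<close>.\<close>
    define d where "d = e / (2 * (3 * T * B'))"
    have d: "d > 0" using e T B' by (simp add: d_def)
    show "\<forall>\<^sub>F n in sequentially. norm ((\<Sum>k<(i * 2^n) div m.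
        2 * u n k * (b n k * (T / 2 ^ n)) + (b n k * (T / 2 ^ n))\<^sup>2) - 0) < e"
      using small[OF d] B'(2) eventually_mesh_less[OF divide_pos_pos[OF d B'(1)], of T]
    proof eventually_elim
      case (elim n)
      have le: "(i * 2^n) div m \<le> 2 ^ n"
        using m by (metis div_le_mono mult_le_mono1 nonzero_mult_div_cancel_left not_gr_zero)
      let ?h = "T / 2 ^ n"
      have "norm (\<Sum>k<(i * 2^n) div m. 2 * u n k * (b n k * ?h) + (b n k * ?h)\<^sup>2)
          \<le> (\<Sum>k<(i * 2^n) div m. 3 * d * B' * ?h)"
      proof (intro order_trans[OF norm_sum] sum_mono)
        fix k assume "k \<in> {..<(i * 2^n) div m}"
        then have k: "k < 2 ^ n" using le by auto
        have h: "0 < ?h" "B' * ?h < d"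
          using T elim(3) B'(1) by (auto simp: pos_less_divide_eq mult.commute)
        have bh: "\<bar>b n k * ?h\<bar> \<le> B' * ?h"
          unfolding abs_mult abs_of_pos[OF h(1)] using elim(2) k h(1) by (intro mult_right_mono) auto
        have "\<bar>2 * u n k * (b n k * ?h)\<bar> \<le> 2 * d * (B' * ?h)"
          unfolding abs_mult[of "2 * u n k"] using elim(1) k bh d by (intro mult_mono) auto
        moreover have "\<bar>(b n k * ?h)\<^sup>2\<bar> \<le> d * (B' * ?h)"
          unfolding power2_eq_square abs_mult[of "b n k * ?h"]
          using bh h(2) d by (intro mult_mono) linarith+
        ultimately show "norm (2 * u n k * (b n k * ?h) + (b n k * ?h)\<^sup>2) \<le> 3 * d * B' * ?h"
        proof -
          have *: "\<bar>p + q\<bar> \<le> 3 * r" if "\<bar>p\<bar> \<le> 2 * r" "\<bar>q\<bar> \<le> r" for p q r :: real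
            using that by linarith
          assume "\<bar>2 * u n k * (b n k * ?h)\<bar> \<le> 2 * d * (B' * ?h)" "\<bar>(b n k * ?h)\<^sup>2\<bar> \<le> d * (B' * ?h)"
          then show ?thesis
            unfolding real_norm_def mult.assoc by (rule *)
        qed
      qed
      also have "\<dots> = real ((i * 2^n) div m) * (3 * d * B' * ?h)" by simp
      also have "\<dots> \<le> 2 ^ n * (3 * d * B' * ?h)"
      proof (rule mult_right_mono)
        show "real ((i * 2^n) div m) \<le> 2 ^ n"
          using le by (metis of_nat_le_iff of_nat_numeral of_nat_power)
      qed (use d B' T in auto)
      also have "\<dots> = e / 2" using T B' by (simp add: d_def)
      finally show ?case using e by simp
    qed
  qed
  from tendsto_add[OF unit_quadratic_variationD[OF u m] this]
  show "(\<lambda>n. \<Sum>k<(i * 2^n) div m. (u n k + b n k * (T / 2 ^ n))\<^sup>2 - T / 2 ^ n) \<longlonglongrightarrow> 0"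
    by (simp add: sum.distrib[symmetric] power2_sum algebra_simps)
qed

lemma second_order_Taylor:
  fixes f f' f'' :: "real \<Rightarrow> real"
  assumes f: "\<And>y. (f has_real_derivative f' y) (at y)" and f': "\<And>y. (f' has_real_derivative f'' y) (at y)"
  obtains z where "min a b \<le> z" "z \<le> max a b" "f b - f a = f' a * (b - a) + f'' z / 2 * (b - a)\<^sup>2"
proof (cases "a = b")
  case False
  define diff where "diff m = (if m = 0 then f else if m = 1 then f' else f'')" for m :: nat
  have "\<exists>t. (if b < a then b < t \<and> t < a else a < t \<and> t < b) \<and>
      f b = (\<Sum>m<2. (diff m a / fact m) * (b - a) ^ m) + (diff 2 t / fact 2) * (b - a)\<^sup>2"
    using False f f' by (intro Taylor[where a="min a b" and b="max a b"]) (auto simp: diff_def less_2_cases_iff)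
  then obtain t where "if b < a then b < t \<and> t < a else a < t \<and> t < b"
      "f b = f a + f' a * (b - a) + f'' t / 2 * (b - a)\<^sup>2"
    by (auto simp: diff_def lessThan_Suc numeral_2_eq_2)
  then show ?thesis using that[of t] by (auto split: if_splits)
qed (auto intro: that)

text \<open>The increments of \<open>Lam\<close> telescope, and the second-order Taylor terms form a
  weighted quadratic variation. The scheme \<open>y\<close> has to approach \<open>Y\<close> only at
  grid points and its increments alone carry the quadratic variation, so the result covers both the
  sampled path and the Euler scheme.\<close>

theorem Foellmer_integral_tendsto:
  fixes lam lam' Lam :: "real \<Rightarrow> real"
  assumes Lam: "\<And>y. (Lam has_real_derivative lam y) (at y)"
    and lam: "\<And>y. (lam has_real_derivative lam' y) (at y)" and cont: "continuous_on UNIV lam'"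
    and Y: "continuous_on {0..T} Y" and T: "0 < T"
    and y: "\<And>e. e > 0 \<Longrightarrow> \<forall>\<^sub>F n in sequentially. \<forall>k\<le>2^n. \<bar>y n k - Y (grid T n k)\<bar> < e"
    and incr: "\<And>n k. k < 2 ^ n \<Longrightarrow> y n (Suc k) - y n k = \<sigma> * u n k"
    and u: "unit_quadratic_variation T u"
  shows "(\<lambda>n. \<Sum>k<2^n. lam (y n k) * (y n (Suc k) - y n k))
    \<longlonglongrightarrow> Lam (Y T) - Lam (Y 0) - \<sigma>\<^sup>2 / 2 * integral {0..T} (\<lambda>r. lam' (Y r))"
proof -
  have "\<exists>z. min (y n k) (y n (Suc k)) \<le> z \<and> z \<le> max (y n k) (y n (Suc k)) \<and>
      Lam (y n (Suc k)) - Lam (y n k) = lam (y n k) * (y n (Suc k) - y n k)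
        + lam' z / 2 * (y n (Suc k) - y n k)\<^sup>2" for n k
    using second_order_Taylor[OF Lam lam, of "y n k" "y n (Suc k)"] by metis
  then obtain z where z: "\<And>n k. min (y n k) (y n (Suc k)) \<le> z n k \<and> z n k \<le> max (y n k) (y n (Suc k))"
    "\<And>n k. Lam (y n (Suc k)) - Lam (y n k) = lam (y n k) * (y n (Suc k) - y n k)
        + lam' (z n k) / 2 * (y n (Suc k) - y n k)\<^sup>2"
    by metis
  have "approx_on_cells T z Y"
    using z(1) by (intro approx_on_cells_between[OF approx_on_cellsI[OF Y T y]]) auto
  then have appr: "approx_on_cells T (\<lambda>n k. lam' (z n k)) (\<lambda>r. lam' (Y r))"
    by (rule approx_on_cells_compose[OF _ Y T cont])
  have cY: "continuous_on {0..T} (\<lambda>r. lam' (Y r))"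
    by (rule continuous_on_compose2[OF cont Y]) auto
  note qv = quadratic_variation_sum_tendsto[OF u appr cY T]
  have ends: "(\<lambda>n. y n 0) \<longlonglongrightarrow> Y 0" "(\<lambda>n. y n (2 ^ n)) \<longlonglongrightarrow> Y T"
  proof -
    show "(\<lambda>n. y n 0) \<longlonglongrightarrow> Y 0"
      using eventually_mono[OF y, of _ "\<lambda>n. \<bar>y n 0 - Y 0\<bar> < _"]
      by (fastforce simp: tendsto_iff dist_real_def)
    show "(\<lambda>n. y n (2 ^ n)) \<longlonglongrightarrow> Y T"
      using eventually_mono[OF y, of _ "\<lambda>n. \<bar>y n (2 ^ n) - Y T\<bar> < _"]
      by (fastforce simp: tendsto_iff dist_real_def)
  qed
  have cL: "isCont Lam a" for a using Lam DERIV_isCont by blast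
  have "(\<lambda>n. Lam (y n (2 ^ n)) - Lam (y n 0) - \<sigma>\<^sup>2 / 2 * (\<Sum>k<2^n. lam' (z n k) * (u n k)\<^sup>2))
    \<longlonglongrightarrow> Lam (Y T) - Lam (Y 0) - \<sigma>\<^sup>2 / 2 * integral {0..T} (\<lambda>r. lam' (Y r))"
    by (intro tendsto_intros qv isCont_tendsto_compose[OF cL] ends)
  moreover have "Lam (y n (2 ^ n)) - Lam (y n 0) - \<sigma>\<^sup>2 / 2 * (\<Sum>k<2^n. lam' (z n k) * (u n k)\<^sup>2)
      = (\<Sum>k<2^n. lam (y n k) * (y n (Suc k) - y n k))" for n
  proof -
    have "Lam (y n (2 ^ n)) - Lam (y n 0) = (\<Sum>k<2^n. Lam (y n (Suc k)) - Lam (y n k))"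
      by (rule sum_lessThan_telescope[of "\<lambda>k. Lam (y n k)", symmetric])
    also have "\<dots> = (\<Sum>k<2^n. lam (y n k) * (y n (Suc k) - y n k) + \<sigma>\<^sup>2 / 2 * (lam' (z n k) * (u n k)\<^sup>2))"
      unfolding z(2) by (intro sum.cong) (auto simp: incr power_mult_distrib)
    finally show ?thesis by (simp add: sum.distrib sum_distrib_left)
  qed
  ultimately show ?thesis by simp
qed

section \<open>The Girsanov exponent and the Euler scheme\<close>

definition girsanov_exponent :: "real \<Rightarrow> (real \<Rightarrow> real) \<Rightarrow> real \<Rightarrow> nat \<Rightarrow> (nat \<Rightarrow> real) \<Rightarrow> real" where
  "girsanov_exponent \<sigma> lam h N y =
     (\<Sum>k<N. lam (y k) * (y (Suc k) - y k) / \<sigma>\<^sup>2 - h * (lam (y k))\<^sup>2 / (2 * \<sigma>\<^sup>2))"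

text \<open>Divided by \<open>\<sigma>\<^sup>2\<close>, the Ito correction contributes
  \<open>slope lam / 2\<close> to the integrand; the compensator contributes
  \<open>- lam\<^sup>2 / (2 * \<sigma>\<^sup>2)\<close>. Their sum is \<open>Psi0\<close>.\<close>

theorem girsanov_exponent_tendsto:
  fixes lam Lam :: "real \<Rightarrow> real"
  assumes Lam: "\<And>y. (Lam has_real_derivative lam y) (at y)"
    and lam: "\<And>y. (lam has_real_derivative deriv lam y) (at y)" and cont: "continuous_on UNIV (deriv lam)"
    and Y: "continuous_on {0..T} Y" and T: "0 < T" and \<sigma>: "\<sigma> > 0"
    and y: "\<And>e. e > 0 \<Longrightarrow> \<forall>\<^sub>F n in sequentially. \<forall>k\<le>2^n. \<bar>y n k - Y (grid T n k)\<bar> < e"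
    and incr: "\<And>n k. k < 2 ^ n \<Longrightarrow> y n (Suc k) - y n k = \<sigma> * u n k"
    and u: "unit_quadratic_variation T u"
  shows "(\<lambda>n. girsanov_exponent \<sigma> lam (T / 2 ^ n) (2 ^ n) (y n))
    \<longlonglongrightarrow> (Lam (Y T) - Lam (Y 0)) / \<sigma>\<^sup>2 + integral {0..T} (\<lambda>r. Psi0 \<sigma> lam (Y r))"
proof -
  have cl: "continuous_on UNIV lam" using lam DERIV_isCont by (blast intro: continuous_at_imp_continuous_on)
  have l2: "continuous_on UNIV (\<lambda>v. (lam v)\<^sup>2)" using cl by (intro continuous_intros)
  have cY: "continuous_on {0..T} (\<lambda>r. (lam (Y r))\<^sup>2)" "continuous_on {0..T} (\<lambda>r. deriv lam (Y r))"
    using continuous_on_compose2[OF l2 Y] continuous_on_compose2[OF cont Y] by auto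
  have clY: "continuous_on {0..T} (\<lambda>r. lam (Y r))" by (rule continuous_on_compose2[OF cl Y]) auto
  have R: "(\<lambda>n. \<Sum>k<2^n. (lam (y n k))\<^sup>2 * (T / 2 ^ n)) \<longlonglongrightarrow> integral {0..T} (\<lambda>r. (lam (Y r))\<^sup>2)"
    by (rule riemann_sum_tendsto[OF approx_on_cells_compose[OF approx_on_cellsI(1)[OF Y T y] Y T l2] cY(1) T])
  note F = Foellmer_integral_tendsto[OF Lam lam cont Y T y incr u]
  have "(\<lambda>n. (\<Sum>k<2^n. lam (y n k) * (y n (Suc k) - y n k)) / \<sigma>\<^sup>2
        - (\<Sum>k<2^n. (lam (y n k))\<^sup>2 * (T / 2 ^ n)) / (2 * \<sigma>\<^sup>2))
    \<longlonglongrightarrow> (Lam (Y T) - Lam (Y 0) - \<sigma>\<^sup>2 / 2 * integral {0..T} (\<lambda>r. deriv lam (Y r))) / \<sigma>\<^sup>2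
        - integral {0..T} (\<lambda>r. (lam (Y r))\<^sup>2) / (2 * \<sigma>\<^sup>2)"
    using \<sigma> by (intro tendsto_intros F R) auto
  moreover have "integral {0..T} (\<lambda>r. Psi0 \<sigma> lam (Y r))
      = - integral {0..T} (\<lambda>r. deriv lam (Y r)) / 2 - integral {0..T} (\<lambda>r. (lam (Y r))\<^sup>2) / (2 * \<sigma>\<^sup>2)"
  proof -
    have "integral {0..T} (\<lambda>r. (- 1 / 2) * deriv lam (Y r) - (1 / (2 * \<sigma>\<^sup>2)) * (lam (Y r))\<^sup>2)
      = integral {0..T} (\<lambda>r. (- 1 / 2) * deriv lam (Y r)) - integral {0..T} (\<lambda>r. (1 / (2 * \<sigma>\<^sup>2)) * (lam (Y r))\<^sup>2)"
      using cY clY by (intro Henstock_Kurzweil_Integration.integral_diff integrable_continuous_real continuous_intros)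
    then show ?thesis by (simp add: Psi0_def slope_def)
  qed
  moreover have "girsanov_exponent \<sigma> lam (T / 2 ^ n) (2 ^ n) (y n)
      = (\<Sum>k<2^n. lam (y n k) * (y n (Suc k) - y n k)) / \<sigma>\<^sup>2
        - (\<Sum>k<2^n. (lam (y n k))\<^sup>2 * (T / 2 ^ n)) / (2 * \<sigma>\<^sup>2)" for n
    by (simp add: girsanov_exponent_def sum_subtractf sum_divide_distrib mult.commute)
  moreover have "(Lam (Y T) - Lam (Y 0) - \<sigma>\<^sup>2 / 2 * I1) / \<sigma>\<^sup>2 - I2 / (2 * \<sigma>\<^sup>2)
      = (Lam (Y T) - Lam (Y 0)) / \<sigma>\<^sup>2 + (- I1 / 2 - I2 / (2 * \<sigma>\<^sup>2))" for I1 I2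
    using \<sigma> by (simp add: diff_divide_distrib)
  ultimately show ?thesis by (simp only:)
qed

primrec euler :: "real \<Rightarrow> (real \<Rightarrow> real) \<Rightarrow> real \<Rightarrow> real \<Rightarrow> (real \<Rightarrow> real) \<Rightarrow> nat \<Rightarrow> nat \<Rightarrow> real" where
  "euler \<sigma> lam x T W n 0 = x"
| "euler \<sigma> lam x T W n (Suc k) = euler \<sigma> lam x T W n k + lam (euler \<sigma> lam x T W n k) * (T / 2 ^ n)
     + \<sigma> * (W (grid T n (Suc k)) - W (grid T n k))"

text \<open>For small mesh \<open>h\<close> the map \<open>v \<mapsto> v + h * lam v\<close> is
  non-expansive near the path: the decreasing drift pulls two points together, and a local Lipschitz
  constant prevents them from overshooting. The noise increments cancel, so the local errors merely
  add up.\<close>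

theorem euler_converges:
  assumes lam: "\<And>y. (lam has_real_derivative deriv lam y) (at y)" and cont: "continuous_on UNIV (deriv lam)"
    and decr: "\<And>y z. y \<le> z \<Longrightarrow> lam z \<le> lam y"
    and X: "continuous_on {0..T} X" and T: "0 < T" and W0: "W 0 = 0"
    and eq: "\<And>t. t \<in> {0..T} \<Longrightarrow> X t = x + integral {0..t} (\<lambda>s. lam (X s)) + \<sigma> * W t"
    and e: "e > 0"
  shows "\<forall>\<^sub>F n in sequentially. \<forall>k\<le>2^n. \<bar>euler \<sigma> lam x T W n k - X (grid T n k)\<bar> < e"
proof -
  have cl: "continuous_on UNIV lam" using lam DERIV_isCont by (blast intro: continuous_at_imp_continuous_on)
  have clX: "continuous_on {0..T} (\<lambda>s. lam (X s))" by (rule continuous_on_compose2[OF cl X]) auto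
  obtain R where R: "R > 0" "\<And>r. r \<in> {0..T} \<Longrightarrow> \<bar>X r\<bar> \<le> R"
    using continuous_on_Icc_bounded[OF X] by blast
  \<comment> \<open>The interval exceeds the range of \<open>X\<close> by 1 on each side; the
    induction below keeps the scheme within distance 1 of \<open>X\<close>, so \<open>L\<close>
    applies to both arguments.\<close>
  obtain L where L: "L > 0" "\<And>v. v \<in> {-R-1..R+1} \<Longrightarrow> \<bar>deriv lam v\<bar> \<le> L"
    using continuous_on_Icc_bounded[OF continuous_on_subset[OF cont subset_UNIV]] by blast
  have lip: "\<bar>lam v - lam w\<bar> \<le> L * \<bar>v - w\<bar>" if "v \<in> {-R-1..R+1}" "w \<in> {-R-1..R+1}" for v w
    using field_differentiable_bound[of "{-R-1..R+1}" lam "deriv lam" L v w] that L lam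
    by (auto intro: has_field_derivative_at_within simp: norm_minus_commute abs_minus_commute)
  \<comment> \<open>The accumulated error is at most \<open>T * d\<close>. It must be below
    \<open>e\<close> for the claim and below 1 for staying in the region where \<open>L\<close> is
    valid.\<close>
  define d where "d = min e 1 / (2 * T)"
  have d: "d > 0" "T * d < e" "T * d < 1" using e T by (auto simp: d_def min_def)
  show ?thesis
    using approx_on_cellsD[OF approx_on_cells_grid[OF clX T] d(1)]
      eventually_mesh_less[of "1 / L" T, OF divide_pos_pos[OF zero_less_one L(1)]]
  proof eventually_elim
    case (elim n)
    let ?Y = "euler \<sigma> lam x T W n" and ?h = "T / 2 ^ n"
    have h: "?h > 0" "?h * L < 1" using T elim(2) L(1) by (auto simp: field_simps)
    \<comment> \<open>A bound that grows linearly in \<open>k\<close>, with one local error of size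
      \<open>?h * d\<close> per step; at every \<open>k\<close> it implies the distance 1 needed for
      the next step.\<close>
    have bound: "k \<le> 2 ^ n \<Longrightarrow> \<bar>?Y k - X (grid T n k)\<bar> \<le> real k * ?h * d" for k
    proof (induction k)
      case 0
      then show ?case using eq[of 0] T W0 by simp
    next
      case (Suc k)
      then have k: "k < 2 ^ n" and IH: "\<bar>?Y k - X (grid T n k)\<bar> \<le> real k * ?h * d" by auto
      let ?S = "{grid T n k..grid T n (Suc k)}"
      have sub: "?S \<subseteq> {0..T}" using grid_cell_subset T k by simp
      have mono: "grid T n k \<le> grid T n (Suc k)" using grid_mono[of T k "Suc k" n] T by simp
      have "real k * ?h * d \<le> 2 ^ n * ?h * d"
      proof -
        have "real k \<le> 2 ^ n" using k by (metis less_imp_le of_nat_le_iff of_nat_numeral of_nat_power)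
        then show ?thesis using h(1) d(1) by (intro mult_right_mono) auto
      qed
      also have "2 ^ n * ?h * d = T * d" by simp
      finally have small: "\<bar>?Y k - X (grid T n k)\<bar> \<le> 1" using IH d(3) by linarith
      have XR: "\<bar>X (grid T n k)\<bar> \<le> R" using R(2) sub mono by auto
      have ins: "?Y k \<in> {-R-1..R+1}" "X (grid T n k) \<in> {-R-1..R+1}" using small XR by auto
      have lipk: "\<bar>lam (?Y k) - lam (X (grid T n k))\<bar> * ?h \<le> \<bar>?Y k - X (grid T n k)\<bar>"
      proof -
        have "\<bar>lam (?Y k) - lam (X (grid T n k))\<bar> * ?h \<le> (L * \<bar>?Y k - X (grid T n k)\<bar>) * ?h"
          using lip[OF ins] h(1) by (intro mult_right_mono) auto
        also have "\<dots> = (?h * L) * \<bar>?Y k - X (grid T n k)\<bar>" by simp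
        also have "\<dots> \<le> 1 * \<bar>?Y k - X (grid T n k)\<bar>" using h(2) by (intro mult_right_mono) auto
        finally show ?thesis by simp
      qed
      \<comment> \<open>The drift difference has the opposite sign to the position difference and,
        by \<open>lipk\<close>, is no larger, so adding it cannot increase the distance.\<close>
      have contr: "\<bar>(?Y k - X (grid T n k)) + (lam (?Y k) - lam (X (grid T n k))) * ?h\<bar>
          \<le> \<bar>?Y k - X (grid T n k)\<bar>"
      proof (cases "?Y k \<le> X (grid T n k)")
        case True
        have "0 \<le> (lam (?Y k) - lam (X (grid T n k))) * ?h"
          using decr[OF True] h(1) by (intro mult_nonneg_nonneg) auto
        moreover have "(lam (?Y k) - lam (X (grid T n k))) * ?h \<le> X (grid T n k) - ?Y k"
          using lipk True decr[OF True]
          by (simp only: abs_of_nonneg abs_of_nonpos diff_ge_0_iff_ge diff_le_0_iff_le minus_diff_eq)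
        ultimately show ?thesis using True by linarith
      next
        case False
        then have le: "X (grid T n k) \<le> ?Y k" by simp
        have "(lam (?Y k) - lam (X (grid T n k))) * ?h \<le> 0"
          using decr[OF le] h(1) by (intro mult_nonpos_nonneg) auto
        moreover have "- ((lam (?Y k) - lam (X (grid T n k))) * ?h) \<le> ?Y k - X (grid T n k)"
          using lipk le unfolding abs_of_nonpos[OF diff_le_0_iff_le[THEN iffD2, OF decr[OF le]]]
          by (simp only: mult_minus_left abs_of_nonneg diff_ge_0_iff_ge)
        ultimately show ?thesis using le by linarith
      qed
      have int: "(\<lambda>s. lam (X s)) integrable_on ?S" "(\<lambda>s. lam (X s)) integrable_on {0..grid T n (Suc k)}"
        using continuous_on_subset[OF clX] sub mono T
        by (intro integrable_continuous_real; force)+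
      have "X (grid T n (Suc k)) - X (grid T n k) = integral ?S (\<lambda>s. lam (X s))
          + \<sigma> * (W (grid T n (Suc k)) - W (grid T n k))"
      proof -
        have "integral {0..grid T n k} (\<lambda>s. lam (X s)) + integral ?S (\<lambda>s. lam (X s))
            = integral {0..grid T n (Suc k)} (\<lambda>s. lam (X s))"
          using int mono T by (intro Henstock_Kurzweil_Integration.integral_combine) auto
        moreover have "grid T n k \<in> {0..T}" "grid T n (Suc k) \<in> {0..T}" using sub mono by auto
        note eq[OF this(1)] eq[OF this(2)]
        ultimately show ?thesis by (simp add: algebra_simps)
      qed
      \<comment> \<open>The old error passes through the non-expansive map; what remains is the
        error of replacing \<open>lam (X s)\<close> by its value at the left end of the
        cell.\<close>
      then have "?Y (Suc k) - X (grid T n (Suc k))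
          = (?Y k - X (grid T n k)) + (lam (?Y k) - lam (X (grid T n k))) * ?h
            + (lam (X (grid T n k)) * ?h - integral ?S (\<lambda>s. lam (X s)))"
        by (simp add: algebra_simps)
      also have "\<bar>\<dots>\<bar> \<le> \<bar>?Y k - X (grid T n k)\<bar> + d * ?h"
      proof -
        have "lam (X (grid T n k)) * ?h - integral ?S (\<lambda>s. lam (X s))
            = integral ?S (\<lambda>s. lam (X (grid T n k)) - lam (X s))"
          using Henstock_Kurzweil_Integration.integral_diff[OF integrable_const_ivl int(1), of "lam (X (grid T n k))"] mono
          by (simp add: grid_Suc mult.commute)
        also have "norm \<dots> \<le> d * (grid T n (Suc k) - grid T n k)"
        proof (rule integral_bound[OF mono])
          show "continuous_on ?S (\<lambda>s. lam (X (grid T n k)) - lam (X s))"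
            using continuous_on_subset[OF clX sub] by (intro continuous_intros)
          show "norm (lam (X (grid T n k)) - lam (X s)) \<le> d" if "s \<in> ?S" for s
            using elim(1) k that by (auto intro: less_imp_le)
        qed
        finally have "\<bar>lam (X (grid T n k)) * ?h - integral ?S (\<lambda>s. lam (X s))\<bar> \<le> d * ?h"
          by (simp add: grid_Suc)
        then show ?thesis by (intro order_trans[OF abs_triangle_ineq] add_mono contr)
      qed
      also have "\<dots> \<le> real (Suc k) * ?h * d"
        using IH by (simp add: algebra_simps add_divide_distrib)
      finally show ?case .
    qed
    show ?case
    proof (intro allI impI)
      fix k :: nat assume k: "k \<le> 2 ^ n"
      have "real k \<le> 2 ^ n" using k by (metis of_nat_le_iff of_nat_numeral of_nat_power)
      then have "real k * ?h * d \<le> 2 ^ n * ?h * d" using h(1) d(1) by (intro mult_right_mono) auto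
      also have "\<dots> = T * d" by simp
      finally show "\<bar>?Y k - X (grid T n k)\<bar> < e" using bound[OF k] d(2) by linarith
    qed
  qed
qed

section \<open>Increments and quadratic variation of Brownian motion\<close>

lemmas real_measurable_intros =
  borel_measurable_sum borel_measurable_add borel_measurable_diff borel_measurable_times borel_measurable_divide
  borel_measurable_power borel_measurable_const

section \<open>Natural filtrations and integration over independent increments\<close>

lemma space_natural_filtration [simp]: "space (natural_filtration M X t) = space M"
  by (simp add: natural_filtration_def)

lemma measurable_natural_filtrationI:
  assumes "g \<in> space N \<rightarrow> space M"
    and "\<And>s. 0 \<le> s \<Longrightarrow> s \<le> t \<Longrightarrow> (\<lambda>w. X s (g w)) \<in> borel_measurable N"
  shows "g \<in> measurable N (natural_filtration M X t)"
  unfolding natural_filtration_def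
proof (rule measurable_vimage_algebra2)
  show "(\<lambda>w. \<lambda>s\<in>{0..t}. X s (g w)) \<in> measurable N (Pi\<^sub>M {0..t} (\<lambda>_. borel))"
    using assms(2) by (intro measurable_restrict) auto
qed (use assms(1) in auto)

lemma measurable_natural_filtration_component:
  assumes "0 \<le> s" "s \<le> t"
  shows "X s \<in> borel_measurable (natural_filtration M X t)"
proof -
  have "(\<lambda>w. \<lambda>s\<in>{0..t}. X s w) \<in> measurable (natural_filtration M X t) (Pi\<^sub>M {0..t} (\<lambda>_. borel))"
    unfolding natural_filtration_def by (rule measurable_vimage_algebra1) (auto simp: space_PiM)
  from measurable_compose[OF this measurable_component_singleton[of s "{0..t}"]] assms
  show ?thesis by simp
qed

lemma measurable_natural_filtration_mono:
  assumes "f \<in> measurable (natural_filtration M X s) N" "s \<le> t"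
  shows "f \<in> measurable (natural_filtration M X t) N"
proof -
  have "(\<lambda>w. w) \<in> measurable (natural_filtration M X t) (natural_filtration M X s)"
    using assms(2) by (intro measurable_natural_filtrationI measurable_natural_filtration_component) auto
  from measurable_compose[OF this assms(1)] show ?thesis .
qed

lemma measurable_from_natural_filtration:
  assumes "f \<in> measurable (natural_filtration M X s) N"
    and "\<And>r. 0 \<le> r \<Longrightarrow> r \<le> s \<Longrightarrow> X r \<in> borel_measurable M"
  shows "f \<in> measurable M N"
proof -
  have "(\<lambda>w. w) \<in> measurable M (natural_filtration M X s)"
    using assms(2) by (intro measurable_natural_filtrationI) auto
  from measurable_compose[OF this assms(1)] show ?thesis .
qed

lemma brownian_motion_measurable [measurable_dest]:
  "brownian_motion M W \<Longrightarrow> 0 \<le> t \<Longrightarrow> W t \<in> borel_measurable M"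
  by (simp add: brownian_motion_def)

lemma brownian_motion_prob_space: "brownian_motion M W \<Longrightarrow> prob_space M"
  by (simp add: brownian_motion_def)

text \<open>Independence makes the joint law of the past and the increment a product, and Tonelli's
  theorem integrates out the Gaussian variable with the past frozen. This takes the place of
  conditional expectations in what follows.\<close>

lemma nn_integral_brownian_increment:
  fixes g :: "'a \<times> real \<Rightarrow> ennreal"
  assumes W: "brownian_motion M W" and st: "0 \<le> s" "s < t"
    and g: "g \<in> borel_measurable (natural_filtration M W s \<Otimes>\<^sub>M borel)"
  shows "(\<integral>\<^sup>+w. g (w, W t w - W s w) \<partial>M)
    = (\<integral>\<^sup>+w. (\<integral>\<^sup>+z. ennreal (normal_density 0 (sqrt (t - s)) z) * g (w, z) \<partial>lborel) \<partial>M)"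
proof -
  interpret prob_space M by (rule brownian_motion_prob_space[OF W])
  define F where "F = natural_filtration M W s"
  define \<xi> where "\<xi> = (\<lambda>w. W t w - W s w)"
  have gF: "g \<in> borel_measurable (F \<Otimes>\<^sub>M borel)" using g by (simp add: F_def)
  have [measurable]: "(\<lambda>w. w) \<in> measurable M F"
    unfolding F_def using W by (intro measurable_natural_filtrationI) (auto simp: brownian_motion_def)
  have \<xi>[measurable]: "\<xi> \<in> borel_measurable M"
    unfolding \<xi>_def using W st by (intro borel_measurable_diff brownian_motion_measurable) auto
  have dens: "distributed M lborel \<xi> (normal_density 0 (sqrt (t - s)))"
    and ind: "indep_set (sets F) (sets (vimage_algebra (space M) \<xi> borel))"
    using W st unfolding brownian_motion_def F_def \<xi>_def by blast+
  interpret \<xi>: prob_space "distr M borel \<xi>" by (rule prob_space_distr) simp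
  interpret F: prob_space "distr M F (\<lambda>w. w)" by (rule prob_space_distr) simp
  \<comment> \<open>The identity map from \<open>M\<close> to the coarser \<open>F\<close>
    represents the past as a random variable; on rectangles the equality is precisely
    independence.\<close>
  have joint: "distr M F (\<lambda>w. w) \<Otimes>\<^sub>M distr M borel \<xi> = distr M (F \<Otimes>\<^sub>M borel) (\<lambda>w. (w, \<xi> w))"
  proof (rule pair_measure_eqI)
    fix A B assume "A \<in> sets (distr M F (\<lambda>w. w))" "B \<in> sets (distr M borel \<xi>)"
    then have A[measurable]: "A \<in> sets F" and B[measurable]: "B \<in> sets borel" by auto
    have AM: "A \<subseteq> space M" using sets.sets_into_space[OF A] by (simp add: F_def)
    have "prob (A \<inter> (\<xi> -` B \<inter> space M)) = prob A * prob (\<xi> -` B \<inter> space M)"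
      using A in_vimage_algebra[OF B] by (intro indep_setD[OF ind])
    moreover have "A \<inter> (\<xi> -` B \<inter> space M) = (\<lambda>w. (w, \<xi> w)) -` (A \<times> B) \<inter> space M"
      "(\<lambda>w. w) -` A \<inter> space M = A" using AM by auto
    ultimately show "emeasure (distr M F (\<lambda>w. w)) A * emeasure (distr M borel \<xi>) B
        = emeasure (distr M (F \<Otimes>\<^sub>M borel) (\<lambda>w. (w, \<xi> w))) (A \<times> B)"
      by (simp add: emeasure_distr emeasure_eq_measure ennreal_mult)
  qed (auto intro: F.sigma_finite_measure_axioms \<xi>.sigma_finite_measure_axioms)
  \<comment> \<open>\<open>distributed\<close> refers to \<open>lborel\<close> as target space; it
    has the same measurable sets as \<open>borel\<close>.\<close>
  have law: "distr M borel \<xi> = density lborel (normal_density 0 (sqrt (t - s)))"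
    using distributed_distr_eq_density[OF dens] by (subst distr_cong[OF refl sets_lborel[symmetric] refl])
  have "(\<integral>\<^sup>+w. g (w, \<xi> w) \<partial>M) = (\<integral>\<^sup>+p. g p \<partial>distr M (F \<Otimes>\<^sub>M borel) (\<lambda>w. (w, \<xi> w)))"
    using gF by (subst nn_integral_distr) auto
  also have "\<dots> = (\<integral>\<^sup>+w. (\<integral>\<^sup>+z. g (w, z) \<partial>distr M borel \<xi>) \<partial>distr M F (\<lambda>w. w))"
    using gF unfolding joint[symmetric] by (intro \<xi>.nn_integral_fst[symmetric]) simp
  also have "\<dots> = (\<integral>\<^sup>+w. (\<integral>\<^sup>+z. g (w, z) \<partial>distr M borel \<xi>) \<partial>M)"
    using gF by (intro nn_integral_distr \<xi>.borel_measurable_nn_integral) (auto simp: case_prod_beta')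
  also have "\<dots> = (\<integral>\<^sup>+w. (\<integral>\<^sup>+z. ennreal (normal_density 0 (sqrt (t - s)) z) * g (w, z) \<partial>lborel) \<partial>M)"
  proof (rule nn_integral_cong)
    fix w assume "w \<in> space M"
    then have "(\<lambda>z. g (w, z)) \<in> borel_measurable borel"
      using gF by (intro measurable_Pair2[of g F borel]) (auto simp: F_def)
    then show "(\<integral>\<^sup>+z. g (w, z) \<partial>distr M borel \<xi>)
      = (\<integral>\<^sup>+z. ennreal (normal_density 0 (sqrt (t - s)) z) * g (w, z) \<partial>lborel)"
      unfolding law by (subst nn_integral_density) auto
  qed
  finally show ?thesis by (simp add: \<xi>_def)
qed

lemma nn_integral_normal_centred_square:
  assumes h: "0 < h"
  shows "(\<integral>\<^sup>+z. ennreal (normal_density 0 (sqrt h) z) * ennreal ((s + (z\<^sup>2 - h))\<^sup>2) \<partial>lborel)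
    = ennreal (s\<^sup>2 + 2 * h\<^sup>2)"
proof -
  have sq: "0 < sqrt h" using h by simp
  let ?\<phi> = "normal_density 0 (sqrt h)"
  have m: "has_bochner_integral lborel ?\<phi> 1" "has_bochner_integral lborel (\<lambda>z. ?\<phi> z * z ^ 2) h"
    "has_bochner_integral lborel (\<lambda>z. ?\<phi> z * z ^ 4) (3 * h\<^sup>2)"
    using normal_moment_even[OF sq, of 0 0] normal_moment_even[OF sq, of 0 1] normal_moment_even[OF sq, of 0 2] h
    by (simp_all add: fact_numeral power_divide)
  have "has_bochner_integral lborel (\<lambda>z. (s - h)\<^sup>2 * ?\<phi> z + 2 * (s - h) * (?\<phi> z * z ^ 2) + ?\<phi> z * z ^ 4)
      ((s - h)\<^sup>2 * 1 + 2 * (s - h) * h + 3 * h\<^sup>2)"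
    by (intro has_bochner_integral_add has_bochner_integral_mult_right m)
  moreover have "(s - h)\<^sup>2 * p + 2 * (s - h) * (p * z ^ 2) + p * z ^ 4 = p * (s + (z\<^sup>2 - h))\<^sup>2" for p z :: real
    by algebra
  moreover have "(s - h)\<^sup>2 * 1 + 2 * (s - h) * h + 3 * h\<^sup>2 = s\<^sup>2 + 2 * h\<^sup>2"
    by algebra
  ultimately have "has_bochner_integral lborel (\<lambda>z. ?\<phi> z * (s + (z\<^sup>2 - h))\<^sup>2) (s\<^sup>2 + 2 * h\<^sup>2)"
    by (simp only:)
  then show ?thesis
    using nn_integral_eq_integral[of lborel "\<lambda>z. normal_density 0 (sqrt h) z * (s + (z\<^sup>2 - h))\<^sup>2"]
    by (simp add: ennreal_mult' has_bochner_integral_iff)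
qed

text \<open>The errors of distinct cells are orthogonal, so every cell adds its variance
  \<open>2 * (T / 2 ^ n)\<^sup>2\<close> to the second moment.\<close>

lemma nn_integral_quadratic_variation_error:
  assumes W: "brownian_motion M W" and T: "0 < T"
  shows "(\<integral>\<^sup>+w. ennreal ((\<Sum>k<j. (W (grid T n (Suc k)) w - W (grid T n k) w)\<^sup>2 - T / 2 ^ n)\<^sup>2) \<partial>M)
    = ennreal (real j * (2 * (T / 2 ^ n)\<^sup>2))"
proof (induction j)
  case (Suc j)
  interpret prob_space M by (rule brownian_motion_prob_space[OF W])
  define h where "h = T / 2 ^ n"
  have h: "h > 0" using T by (simp add: h_def)
  let ?t = "grid T n j"
  have t: "0 \<le> ?t" "?t < grid T n (Suc j)" using T by (auto simp: grid_Suc)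
  define S where "S w = (\<Sum>k<j. (W (grid T n (Suc k)) w - W (grid T n k) w)\<^sup>2 - h)" for w
  have S: "S \<in> borel_measurable (natural_filtration M W ?t)"
    unfolding S_def using T
    by (intro real_measurable_intros
        measurable_natural_filtration_component grid_nonneg grid_mono) auto
  have [measurable]: "S \<in> borel_measurable M"
    using W by (intro measurable_from_natural_filtration[OF S]) (auto simp: brownian_motion_def)
  have "(\<integral>\<^sup>+w. ennreal ((S w + ((W (grid T n (Suc j)) w - W ?t w)\<^sup>2 - h))\<^sup>2) \<partial>M)
      = (\<integral>\<^sup>+w. (\<integral>\<^sup>+z. ennreal (normal_density 0 (sqrt (grid T n (Suc j) - ?t)) z) * ennreal ((S w + (z\<^sup>2 - h))\<^sup>2) \<partial>lborel) \<partial>M)"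
    using nn_integral_brownian_increment[OF W t, of "\<lambda>(w, z). ennreal ((S w + (z\<^sup>2 - h))\<^sup>2)"] S
    by simp
  also have "grid T n (Suc j) - ?t = h" by (simp add: grid_Suc h_def)
  also have "(\<integral>\<^sup>+w. (\<integral>\<^sup>+z. ennreal (normal_density 0 (sqrt h) z) * ennreal ((S w + (z\<^sup>2 - h))\<^sup>2) \<partial>lborel) \<partial>M)
      = (\<integral>\<^sup>+w. ennreal ((S w)\<^sup>2) + ennreal (2 * h\<^sup>2) \<partial>M)"
    by (intro nn_integral_cong) (simp add: nn_integral_normal_centred_square[OF h] ennreal_plus)
  also have "\<dots> = (\<integral>\<^sup>+w. ennreal ((S w)\<^sup>2) \<partial>M) + ennreal (2 * h\<^sup>2)"
    by (subst nn_integral_add) (auto simp: emeasure_space_1)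
  also have "(\<integral>\<^sup>+w. ennreal ((S w)\<^sup>2) \<partial>M) = ennreal (real j * (2 * h\<^sup>2))"
    using Suc.IH by (simp add: S_def h_def)
  also have "\<dots> + ennreal (2 * h\<^sup>2) = ennreal (real (Suc j) * (2 * h\<^sup>2))"
    by (subst ennreal_plus[symmetric]) (auto simp: algebra_simps)
  finally show ?case by (simp add: S_def h_def)
qed simp

text \<open>At most \<open>2 ^ n\<close> cells contribute on level \<open>n\<close>, so the second
  moment of the error is at most \<open>2 * T\<^sup>2 / 2 ^ n\<close>. This is summable in
  \<open>n\<close>; the sum of the squared errors is therefore almost surely finite and its terms
  tend to 0.\<close>

theorem AE_unit_quadratic_variation:
  assumes W: "brownian_motion M W" and T: "0 < T"
  shows "AE w in M. unit_quadratic_variation T (\<lambda>n k. W (grid T n (Suc k)) w - W (grid T n k) w)"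
proof -
  have "AE w in M. (\<lambda>n. \<Sum>k<(i * 2^n) div m. (W (grid T n (Suc k)) w - W (grid T n k) w)\<^sup>2 - T / 2 ^ n) \<longlonglongrightarrow> 0"
    if m: "0 < m" "i \<le> m" for m i :: nat
  proof -
    define S where "S n w = (\<Sum>k<(i * 2^n) div m. (W (grid T n (Suc k)) w - W (grid T n k) w)\<^sup>2 - T / 2 ^ n)" for n w
    have [measurable]: "S n \<in> borel_measurable M" for n
      unfolding S_def using T W
      by (intro real_measurable_intros
          brownian_motion_measurable grid_nonneg) auto
    have "(\<integral>\<^sup>+w. (\<Sum>n. ennreal ((S n w)\<^sup>2)) \<partial>M) = (\<Sum>n. \<integral>\<^sup>+w. ennreal ((S n w)\<^sup>2) \<partial>M)"
      by (rule nn_integral_suminf) simp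
    also have "\<dots> \<le> (\<Sum>n. ennreal (2 * T\<^sup>2 * (1 / 2) ^ n))"
    proof (rule suminf_le)
      fix n
      have le: "(i * 2^n) div m \<le> 2 ^ n"
        using m by (metis div_le_mono mult_le_mono1 nonzero_mult_div_cancel_left not_gr_zero)
      have "real ((i * 2^n) div m) \<le> 2 ^ n"
        using le by (metis of_nat_le_iff of_nat_numeral of_nat_power)
      then have "real ((i * 2^n) div m) * (2 * (T / 2 ^ n)\<^sup>2) \<le> 2 ^ n * (2 * (T / 2 ^ n)\<^sup>2)"
        by (intro mult_right_mono) simp_all
      also have "\<dots> = 2 * T\<^sup>2 * (1 / 2) ^ n" by (simp add: power2_eq_square power_one_over field_simps)
      finally show "(\<integral>\<^sup>+w. ennreal ((S n w)\<^sup>2) \<partial>M) \<le> ennreal (2 * T\<^sup>2 * (1 / 2) ^ n)"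
        unfolding S_def nn_integral_quadratic_variation_error[OF W T] by (rule ennreal_leI)
    qed auto
    also have "\<dots> < \<infinity>"
    proof -
      have "summable (\<lambda>n. 2 * T\<^sup>2 * (1 / 2 :: real) ^ n)" by (intro summable_mult summable_geometric) simp
      then show ?thesis by (subst suminf_ennreal2) (auto simp: top.not_eq_extremum[symmetric])
  qed
  finally have "(\<integral>\<^sup>+w. (\<Sum>n. ennreal ((S n w)\<^sup>2)) \<partial>M) \<noteq> \<infinity>" by simp
  then have "AE w in M. (\<Sum>n. ennreal ((S n w)\<^sup>2)) \<noteq> \<infinity>"
    by (intro nn_integral_PInf_AE) auto
  then have "AE w in M. (\<lambda>n. S n w) \<longlonglongrightarrow> 0"
  proof eventually_elim
    case (elim w)
    then have "summable (\<lambda>n. (S n w)\<^sup>2)" by (intro summable_suminf_not_top) auto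
    then have "(\<lambda>n. sqrt ((S n w)\<^sup>2)) \<longlonglongrightarrow> sqrt 0"
      by (intro tendsto_real_sqrt summable_LIMSEQ_zero)
    then show ?case by (simp add: tendsto_rabs_zero_iff)
  qed
  then show ?thesis
    by (simp add: S_def)
  qed
  \<comment> \<open>The pairs \<open>(m, i)\<close> are countable, so a single null set serves all
    of them.\<close>
  then have "AE w in M. \<forall>m i. 0 < m \<longrightarrow> i \<le> m \<longrightarrow>
      (\<lambda>n. \<Sum>k<(i * 2^n) div m. (W (grid T n (Suc k)) w - W (grid T n k) w)\<^sup>2 - T / 2 ^ n) \<longlonglongrightarrow> 0"
    by (intro AE_all_countable[THEN iffD2] allI AE_impI)
  then show ?thesis by (rule eventually_mono) (simp add: unit_quadratic_variation_def)
qed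

section \<open>Girsanov's theorem for the Euler scheme\<close>

abbreviation sequences :: "(nat \<Rightarrow> real) measure" where
  "sequences \<equiv> Pi\<^sub>M UNIV (\<lambda>_. borel)"

lemma measurable_sequencesI:
  assumes "\<And>k. (\<lambda>\<omega>. f \<omega> k) \<in> borel_measurable N"
  shows "f \<in> measurable N sequences"
proof -
  have "(\<lambda>\<omega> k. f \<omega> k) \<in> measurable N sequences"
    by (rule measurable_PiM_single') (simp_all add: assms PiE_def)
  then show ?thesis .
qed

lemma measurable_sequences_component [measurable]: "(\<lambda>v. v k) \<in> borel_measurable sequences"
  by (rule measurable_component_singleton) simp

text \<open>Padding with 0 after index \<open>j\<close> puts histories of every length into the one
  space \<open>sequences\<close> and keeps them measurable with respect to the past of the
  \<open>j\<close>-th grid time.\<close>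

definition stopped_sequence :: "nat \<Rightarrow> (nat \<Rightarrow> real) \<Rightarrow> nat \<Rightarrow> real" where
  "stopped_sequence j y = (\<lambda>k. if k \<le> j then y k else 0)"

lemma stopped_sequence_Suc:
  "stopped_sequence (Suc j) y = (stopped_sequence j y)(Suc j := y (Suc j))"
  by (auto simp: stopped_sequence_def fun_eq_iff)

lemma girsanov_exponent_Suc:
  "girsanov_exponent \<sigma> lam h (Suc N) y = girsanov_exponent \<sigma> lam h N y
     + (lam (y N) * (y (Suc N) - y N) / \<sigma>\<^sup>2 - h * (lam (y N))\<^sup>2 / (2 * \<sigma>\<^sup>2))"
  by (simp add: girsanov_exponent_def)

lemma stopped_sequence_last: "stopped_sequence j y j = y j"
  by (simp add: stopped_sequence_def)

lemma measurable_stopped_sequence: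
  assumes "\<And>k. k \<le> j \<Longrightarrow> (\<lambda>\<omega>. f \<omega> k) \<in> borel_measurable N"
  shows "(\<lambda>\<omega>. stopped_sequence j (f \<omega>)) \<in> measurable N sequences"
proof (rule measurable_sequencesI)
  fix k show "(\<lambda>\<omega>. stopped_sequence j (f \<omega>) k) \<in> borel_measurable N"
    using assms[of k] by (cases "k \<le> j") (simp_all add: stopped_sequence_def)
qed

lemma measurable_girsanov_exponent:
  assumes f: "\<And>k. k \<le> j \<Longrightarrow> (\<lambda>\<omega>. f \<omega> k) \<in> borel_measurable N"
    and lam: "lam \<in> borel_measurable borel"
  shows "(\<lambda>\<omega>. girsanov_exponent \<sigma> lam h j (f \<omega>)) \<in> borel_measurable N"
  unfolding girsanov_exponent_def
proof (rule borel_measurable_sum)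
  have *: "(\<lambda>\<omega>. a \<omega> * (c \<omega> - b \<omega>) / \<sigma>\<^sup>2 - h * (a \<omega>)\<^sup>2 / (2 * \<sigma>\<^sup>2)) \<in> borel_measurable N"
    if [measurable]: "a \<in> borel_measurable N" "b \<in> borel_measurable N" "c \<in> borel_measurable N" for a b c
    by measurable
  fix k assume "k \<in> {..<j}"
  then have k: "k \<le> j" "Suc k \<le> j" by auto
  note m = f[OF k(1)] f[OF k(2)]
  show "(\<lambda>\<omega>. lam (f \<omega> k) * (f \<omega> (Suc k) - f \<omega> k) / \<sigma>\<^sup>2 - h * (lam (f \<omega> k))\<^sup>2 / (2 * \<sigma>\<^sup>2))
      \<in> borel_measurable N"
  proof (rule *)
    show "(\<lambda>\<omega>. lam (f \<omega> k)) \<in> borel_measurable N" by (rule measurable_compose[OF m(1) lam])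
  qed (rule m)+
qed

text \<open>Completing the square in the exponent: a one-dimensional Cameron-Martin formula, written
  with the scaled increment \<open>\<sigma> * z\<close> so that it matches one summand of
  \<open>girsanov_exponent\<close>.\<close>

lemma normal_density_shift:
  assumes "\<sigma> > 0" "h > 0"
  shows "normal_density 0 (sqrt h) (l * h / \<sigma> + z) * exp (l * (\<sigma> * (l * h / \<sigma> + z)) / \<sigma>\<^sup>2 - h * l\<^sup>2 / (2 * \<sigma>\<^sup>2))
    = normal_density 0 (sqrt h) z"
proof -
  define b where "b = l / \<sigma>"
  have b: "l * h / \<sigma> = b * h" "l * (\<sigma> * (b * h + z)) / \<sigma>\<^sup>2 = b * (b * h + z)" "h * l\<^sup>2 / (2 * \<sigma>\<^sup>2) = h * b\<^sup>2 / 2"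
    using assms by (simp_all add: b_def power2_eq_square)
  have "- (b * h + z)\<^sup>2 / (2 * h) + (b * (b * h + z) - h * b\<^sup>2 / 2) = - z\<^sup>2 / (2 * h)"
    using assms(2) by (simp add: field_simps power2_eq_square)
  moreover have "(sqrt h)\<^sup>2 = h" using assms(2) by simp
  ultimately show ?thesis
    unfolding b normal_density_def diff_0_right by (simp only: mult.assoc exp_add[symmetric])
qed

lemma measurable_euler:
  assumes lam: "lam \<in> borel_measurable borel" and T: "0 \<le> T"
  shows "k \<le> j \<Longrightarrow> (\<lambda>\<omega>. euler \<sigma> lam x T (\<lambda>t. W t \<omega>) n k) \<in> borel_measurable (natural_filtration M W (grid T n j))"
proof (induction k)
  case (Suc k)
  have [measurable]: "W (grid T n (Suc k)) \<in> borel_measurable (natural_filtration M W (grid T n j))"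
      "W (grid T n k) \<in> borel_measurable (natural_filtration M W (grid T n j))"
    using Suc.prems T by (auto intro!: measurable_natural_filtration_component grid_mono)
  note [measurable] = lam
  have [measurable]: "(\<lambda>\<omega>. euler \<sigma> lam x T (\<lambda>t. W t \<omega>) n k) \<in> borel_measurable (natural_filtration M W (grid T n j))"
    using Suc by simp
  show ?case by simp
qed simp

text \<open>Induction over all test functionals at once: integrating out the last increment turns
  \<open>F\<close> into a functional of the shorter history, to which the hypothesis applies. A
  translation of the Gaussian variable then trades the drift of the last step for the next factor of
  the density.\<close>

theorem discrete_girsanov:
  fixes F :: "(nat \<Rightarrow> real) \<Rightarrow> ennreal"
  assumes W: "brownian_motion M W" and T: "0 < T" and \<sigma>: "\<sigma> > 0"
    and lam: "lam \<in> borel_measurable borel" and F: "F \<in> borel_measurable sequences"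
  shows "(\<integral>\<^sup>+\<omega>. F (stopped_sequence j (euler \<sigma> lam x T (\<lambda>t. W t \<omega>) n)) \<partial>M)
    = (\<integral>\<^sup>+\<omega>. F (stopped_sequence j (\<lambda>k. x + \<sigma> * W (grid T n k) \<omega>))
        * ennreal (exp (girsanov_exponent \<sigma> lam (T / 2 ^ n) j (\<lambda>k. x + \<sigma> * W (grid T n k) \<omega>))) \<partial>M)"
  using F
proof (induction j arbitrary: F)
  case 0
  \<comment> \<open>Both histories of length one are \<open>x\<close>, except on the null set where
    \<open>W\<close> does not start at 0.\<close>
  have "AE \<omega> in M. W 0 \<omega> = 0" using W by (simp add: brownian_motion_def)
  then show ?case
  proof (intro nn_integral_cong_AE, eventually_elim)
    case (elim \<omega>)
    then have "stopped_sequence 0 (euler \<sigma> lam x T (\<lambda>t. W t \<omega>) n) = stopped_sequence 0 (\<lambda>k. x + \<sigma> * W (grid T n k) \<omega>)"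
      by (auto simp: stopped_sequence_def fun_eq_iff)
    then show ?case by (simp add: girsanov_exponent_def)
  qed
next
  case (Suc j)
  note [measurable] = lam Suc.prems
  define h where "h = T / 2 ^ n"
  have h: "h > 0" using T by (simp add: h_def)
  let ?t = "grid T n j"
  let ?\<phi> = "\<lambda>z. ennreal (normal_density 0 (sqrt h) z)"
    and ?E = "\<lambda>l z. ennreal (exp (l * (\<sigma> * z) / \<sigma>\<^sup>2 - h * l\<^sup>2 / (2 * \<sigma>\<^sup>2)))"
    and ?\<Delta> = "\<lambda>\<omega>. W (grid T n (Suc j)) \<omega> - W ?t \<omega>"
    and ?F = "\<lambda>v a z. F (v(Suc j := a + \<sigma> * z))"
  have t: "0 \<le> ?t" "?t < grid T n (Suc j)" "grid T n (Suc j) - ?t = h" using T by (auto simp: grid_Suc h_def)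
  let ?N = "natural_filtration M W ?t"
  define e where "e \<omega> = euler \<sigma> lam x T (\<lambda>t. W t \<omega>) n" for \<omega>
  define w where "w \<omega> = (\<lambda>k. x + \<sigma> * W (grid T n k) \<omega>)" for \<omega>
  define D where "D \<omega> = ennreal (exp (girsanov_exponent \<sigma> lam h j (w \<omega>)))" for \<omega>
  have wN: "(\<lambda>\<omega>. w \<omega> k) \<in> borel_measurable ?N" if "k \<le> j" for k
    unfolding w_def using T that
    by (intro real_measurable_intros
      measurable_natural_filtration_component grid_nonneg grid_mono) auto
  have eN: "(\<lambda>\<omega>. e \<omega> k) \<in> borel_measurable ?N" if "k \<le> j" for k
    unfolding e_def using measurable_euler[OF lam less_imp_le[OF T] that] .
  have [measurable]: "(\<lambda>\<omega>. stopped_sequence j (e \<omega>)) \<in> measurable ?N sequences"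
    "(\<lambda>\<omega>. stopped_sequence j (w \<omega>)) \<in> measurable ?N sequences"
    using wN eN by (auto intro!: measurable_stopped_sequence)
  have D[measurable]: "D \<in> borel_measurable ?N"
    unfolding D_def
    by (rule measurable_compose[OF measurable_compose[OF measurable_girsanov_exponent[where f=w, OF _ lam]
          borel_measurable_exp] measurable_ennreal]) (rule wN)
  \<comment> \<open>\<open>F\<close> after one Euler step, as a function of the history so far and
    the last noise increment.\<close>
  define G where "G p = F ((fst p)(Suc j := fst p j + lam (fst p j) * h + \<sigma> * snd p))" for p
  have upd: "(\<lambda>p. (fst p)(Suc j := fst p j + a (fst p) + \<sigma> * snd p)) \<in> measurable (sequences \<Otimes>\<^sub>M borel) sequences"
    if [measurable]: "a \<in> borel_measurable sequences" for a
  proof (rule measurable_sequencesI)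
    fix k show "(\<lambda>p. ((fst p)(Suc j := fst p j + a (fst p) + \<sigma> * snd p)) k) \<in> borel_measurable (sequences \<Otimes>\<^sub>M borel)"
      by (cases "k = Suc j") simp_all
  qed
  have G[measurable]: "G \<in> borel_measurable (sequences \<Otimes>\<^sub>M borel)"
    unfolding G_def by (rule measurable_compose[OF upd Suc.prems]) simp
  \<comment> \<open>With the last noise integrated out, only the history remains, so the induction
    hypothesis can be used.\<close>
  define G' where "G' v = (\<integral>\<^sup>+z. ?\<phi> z * G (v, z) \<partial>lborel)" for v
  have G': "G' \<in> borel_measurable sequences" unfolding G'_def by simp
  have "(\<integral>\<^sup>+\<omega>. F (stopped_sequence (Suc j) (e \<omega>)) \<partial>M)
      = (\<integral>\<^sup>+\<omega>. G (stopped_sequence j (e \<omega>), ?\<Delta> \<omega>) \<partial>M)"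
    by (simp add: G_def stopped_sequence_Suc) (simp add: stopped_sequence_def e_def h_def)
  also have "\<dots> = (\<integral>\<^sup>+\<omega>. G' (stopped_sequence j (e \<omega>)) \<partial>M)"
    using nn_integral_brownian_increment[OF W t(1,2), of "\<lambda>(\<omega>, z). G (stopped_sequence j (e \<omega>), z)"] 
    by (simp add: G'_def t(3))
  also have "\<dots> = (\<integral>\<^sup>+\<omega>. G' (stopped_sequence j (w \<omega>)) * D \<omega> \<partial>M)"
    using Suc.IH[OF G'] by (simp add: e_def w_def D_def h_def)
  also have "\<dots> = (\<integral>\<^sup>+\<omega>. (\<integral>\<^sup>+z. ?\<phi> z * (?F (stopped_sequence j (w \<omega>)) (w \<omega> j) z
      * ?E (lam (w \<omega> j)) z * D \<omega>) \<partial>lborel) \<partial>M)"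
  proof (rule nn_integral_cong)
    fix \<omega> assume \<omega>: "\<omega> \<in> space M"
    define v where "v = stopped_sequence j (w \<omega>)"
    define l where "l = lam (w \<omega> j)"
    have vj: "v j = w \<omega> j" by (simp add: v_def stopped_sequence_def)
    have vs: "v \<in> space sequences" by (simp add: space_PiM)
    have Fm[measurable]: "(\<lambda>z. F (v(Suc j := v j + b + \<sigma> * z))) \<in> borel_measurable borel" for b
      using measurable_compose[OF measurable_compose[OF measurable_Pair1'[OF vs, of borel] upd[of "\<lambda>_. b", OF borel_measurable_const]] Suc.prems]
      unfolding fst_conv snd_conv .
    \<comment> \<open>Lebesgue measure is invariant under the shift by
      \<open>l * h / \<sigma>\<close>, which is the drift of one step measured in units of the
      noise.\<close>
    have "(\<integral>\<^sup>+z. ?\<phi> z * (?F v (v j) z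
        * ?E l z * D \<omega>) \<partial>lborel)
      = (\<integral>\<^sup>+z. ?\<phi> z * (?F v (v j) z
        * ?E l z * D \<omega>) \<partial>distr lborel borel ((+) (l * h / \<sigma>)))"
      by (simp only: lborel_distr_plus)
    also have "\<dots> = (\<integral>\<^sup>+z. ?\<phi> (l * h / \<sigma> + z) * (?F v (v j) (l * h / \<sigma> + z)
        * ?E l (l * h / \<sigma> + z) * D \<omega>) \<partial>lborel)"
      using Fm[of 0] by (subst nn_integral_distr) auto
    also have "\<dots> = (\<integral>\<^sup>+z. (?\<phi> z * G (v, z)) * D \<omega> \<partial>lborel)"
    proof (rule nn_integral_cong)
      fix z :: real
      have rearrange: "a * (b * c * d) = (a * c) * b * d" for a b c d :: ennreal
        by (simp only: mult_ac)
      have "?\<phi> (l * h / \<sigma> + z) * ?E l (l * h / \<sigma> + z) = ?\<phi> z"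
        by (subst ennreal_mult[symmetric]) (auto simp only: normal_density_shift[OF \<sigma> h] normal_density_nonneg exp_ge_zero)
      moreover have "v j + \<sigma> * (l * h / \<sigma> + z) = v j + lam (v j) * h + \<sigma> * z"
        using \<sigma> by (simp add: vj l_def field_simps)
      ultimately show "?\<phi> (l * h / \<sigma> + z) * (?F v (v j) (l * h / \<sigma> + z)
        * ?E l (l * h / \<sigma> + z) * D \<omega>) = ?\<phi> z * G (v, z) * D \<omega>"
        by (simp only: rearrange G_def fst_conv snd_conv)
    qed
    also have "\<dots> = G' v * D \<omega>"
      using Fm[of "lam (v j) * h"] by (simp add: G'_def G_def nn_integral_multc)
    finally show "G' (stopped_sequence j (w \<omega>)) * D \<omega> = (\<integral>\<^sup>+z. ?\<phi> z * (?F (stopped_sequence j (w \<omega>)) (w \<omega> j) z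
      * ?E (lam (w \<omega> j)) z * D \<omega>) \<partial>lborel)"
      by (simp add: v_def[symmetric] l_def[symmetric] vj)
  qed
  \<comment> \<open>The increment is put back, now for the driftless walk and with the exponential
    factor attached.\<close>
  also have "\<dots> = (\<integral>\<^sup>+\<omega>. ?F (stopped_sequence j (w \<omega>)) (w \<omega> j) (?\<Delta> \<omega>)
      * ?E (lam (w \<omega> j)) (?\<Delta> \<omega>) * D \<omega> \<partial>M)"
  proof -
    have [measurable]: "(\<lambda>\<omega>. w \<omega> j) \<in> borel_measurable ?N" using wN by simp
    have "(\<lambda>p. (stopped_sequence j (w (fst p)), snd p)) \<in> measurable (?N \<Otimes>\<^sub>M borel) (sequences \<Otimes>\<^sub>M borel)" by simp
    from measurable_compose[OF measurable_compose[OF this upd[of "\<lambda>_. 0", OF borel_measurable_const]] Suc.prems]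
    have [measurable]: "(\<lambda>p. ?F (stopped_sequence j (w (fst p))) (w (fst p) j) (snd p)) \<in> borel_measurable (?N \<Otimes>\<^sub>M borel)"
      unfolding fst_conv snd_conv add_0_right stopped_sequence_last .
    show ?thesis
      using nn_integral_brownian_increment[OF W t(1,2), of "\<lambda>p. ?F (stopped_sequence j (w (fst p))) (w (fst p) j) (snd p)
        * ?E (lam (w (fst p) j)) (snd p) * D (fst p)"]
      by (simp add: t(3))
  qed
  also have "\<dots> = (\<integral>\<^sup>+\<omega>. F (stopped_sequence (Suc j) (w \<omega>)) * ennreal (exp (girsanov_exponent \<sigma> lam h (Suc j) (w \<omega>))) \<partial>M)"
  proof (rule nn_integral_cong)
    fix \<omega>
    have inc: "w \<omega> (Suc j) = w \<omega> j + \<sigma> * (?\<Delta> \<omega>)" by (simp add: w_def algebra_simps)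
    show "?F (stopped_sequence j (w \<omega>)) (w \<omega> j) (?\<Delta> \<omega>)
      * ?E (lam (w \<omega> j)) (?\<Delta> \<omega>) * D \<omega>
      = F (stopped_sequence (Suc j) (w \<omega>)) * ennreal (exp (girsanov_exponent \<sigma> lam h (Suc j) (w \<omega>)))"
      by (simp add: stopped_sequence_Suc girsanov_exponent_Suc inc exp_add D_def ennreal_mult ac_simps)
  qed
  finally show ?case by (simp add: e_def w_def h_def cong: if_cong)
qed

section \<open>Measures on path space\<close>

text \<open>For continuous integrands the integral is a limit of dyadic Riemann sums, which are
  finite combinations of measurable functions.\<close>

lemma measurable_pathwise_integral:
  fixes t :: real and Y :: "real \<Rightarrow> 'a \<Rightarrow> real"
  assumes t: "0 \<le> t" and meas: "\<And>s. 0 \<le> s \<Longrightarrow> s \<le> t \<Longrightarrow> Y s \<in> borel_measurable N"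
    and cont: "\<And>\<omega>. \<omega> \<in> space N \<Longrightarrow> continuous_on {0..t} (\<lambda>s. Y s \<omega>)"
  shows "(\<lambda>\<omega>. integral {0..t} (\<lambda>s. Y s \<omega>)) \<in> borel_measurable N"
proof (cases "t = 0")
  case False
  then have t: "0 < t" using t by simp
  show ?thesis
  proof (rule borel_measurable_LIMSEQ_real)
    show "(\<lambda>n. \<Sum>k<2^n. Y (grid t n k) \<omega> * (t / 2 ^ n)) \<longlonglongrightarrow> integral {0..t} (\<lambda>s. Y s \<omega>)"
      if "\<omega> \<in> space N" for \<omega>
      using riemann_sum_tendsto[OF approx_on_cells_grid[OF cont[OF that] t] cont[OF that] t] .
    show "(\<lambda>\<omega>. \<Sum>k<2^n. Y (grid t n k) \<omega> * (t / 2 ^ n)) \<in> borel_measurable N" for n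
      using t by (intro real_measurable_intros meas
          grid_nonneg grid_le) auto
  qed
qed simp

lemma space_path_space: "space (path_space T) = {w \<in> extensional {0..T}. continuous_on {0..T} w}"
  by (auto simp: path_space_def space_restrict_space space_PiM PiE_def)

lemma measurable_path_coordinate: "t \<in> {0..T} \<Longrightarrow> (\<lambda>w. w t) \<in> borel_measurable (path_space T)"
  unfolding path_space_def by (intro measurable_restrict_space1 measurable_component_singleton)

lemma measurable_path_spaceI:
  assumes "\<And>t. t \<in> {0..T} \<Longrightarrow> (\<lambda>\<omega>. f \<omega> t) \<in> borel_measurable N"
    and "\<And>\<omega>. \<omega> \<in> space N \<Longrightarrow> f \<omega> \<in> space (path_space T)"
  shows "f \<in> measurable N (path_space T)"
  unfolding path_space_def
proof (rule measurable_restrict_space2)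
  have f: "f \<omega> \<in> extensional {0..T}" "continuous_on {0..T} (f \<omega>)" if "\<omega> \<in> space N" for \<omega>
    using assms(2)[OF that] by (auto simp: space_path_space)
  then show "f \<in> space N \<rightarrow> {w. continuous_on {0..T} w}" by auto
  show "f \<in> measurable N (Pi\<^sub>M {0..T} (\<lambda>_. borel))"
    using measurable_PiM_single'[of "{0..T}" "\<lambda>t \<omega>. f \<omega> t" N "\<lambda>_. borel"] assms(1) f(1)
    by (auto simp: PiE_def)
qed

lemma measurable_path_map:
  assumes "\<And>t. 0 \<le> t \<Longrightarrow> X t \<in> borel_measurable M"
    and "\<And>\<omega>. \<omega> \<in> space M \<Longrightarrow> continuous_on {0..} (\<lambda>t. X t \<omega>)"
  shows "(\<lambda>\<omega>. \<lambda>t\<in>{0..T}. X t \<omega>) \<in> measurable M (path_space T)"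
proof (rule measurable_path_spaceI)
  show "(\<lambda>\<omega>. (\<lambda>t\<in>{0..T}. X t \<omega>) t) \<in> borel_measurable M" if "t \<in> {0..T}" for t
    using that assms(1) by simp
  show "(\<lambda>t\<in>{0..T}. X t \<omega>) \<in> space (path_space T)" if "\<omega> \<in> space M" for \<omega>
  proof -
    have "continuous_on {0..T} (\<lambda>t. X t \<omega>)" using continuous_on_subset[OF assms(2)[OF that]] by auto
    then have "continuous_on {0..T} (\<lambda>t\<in>{0..T}. X t \<omega>)" by (rule continuous_on_eq) auto
    then show ?thesis by (simp add: space_path_space)
  qed
qed

text \<open>A continuous approximation of the indicator of \<open>y > 0\<close>: continuity lets it
  follow limits of grid values, and \<open>k\<close> is sent to infinity only afterwards.\<close>

definition ramp :: "nat \<Rightarrow> real \<Rightarrow> real" where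
  "ramp k y = max 0 (min 1 (real k * y))"

lemma ramp_bounds: "0 \<le> ramp k y" "ramp k y \<le> 1"
  by (auto simp: ramp_def)

lemma isCont_ramp: "isCont (ramp k) y"
  unfolding ramp_def by (intro continuous_intros)

lemma measurable_ramp [measurable]: "ramp k \<in> borel_measurable borel"
  unfolding ramp_def by measurable

lemma ramp_tendsto: "(\<lambda>k. ramp k y) \<longlonglongrightarrow> indicator {0<..} y"
proof (cases "y > 0")
  case True
  obtain k0 :: nat where "1 / y < k0" using reals_Archimedean2 by blast
  have "ramp k y = 1" if "k0 \<le> k" for k
  proof -
    have "1 < real k0 * y" using \<open>1 / y < k0\<close> True by (simp add: pos_divide_less_eq)
    also have "\<dots> \<le> real k * y" using that True by (intro mult_right_mono) auto
    finally have "1 < real k * y" .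
    then show "ramp k y = 1" by (simp add: ramp_def)
  qed
  then show ?thesis using True
    by (intro tendsto_eventually) (auto simp: eventually_sequentially)
next
  case False
  then have "real k * y \<le> 0" for k by (simp add: mult_nonneg_nonpos)
  then have "ramp k y = 0" for k by (simp add: ramp_def max_absorb1 min.coboundedI2)
  then show ?thesis using False by simp
qed

text \<open>Approximates the indicator of the paths that lie below \<open>a t\<close> at all times
  \<open>t\<close> in \<open>J\<close>.\<close>

definition cylinder_test :: "nat \<Rightarrow> real set \<Rightarrow> (real \<Rightarrow> real) \<Rightarrow> (real \<Rightarrow> real) \<Rightarrow> real" where
  "cylinder_test k J a w = (\<Prod>t\<in>J. ramp k (a t - w t))"

lemma cylinder_test_bounds: "0 \<le> cylinder_test k J a w" "cylinder_test k J a w \<le> 1"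
  by (auto simp: cylinder_test_def ramp_bounds intro!: prod_nonneg prod_le_1)

lemma measurable_cylinder_test:
  assumes "\<And>t. t \<in> J \<Longrightarrow> (\<lambda>\<omega>. f \<omega> t) \<in> borel_measurable N"
  shows "(\<lambda>\<omega>. cylinder_test k J a (f \<omega>)) \<in> borel_measurable N"
  unfolding cylinder_test_def
  by (intro borel_measurable_prod measurable_compose[OF _ measurable_ramp] real_measurable_intros assms)

lemma cylinder_test_tendsto:
  "(\<lambda>k. cylinder_test k J a w) \<longlonglongrightarrow> (\<Prod>t\<in>J. indicator {0<..} (a t - w t))"
  unfolding cylinder_test_def by (intro tendsto_prod ramp_tendsto)

text \<open>As \<open>k\<close> grows, dominated convergence turns the tests into the masses of
  cylinders \<open>w t < a t\<close>. These are stable under intersection and generate the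
  \<open>\<sigma>\<close>-algebra, so the measures agree.\<close>

lemma path_measure_eqI:
  fixes P Q :: "(real \<Rightarrow> real) measure"
  assumes sets: "sets P = sets (path_space T)" "sets Q = sets (path_space T)"
    and fin: "finite_measure P" "finite_measure Q"
    and eq: "\<And>k J a. finite J \<Longrightarrow> J \<subseteq> {0..T} \<Longrightarrow>
      (\<integral>\<^sup>+w. ennreal (cylinder_test k J a w) \<partial>P) = (\<integral>\<^sup>+w. ennreal (cylinder_test k J a w) \<partial>Q)"
  shows "P = Q"
proof -
  let ?\<Omega> = "space (path_space T)"
  define B where "B J a = {w \<in> ?\<Omega>. \<forall>t\<in>J. w t < a t}" for J and a :: "real \<Rightarrow> real"
  define E where "E = {B J a |J a. finite J \<and> J \<subseteq> {0..T}}"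
  have sp: "space P = ?\<Omega>" "space Q = ?\<Omega>" using sets by (auto dest: sets_eq_imp_space_eq)
  have coord: "(\<lambda>w. w t) \<in> borel_measurable R" if "sets R = sets (path_space T)" "t \<in> {0..T}" for R t
    using measurable_path_coordinate[OF that(2)] by (simp add: measurable_cong_sets[OF that(1) refl])
  have B_sets: "B J a \<in> sets (path_space T)" if "finite J" "J \<subseteq> {0..T}" for J a
  proof -
    have "B J a = (\<Inter>t\<in>J. {w \<in> ?\<Omega>. w t < a t}) \<inter> ?\<Omega>" by (auto simp: B_def)
    moreover have "{w \<in> ?\<Omega>. w t < a t} \<in> sets (path_space T)" if "t \<in> J" for t
      using measurable_path_coordinate[of t T] that \<open>J \<subseteq> {0..T}\<close> by (intro borel_measurable_less) auto
    ultimately show ?thesis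
      using that by (cases "J = {}") (auto intro!: sets.finite_INT)
  qed
  have lim: "(\<lambda>k. \<integral>\<^sup>+w. ennreal (cylinder_test k J a w) \<partial>R) \<longlonglongrightarrow> emeasure R (B J a)"
    if R: "sets R = sets (path_space T)" "finite_measure R" and J: "finite J" "J \<subseteq> {0..T}" for R J a
  proof -
    interpret R: finite_measure R by fact
    have spR: "space R = ?\<Omega>" using R by (auto dest: sets_eq_imp_space_eq)
    have BR: "B J a \<in> sets R" using B_sets J R by simp
    have "(\<lambda>k. \<integral>\<^sup>+w. ennreal (cylinder_test k J a w) \<partial>R) \<longlonglongrightarrow> (\<integral>\<^sup>+w. indicator (B J a) w \<partial>R)"
    proof (rule nn_integral_dominated_convergence[where w="\<lambda>_. 1"])
      show "(\<lambda>w. ennreal (cylinder_test k J a w)) \<in> borel_measurable R" for k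
        using coord[OF R(1)] J
        by (intro measurable_compose[OF _ measurable_ennreal] measurable_cylinder_test) auto
      have "(\<lambda>k. ennreal (cylinder_test k J a w)) \<longlonglongrightarrow> indicator (B J a) w" if "w \<in> space R" for w
      proof -
        have "(\<Prod>t\<in>J. indicator {0<..} (a t - w t)) = (indicator (B J a) w :: real)"
          using that J(1) by (auto simp: B_def spR indicator_def prod_zero_iff)
        then show ?thesis
          using tendsto_ennrealI[OF cylinder_test_tendsto[of J a w]] by (simp add: ennreal_indicator)
      qed
      then show "AE w in R. (\<lambda>k. ennreal (cylinder_test k J a w)) \<longlonglongrightarrow> indicator (B J a) w" by auto
      show "(\<integral>\<^sup>+w. 1 \<partial>R) < \<infinity>" by (simp add: R.emeasure_finite less_top[symmetric])
    qed (use BR in \<open>auto simp: cylinder_test_bounds ennreal_le_1\<close>)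
    then show ?thesis using BR by simp
  qed
  have E_sub: "E \<subseteq> Pow ?\<Omega>" by (auto simp: E_def B_def)
  have gen: "sets (path_space T) = sigma_sets ?\<Omega> E"
  proof
    show "sigma_sets ?\<Omega> E \<subseteq> sets (path_space T)"
      using B_sets by (intro sets.sigma_sets_subset) (auto simp: E_def)
    define S where "S = sigma ?\<Omega> E"
    have S: "space S = ?\<Omega>" "sets S = sigma_sets ?\<Omega> E"
      using E_sub by (auto simp: S_def sets_measure_of space_measure_of)
    have "(\<lambda>w. w) \<in> measurable S (path_space T)"
    proof (rule measurable_path_spaceI)
      fix t assume t: "t \<in> {0..T}"
      show "(\<lambda>w. w t) \<in> borel_measurable S"
      proof (rule borel_measurableI_less)
        fix y
        have "{w \<in> space S. w t < y} = B {t} (\<lambda>_. y)" by (auto simp: B_def S)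
        then show "{w \<in> space S. w t < y} \<in> sets S"
          unfolding S using t by (auto simp: E_def intro!: sigma_sets.Basic exI[of _ "{t}"] exI[of _ "\<lambda>_. y"])
      qed
    qed (simp add: S)
    then show "sets (path_space T) \<subseteq> sigma_sets ?\<Omega> E"
    proof (intro subsetI)
      fix A assume A: "A \<in> sets (path_space T)"
      have "(\<lambda>w. w) -` A \<inter> space S \<in> sets S" by (rule measurable_sets[OF _ A]) fact
      moreover have "(\<lambda>w. w) -` A \<inter> space S = A" using sets.sets_into_space[OF A] S by auto
      ultimately show "A \<in> sigma_sets ?\<Omega> E" by (simp add: S)
    qed
  qed
  show ?thesis
  proof (rule measure_eqI_generator_eq[OF _ E_sub])
    show "Int_stable E"
    proof (rule Int_stableI)
      fix A A' assume "A \<in> E" "A' \<in> E"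
      then obtain J a J' a' where *: "A = B J a" "finite J" "J \<subseteq> {0..T}" "A' = B J' a'" "finite J'" "J' \<subseteq> {0..T}"
        by (auto simp: E_def)
      \<comment> \<open>At times constrained by both cylinders the smaller level decides.\<close>
      define b where "b t = (if t \<in> J then if t \<in> J' then min (a t) (a' t) else a t else a' t)" for t
      have "A \<inter> A' = B (J \<union> J') b" unfolding * by (auto simp: B_def b_def split: if_splits)
      then show "A \<inter> A' \<in> E" using * by (auto simp: E_def)
    qed
    fix A assume "A \<in> E"
    then obtain J a where A: "A = B J a" "finite J" "J \<subseteq> {0..T}" by (auto simp: E_def)
    show "emeasure P A = emeasure Q A"
      unfolding A(1)
      using lim[OF sets(1) fin(1) A(2,3), of a] lim[OF sets(2) fin(2) A(2,3), of a] eq[OF A(2,3)]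
      by (auto intro: LIMSEQ_unique)
  next
    \<comment> \<open>The whole space is the cylinder without constraints, so equality of the total
      masses is among the tested identities.\<close>
    show "range (\<lambda>_::nat. ?\<Omega>) \<subseteq> E"
      by (auto simp: E_def B_def intro!: exI[of _ "{}"])
    show "emeasure P ?\<Omega> \<noteq> \<infinity>" for i :: nat
      using finite_measure.emeasure_finite[OF fin(1)] by (simp add: sp)
  qed (use sets gen in auto)
qed

text \<open>The cap \<open>2 ^ n - 1\<close> assigns the end time \<open>T\<close> to the last
  cell.\<close>

definition cell_index :: "real \<Rightarrow> nat \<Rightarrow> real \<Rightarrow> nat" where
  "cell_index T n t = min (nat \<lfloor>t * 2 ^ n / T\<rfloor>) (2 ^ n - 1)"

lemma cell_index:
  assumes t: "t \<in> {0..T}" and T: "0 < T"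
  shows "cell_index T n t < 2 ^ n"
    and "t \<in> {grid T n (cell_index T n t)..grid T n (Suc (cell_index T n t))}"
proof -
  show "cell_index T n t < 2 ^ n" by (simp add: cell_index_def min_less_iff_disj)
  define y where "y = t * 2 ^ n / T"
  have y: "0 \<le> y" "y \<le> 2 ^ n" "t = T * y / 2 ^ n" using t T by (auto simp: y_def field_simps)
  have lo: "real (cell_index T n t) \<le> y"
  proof -
    have "real (cell_index T n t) \<le> real (nat \<lfloor>y\<rfloor>)" by (simp add: cell_index_def y_def)
    then show ?thesis using of_nat_floor[OF y(1)] by linarith
  qed
  have hi: "y \<le> real (Suc (cell_index T n t))"
  proof (cases "nat \<lfloor>y\<rfloor> \<le> 2 ^ n - 1")
    case True
    then show ?thesis using y(1) by (simp add: cell_index_def y_def[symmetric]) linarith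
  next
    case False
    then show ?thesis using y(2) by (simp add: cell_index_def y_def[symmetric] of_nat_diff)
  qed
  show "t \<in> {grid T n (cell_index T n t)..grid T n (Suc (cell_index T n t))}"
    using lo hi T unfolding y(3) grid_def by (auto intro!: divide_right_mono mult_left_mono)
qed

lemma approx_on_cells_at:
  assumes c: "approx_on_cells T c g" and t: "t \<in> {0..T}" and T: "0 < T"
  shows "(\<lambda>n. c n (cell_index T n t)) \<longlonglongrightarrow> g t"
proof (rule tendstoI)
  fix e :: real assume "e > 0"
  from approx_on_cellsD[OF c this] show "\<forall>\<^sub>F n in sequentially. dist (c n (cell_index T n t)) (g t) < e"
    by eventually_elim (use cell_index[OF t T] in \<open>auto simp: dist_real_def\<close>)
qed

section \<open>The density of the law of the solution\<close>

lemma bdd_above_Psi0: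
  assumes \<sigma>: "\<sigma> > 0" and lam: "lam \<in> drift_class" and rho: "rho \<sigma> lam < 1"
  shows "bdd_above (range (Psi0 \<sigma> lam))"
proof -
  obtain \<theta> where \<theta>: "lam \<theta> = 0" and dec: "\<And>y z. y < z \<Longrightarrow> lam z < lam y"
    using lam by (auto simp: drift_class_def)
  have "\<forall>\<^sub>F y in at_infinity. ereal (\<sigma>\<^sup>2 * slope lam y / (lam y)\<^sup>2) < 1"
    using rho unfolding rho_def by (rule Limsup_lessD)
  then obtain b where b: "\<And>y. b \<le> \<bar>y\<bar> \<Longrightarrow> \<sigma>\<^sup>2 * slope lam y / (lam y)\<^sup>2 < 1"
    by (auto simp: eventually_at_infinity)
  \<comment> \<open>Beyond \<open>\<bar>\<theta>\<bar> + 1\<close> the drift is nonzero. At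
    \<open>\<theta>\<close> itself the quotient has the default value 0 and would not give the
    comparison of \<open>\<sigma>\<^sup>2 * slope lam y\<close> with
    \<open>(lam y)\<^sup>2\<close>.\<close>
  define B where "B = max b (\<bar>\<theta>\<bar> + 1)"
  have outside: "Psi0 \<sigma> lam y \<le> 0" if "B \<le> \<bar>y\<bar>" for y
  proof -
    have "y \<noteq> \<theta>" "b \<le> \<bar>y\<bar>" using that by (auto simp: B_def)
    then have "lam y \<noteq> 0" using dec[of y \<theta>] dec[of \<theta> y] \<theta> by (cases y \<theta> rule: linorder_cases) auto
    then have "\<sigma>\<^sup>2 * slope lam y < (lam y)\<^sup>2" using b[OF \<open>b \<le> \<bar>y\<bar>\<close>] by (simp add: divide_less_eq)
    then show ?thesis using \<sigma> by (simp add: Psi0_def field_simps)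
  qed
  have "continuous_on UNIV lam"
    using lam by (auto simp: drift_class_def intro!: differentiable_imp_continuous_on simp: differentiable_on_def
        intro: differentiable_at_withinI)
  then have "continuous_on UNIV (Psi0 \<sigma> lam)"
    unfolding Psi0_def[abs_def] slope_def using lam \<sigma> by (intro continuous_intros) (auto simp: drift_class_def)
  then obtain R where R: "R > 0" "\<And>y. y \<in> {-B..B} \<Longrightarrow> \<bar>Psi0 \<sigma> lam y\<bar> \<le> R"
    using continuous_on_Icc_bounded[OF continuous_on_subset[OF _ subset_UNIV]] by metis
  have "Psi0 \<sigma> lam y \<le> R" for y
  proof (cases "B \<le> \<bar>y\<bar>")
    case False
    then have "y \<in> {-B..B}" by auto
    from R(2)[OF this] show ?thesis by linarith
  qed (use outside[of y] R(1) in linarith)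
  then show ?thesis by (auto simp: bdd_above_def)
qed

definition girsanov_density ::
  "real \<Rightarrow> (real \<Rightarrow> real) \<Rightarrow> (real \<Rightarrow> real) \<Rightarrow> real \<Rightarrow> real \<Rightarrow> (real \<Rightarrow> real) \<Rightarrow> real" where
  "girsanov_density \<sigma> lam Lam x T w =
     exp ((Lam (w T) - Lam x) / \<sigma>\<^sup>2 + integral {0..T} (\<lambda>r. Psi0 \<sigma> lam (w r)))"

lemma girsanov_density_pos: "0 < girsanov_density \<sigma> lam Lam x T w"
  by (simp add: girsanov_density_def)

text \<open>Connects processes indexed by all times with elements of path space, which are
  \<open>undefined\<close> outside \<open>{0..T}\<close>.\<close>

lemma girsanov_density_cong:
  assumes "0 \<le> T" "\<And>t. t \<in> {0..T} \<Longrightarrow> w t = v t"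
  shows "girsanov_density \<sigma> lam Lam x T w = girsanov_density \<sigma> lam Lam x T v"
proof -
  have "integral {0..T} (\<lambda>r. Psi0 \<sigma> lam (w r)) = integral {0..T} (\<lambda>r. Psi0 \<sigma> lam (v r))"
    using assms(2) by (intro Henstock_Kurzweil_Integration.integral_cong) simp
  then show ?thesis using assms by (simp add: girsanov_density_def)
qed

lemma girsanov_exponent_stopped:
  "girsanov_exponent \<sigma> lam h N (stopped_sequence N y) = girsanov_exponent \<sigma> lam h N y"
  by (auto simp: girsanov_exponent_def stopped_sequence_def intro!: sum.cong)

section \<open>The probabilistic setting and the pathwise bound on the density\<close>

locale drifted_brownian_motion =
  fixes \<sigma> T x \<theta> :: real and lam Lam :: "real \<Rightarrow> real"
    and M :: "'a measure" and W X :: "real \<Rightarrow> 'a \<Rightarrow> real"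
  assumes sigma_pos: "\<sigma> > 0"
    and lam: "lam \<in> drift_class" and root: "lam \<theta> = 0" and rho: "rho \<sigma> lam < 1"
    and Lam: "\<And>y. (Lam has_real_derivative lam y) (at y)"
    and T_pos: "T > 0"
    and bm: "brownian_motion M W" and sol: "strong_solution M W \<sigma> lam x X"
begin

sublocale M: prob_space M
  by (rule brownian_motion_prob_space[OF bm])

definition "C = exp ((Lam \<theta> - Lam x) / \<sigma>\<^sup>2 + T * (SUP y. Psi0 \<sigma> lam y))"
definition "\<Phi> = girsanov_density \<sigma> lam Lam x T"
definition "U t \<omega> = x + \<sigma> * W t \<omega>"
definition "Q = path_law M (\<lambda>t \<omega>. x + \<sigma> * W t \<omega>) T"
definition "P = path_law M X T"

abbreviation "U_path \<omega> \<equiv> \<lambda>t\<in>{0..T}. U t \<omega>"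
abbreviation "has_qv \<omega> \<equiv> unit_quadratic_variation T (\<lambda>n k. W (grid T n (Suc k)) \<omega> - W (grid T n k) \<omega>)"
abbreviation "log_density n \<equiv> girsanov_exponent \<sigma> lam (T / 2 ^ n) (2 ^ n)"

lemma has_derivative_lam: "(lam has_real_derivative deriv lam y) (at y)"
  using lam by (auto simp: drift_class_def DERIV_deriv_iff_real_differentiable)

lemma continuous_deriv_lam: "continuous_on UNIV (deriv lam)"
  using lam by (auto simp: drift_class_def)

lemma continuous_lam: "continuous_on UNIV lam"
  using has_derivative_lam DERIV_isCont by (blast intro: continuous_at_imp_continuous_on)

lemma lam_decreasing: "y \<le> z \<Longrightarrow> lam z \<le> lam y"
  using lam by (cases "y = z") (auto simp: drift_class_def intro: less_imp_le)

lemma continuous_Psi0: "continuous_on UNIV (Psi0 \<sigma> lam)"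
  unfolding Psi0_def[abs_def] slope_def using sigma_pos
  by (intro continuous_intros continuous_lam continuous_deriv_lam) auto

lemma continuous_Lam: "continuous_on UNIV Lam"
  using Lam DERIV_isCont by (blast intro: continuous_at_imp_continuous_on)

lemma measurable_lam: "lam \<in> borel_measurable borel"
  by (rule borel_measurable_continuous_onI[OF continuous_lam])

lemma Lam_le: "Lam y \<le> Lam \<theta>"
proof (cases "y \<le> \<theta>")
  case True
  show ?thesis
  proof (rule DERIV_nonneg_imp_nondecreasing[OF True])
    fix z assume "y \<le> z" "z \<le> \<theta>"
    then show "\<exists>d. (Lam has_real_derivative d) (at z) \<and> 0 \<le> d"
      using Lam[of z] lam_decreasing[of z \<theta>] root by auto
  qed
next
  case False
  then have le: "\<theta> \<le> y" by simp
  show ?thesis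
  proof (rule DERIV_nonpos_imp_nonincreasing[OF le])
    fix z assume "\<theta> \<le> z" "z \<le> y"
    then show "\<exists>d. (Lam has_real_derivative d) (at z) \<and> d \<le> 0"
      using Lam[of z] lam_decreasing[of \<theta> z] root by auto
  qed
qed

lemma \<Phi>_pos: "0 < \<Phi> w"
  by (simp add: \<Phi>_def girsanov_density_pos)

text \<open>Being valid for every continuous path, the bound can be used along \<open>X\<close> and
  along \<open>U\<close> before any relation between their laws is known.\<close>

lemma \<Phi>_le:
  assumes w: "continuous_on {0..T} w"
  shows "\<Phi> w \<le> C"
proof -
  let ?S = "SUP y. Psi0 \<sigma> lam y"
  have c: "continuous_on {0..T} (\<lambda>r. Psi0 \<sigma> lam (w r))"
    by (rule continuous_on_compose2[OF continuous_Psi0 w]) auto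
  have "integral {0..T} (\<lambda>r. Psi0 \<sigma> lam (w r)) \<le> integral {0..T} (\<lambda>r. ?S)"
    using c cSUP_upper[OF UNIV_I bdd_above_Psi0[OF sigma_pos lam rho]]
    by (intro integral_le integrable_continuous_real continuous_on_const) auto
  also have "\<dots> = T * ?S" using T_pos by simp
  finally have "integral {0..T} (\<lambda>r. Psi0 \<sigma> lam (w r)) \<le> T * ?S" .
  then show ?thesis
    using Lam_le[of "w T"] by (auto simp: \<Phi>_def C_def girsanov_density_def intro!: add_mono divide_right_mono)
qed

lemma W_measurable: "0 \<le> t \<Longrightarrow> W t \<in> borel_measurable M"
  using bm by (auto simp: brownian_motion_def)

lemma W_continuous: "\<omega> \<in> space M \<Longrightarrow> continuous_on {0..T} (\<lambda>t. W t \<omega>)"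
  using bm by (auto simp: brownian_motion_def intro: continuous_on_subset)

lemma U_measurable: "0 \<le> t \<Longrightarrow> U t \<in> borel_measurable M"
  unfolding U_def[abs_def] by (intro real_measurable_intros W_measurable)

lemma U_continuous: "\<omega> \<in> space M \<Longrightarrow> continuous_on {0..T} (\<lambda>t. U t \<omega>)"
  unfolding U_def[abs_def] by (intro continuous_intros W_continuous)

lemma X_measurable: "0 \<le> t \<Longrightarrow> X t \<in> borel_measurable M"
  using sol by (auto simp: strong_solution_def)

lemma X_continuous: "\<omega> \<in> space M \<Longrightarrow> continuous_on {0..T} (\<lambda>t. X t \<omega>)"
  using sol by (auto simp: strong_solution_def intro: continuous_on_subset)

lemma path_U: "(\<lambda>\<omega>. U_path \<omega>) \<in> measurable M (path_space T)"
proof (rule measurable_path_map)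
  show "continuous_on {0..} (\<lambda>t. U t \<omega>)" if "\<omega> \<in> space M" for \<omega>
    using bm that unfolding U_def by (intro continuous_intros) (auto simp: brownian_motion_def)
qed (rule U_measurable)

lemma path_X: "(\<lambda>\<omega>. \<lambda>t\<in>{0..T}. X t \<omega>) \<in> measurable M (path_space T)"
  using sol by (intro measurable_path_map) (auto simp: strong_solution_def)

lemma Q_def': "Q = distr M (path_space T) (\<lambda>\<omega>. U_path \<omega>)"
  by (simp add: Q_def path_law_def U_def)

lemma sets_Q [simp]: "sets Q = sets (path_space T)" and space_Q [simp]: "space Q = space (path_space T)"
  and sets_P [simp]: "sets P = sets (path_space T)" and space_P [simp]: "space P = space (path_space T)"
  by (simp_all add: Q_def P_def path_law_def)

sublocale Q: prob_space Q
  unfolding Q_def' by (rule M.prob_space_distr[OF path_U])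

sublocale P: prob_space P
  unfolding P_def path_law_def by (rule M.prob_space_distr[OF path_X])

lemma \<Phi>_measurable: "\<Phi> \<in> borel_measurable (path_space T)"
proof -
  have "(\<lambda>w. Lam (w T)) \<in> borel_measurable (path_space T)"
    using T_pos borel_measurable_continuous_onI[OF continuous_Lam]
    by (intro measurable_compose[OF measurable_path_coordinate]) auto
  moreover have "(\<lambda>w. integral {0..T} (\<lambda>r. Psi0 \<sigma> lam (w r))) \<in> borel_measurable (path_space T)"
  proof (rule measurable_pathwise_integral)
    show "(\<lambda>w. Psi0 \<sigma> lam (w s)) \<in> borel_measurable (path_space T)" if "0 \<le> s" "s \<le> T" for s
      using that borel_measurable_continuous_onI[OF continuous_Psi0]
      by (intro measurable_compose[OF measurable_path_coordinate]) auto
    show "continuous_on {0..T} (\<lambda>s. Psi0 \<sigma> lam (w s))" if "w \<in> space (path_space T)" for w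
      using that by (intro continuous_on_compose2[OF continuous_Psi0]) (auto simp: space_path_space)
  qed (use T_pos in auto)
  ultimately show ?thesis
    unfolding \<Phi>_def girsanov_density_def[abs_def] by measurable
qed

lemma AE_quadratic_variation:
  "AE \<omega> in M. has_qv \<omega>"
  by (rule AE_unit_quadratic_variation[OF bm T_pos])

lemma W_increments_small:
  assumes "\<omega> \<in> space M" "e > 0"
  shows "\<forall>\<^sub>F n in sequentially. \<forall>k<2^n. \<bar>W (grid T n (Suc k)) \<omega> - W (grid T n k) \<omega>\<bar> < e"
  using approx_on_cellsD[OF approx_on_cells_grid[OF W_continuous[OF assms(1)] T_pos] assms(2)]
proof eventually_elim
  case (elim n)
  have "grid T n (Suc k) \<in> {grid T n k..grid T n (Suc k)}" for k
    using grid_mono[of T k "Suc k" n] T_pos by simp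
  then have "\<forall>k<2^n. \<bar>W (grid T n k) \<omega> - W (grid T n (Suc k)) \<omega>\<bar> < e" using elim by blast
  then show ?case by (simp add: abs_minus_commute)
qed

lemma girsanov_exponent_U_tendsto:
  assumes \<omega>: "\<omega> \<in> space M" and W0: "W 0 \<omega> = 0"
    and qv: "has_qv \<omega>"
  shows "(\<lambda>n. exp (log_density n (\<lambda>k. U (grid T n k) \<omega>)))
    \<longlonglongrightarrow> \<Phi> (\<lambda>t. U t \<omega>)"
proof -
  have "(\<lambda>n. log_density n (\<lambda>k. U (grid T n k) \<omega>))
    \<longlonglongrightarrow> (Lam (U T \<omega>) - Lam (U 0 \<omega>)) / \<sigma>\<^sup>2 + integral {0..T} (\<lambda>r. Psi0 \<sigma> lam (U r \<omega>))"
    by (rule girsanov_exponent_tendsto[OF Lam has_derivative_lam continuous_deriv_lam U_continuous[OF \<omega>] T_pos sigma_pos _ _ qv])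
       (auto simp: U_def algebra_simps)
  then show ?thesis
    unfolding \<Phi>_def girsanov_density_def using W0 by (intro tendsto_exp) (simp add: U_def)
qed

lemma euler_X_approx:
  assumes \<omega>: "\<omega> \<in> space M" and W0: "W 0 \<omega> = 0"
    and eq: "\<forall>t\<ge>0. X t \<omega> = x + integral {0..t} (\<lambda>s. lam (X s \<omega>)) + \<sigma> * W t \<omega>"
    and e: "e > 0"
  shows "\<forall>\<^sub>F n in sequentially. \<forall>k\<le>2^n. \<bar>euler \<sigma> lam x T (\<lambda>t. W t \<omega>) n k - X (grid T n k) \<omega>\<bar> < e"
  using eq
  by (intro euler_converges[where X="\<lambda>t. X t \<omega>" and W="\<lambda>t. W t \<omega>",
        OF has_derivative_lam continuous_deriv_lam lam_decreasing X_continuous[OF \<omega>] T_pos W0 _ e]) auto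

text \<open>Divided by \<open>\<sigma>\<close>, the increments of the scheme are Brownian increments
  plus a drift that stays bounded because the scheme is close to \<open>X\<close>; the unit
  quadratic variation therefore survives.\<close>

lemma girsanov_exponent_euler_tendsto:
  assumes \<omega>: "\<omega> \<in> space M" and W0: "W 0 \<omega> = 0"
    and eq: "\<forall>t\<ge>0. X t \<omega> = x + integral {0..t} (\<lambda>s. lam (X s \<omega>)) + \<sigma> * W t \<omega>"
    and qv: "has_qv \<omega>"
  shows "(\<lambda>n. exp (log_density n (euler \<sigma> lam x T (\<lambda>t. W t \<omega>) n)))
    \<longlonglongrightarrow> \<Phi> (\<lambda>t. X t \<omega>)"
proof -
  define y where "y = euler \<sigma> lam x T (\<lambda>t. W t \<omega>)"
  define b where "b n k = lam (y n k) / \<sigma>" for n k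
  have near: "\<forall>\<^sub>F n in sequentially. \<forall>k\<le>2^n. \<bar>y n k - X (grid T n k) \<omega>\<bar> < e" if "e > 0" for e
    unfolding y_def by (rule euler_X_approx[OF \<omega> W0 eq that])
  have clX: "continuous_on {0..T} (\<lambda>r. lam (X r \<omega>))"
    by (rule continuous_on_compose2[OF continuous_lam X_continuous[OF \<omega>]]) auto
  obtain R where R: "R > 0" "\<And>r. r \<in> {0..T} \<Longrightarrow> \<bar>lam (X r \<omega>)\<bar> \<le> R"
    using continuous_on_Icc_bounded[OF clX] by blast
  have "approx_on_cells T (\<lambda>n k. lam (y n k)) (\<lambda>r. lam (X r \<omega>))"
    by (rule approx_on_cells_compose[OF approx_on_cellsI(1)[OF X_continuous[OF \<omega>] T_pos near] X_continuous[OF \<omega>] T_pos continuous_lam])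
  from approx_on_cellsD[OF this zero_less_one]
  have bounded: "\<forall>\<^sub>F n in sequentially. \<forall>k<2^n. \<bar>b n k\<bar> \<le> (R + 1) / \<sigma>"
  proof eventually_elim
    case (elim n)
    show ?case
    proof (intro allI impI)
      fix k :: nat assume k: "k < 2 ^ n"
      have "grid T n k \<in> {grid T n k..grid T n (Suc k)}" using grid_mono[of T k "Suc k" n] T_pos by simp
      then have "\<bar>lam (y n k) - lam (X (grid T n k) \<omega>)\<bar> < 1" "\<bar>lam (X (grid T n k) \<omega>)\<bar> \<le> R"
        using elim k R(2) grid_cell_subset[of T k n] T_pos by (blast, auto)
      then have "\<bar>lam (y n k)\<bar> \<le> R + 1" by linarith
      then show "\<bar>b n k\<bar> \<le> (R + 1) / \<sigma>"
        using sigma_pos by (simp add: b_def abs_divide divide_right_mono)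
    qed
  qed
  note qv' = unit_quadratic_variation_add_drift[OF qv T_pos W_increments_small[OF \<omega>] bounded]
  have "(\<lambda>n. log_density n (y n))
    \<longlonglongrightarrow> (Lam (X T \<omega>) - Lam (X 0 \<omega>)) / \<sigma>\<^sup>2 + integral {0..T} (\<lambda>r. Psi0 \<sigma> lam (X r \<omega>))"
  proof (rule girsanov_exponent_tendsto[OF Lam has_derivative_lam continuous_deriv_lam X_continuous[OF \<omega>] T_pos sigma_pos near _ qv'])
    show "y n (Suc k) - y n k = \<sigma> * (W (grid T n (Suc k)) \<omega> - W (grid T n k) \<omega> + b n k * (T / 2 ^ n))" for n k
      using sigma_pos by (simp add: y_def b_def algebra_simps)
  qed
  moreover have "X 0 \<omega> = x" using eq W0 by simp
  ultimately show ?thesis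
    unfolding \<Phi>_def girsanov_density_def y_def by (intro tendsto_exp) simp
qed

lemma AE_W0: "AE \<omega> in M. W 0 \<omega> = 0"
  using bm by (auto simp: brownian_motion_def)

lemma AE_solution: "AE \<omega> in M. \<forall>t\<ge>0. X t \<omega> = x + integral {0..t} (\<lambda>s. lam (X s \<omega>)) + \<sigma> * W t \<omega>"
  using sol by (auto simp: strong_solution_def)

lemma measurable_\<Phi>_process:
  assumes "\<And>t. 0 \<le> t \<Longrightarrow> Y t \<in> borel_measurable M"
    and "(\<lambda>\<omega>. \<lambda>t\<in>{0..T}. Y t \<omega>) \<in> measurable M (path_space T)"
  shows "(\<lambda>\<omega>. \<Phi> (\<lambda>t. Y t \<omega>)) \<in> borel_measurable M"
proof -
  have "\<Phi> (\<lambda>t. Y t \<omega>) = \<Phi> (\<lambda>t\<in>{0..T}. Y t \<omega>)" for \<omega>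
    unfolding \<Phi>_def using T_pos by (intro girsanov_density_cong) auto
  then show ?thesis using measurable_compose[OF assms(2) \<Phi>_measurable] by simp
qed

text \<open>The truncated test \<open>F n\<close> is inserted into \<open>discrete_girsanov\<close>.
  Integrands on the Euler side are bounded by 1, and on the driftless side by \<open>K\<close>
  because the cutoff caps the density. Both sequences of integrands converge almost surely to the
  untruncated expressions.\<close>

theorem nn_integral_cylinder_test_X:
  assumes J: "finite J" "J \<subseteq> {0..T}"
  shows "(\<integral>\<^sup>+\<omega>. ennreal (cylinder_test m J a (\<lambda>t. X t \<omega>)) \<partial>M)
    = (\<integral>\<^sup>+\<omega>. ennreal (cylinder_test m J a (\<lambda>t. U t \<omega>) * \<Phi> (\<lambda>t. U t \<omega>)) \<partial>M)"
proof -
  \<comment> \<open>The test reads the value at the left end of the cell containing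
    \<open>t\<close>, which makes it a function of the grid values.\<close>
  define f where "f y n = cylinder_test m J a (\<lambda>t. y (cell_index T n t))" for y :: "nat \<Rightarrow> real" and n
  define E where "E y n = exp (log_density n y)" for y n
  \<comment> \<open>The limit of the densities is at most \<open>C\<close>, hence strictly below
    \<open>K\<close>; so the condition \<open>E y n \<le> K\<close> holds eventually on almost every
    path.\<close>
  define K where "K = C + 1"
  have K: "K > 0" "C < K" by (auto simp: K_def C_def add_pos_pos)
  define F where "F n y = ennreal (if E y n \<le> K then f y n else 0)" for n y
  define y where "y \<omega> n = euler \<sigma> lam x T (\<lambda>t. W t \<omega>) n" for \<omega> n
  define u where "u \<omega> n = (\<lambda>k. U (grid T n k) \<omega>)" for \<omega> n
  have E_meas: "(\<lambda>y. E y n) \<in> borel_measurable sequences" for n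
    unfolding E_def
    by (intro measurable_compose[OF _ borel_measurable_exp] measurable_girsanov_exponent[where f="\<lambda>y. y"]
        measurable_sequences_component measurable_lam)
  have f_meas: "(\<lambda>y. f y n) \<in> borel_measurable sequences" for n
    unfolding f_def by (rule measurable_cylinder_test[where f="\<lambda>y t. y (cell_index T n t)"])
      (rule measurable_sequences_component)
  have F_meas: "F n \<in> borel_measurable sequences" for n
    unfolding F_def using E_meas f_meas by measurable
  \<comment> \<open>Neither the density nor the test reads entries beyond \<open>2 ^ n\<close>, so
    stopping there changes nothing.\<close>
  have stop: "F n (stopped_sequence (2 ^ n) v) = F n v" for n v
  proof -
    have "f (stopped_sequence (2 ^ n) v) n = f v n"
      unfolding f_def cylinder_test_def stopped_sequence_def
    proof (rule prod.cong)
      fix t assume "t \<in> J"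
      then have "cell_index T n t \<le> 2 ^ n" using cell_index(1)[OF _ T_pos, of t n] J(2) by auto
      then show "ramp m (a t - (if cell_index T n t \<le> 2 ^ n then v (cell_index T n t) else 0))
          = ramp m (a t - v (cell_index T n t))" by simp
    qed simp
    then show ?thesis by (simp add: F_def E_def girsanov_exponent_stopped)
  qed
  have y_meas: "(\<lambda>\<omega>. F n (y \<omega> n)) \<in> borel_measurable M" for n
  proof -
    have "(\<lambda>\<omega>. stopped_sequence (2 ^ n) (y \<omega> n)) \<in> measurable M sequences"
      unfolding y_def using measurable_euler[OF measurable_lam less_imp_le[OF T_pos]] W_measurable
      by (intro measurable_stopped_sequence measurable_from_natural_filtration[OF measurable_euler[OF measurable_lam less_imp_le[OF T_pos]]])
    from measurable_compose[OF this F_meas[of n]] show ?thesis by (simp add: stop)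
  qed
  have u_meas': "(\<lambda>\<omega>. stopped_sequence (2 ^ n) (u \<omega> n)) \<in> measurable M sequences" for n
    unfolding u_def using T_pos by (intro measurable_stopped_sequence U_measurable) auto
  have u_meas: "(\<lambda>\<omega>. F n (u \<omega> n) * ennreal (E (u \<omega> n) n)) \<in> borel_measurable M" for n
  proof -
    have "(\<lambda>v. F n v * ennreal (E v n)) \<in> borel_measurable sequences"
      using F_meas E_meas by (intro borel_measurable_times_ennreal measurable_compose[OF _ measurable_ennreal])
    from measurable_compose[OF u_meas'[of n] this] show ?thesis
      by (simp add: stop E_def girsanov_exponent_stopped)
  qed
  have identity: "(\<integral>\<^sup>+\<omega>. F n (y \<omega> n) \<partial>M) = (\<integral>\<^sup>+\<omega>. F n (u \<omega> n) * ennreal (E (u \<omega> n) n) \<partial>M)" for n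
    using discrete_girsanov[OF bm T_pos sigma_pos measurable_lam F_meas[of n], of "2 ^ n" x n]
    unfolding stop by (simp add: y_def u_def E_def U_def)
  have f_lim: "(\<lambda>n. f (v n) n) \<longlonglongrightarrow> cylinder_test m J a Y"
    if "\<And>t. t \<in> {0..T} \<Longrightarrow> (\<lambda>n. v n (cell_index T n t)) \<longlonglongrightarrow> Y t" for v Y
    unfolding f_def cylinder_test_def using that J(2)
    by (intro tendsto_prod isCont_tendsto_compose[OF isCont_ramp] tendsto_diff tendsto_const) auto
  have "(\<lambda>n. \<integral>\<^sup>+\<omega>. F n (y \<omega> n) \<partial>M) \<longlonglongrightarrow> (\<integral>\<^sup>+\<omega>. ennreal (cylinder_test m J a (\<lambda>t. X t \<omega>)) \<partial>M)"
  proof (rule nn_integral_dominated_convergence[where w="\<lambda>_. 1"])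
    show "(\<lambda>\<omega>. ennreal (cylinder_test m J a (\<lambda>t. X t \<omega>))) \<in> borel_measurable M"
      using J(2) by (intro measurable_compose[OF _ measurable_ennreal] measurable_cylinder_test X_measurable) auto
    show "AE \<omega> in M. F n (y \<omega> n) \<le> 1" for n
      by (auto simp: F_def f_def cylinder_test_bounds ennreal_le_1)
    show "AE \<omega> in M. (\<lambda>n. F n (y \<omega> n)) \<longlonglongrightarrow> ennreal (cylinder_test m J a (\<lambda>t. X t \<omega>))"
      using AE_quadratic_variation AE_W0 AE_solution AE_space
    proof eventually_elim
      case (elim \<omega>)
      note \<omega> = elim(4) and W0 = elim(2) and eq = elim(3) and qv = elim(1)
      have lim1: "(\<lambda>n. f (y \<omega> n) n) \<longlonglongrightarrow> cylinder_test m J a (\<lambda>t. X t \<omega>)"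
      proof (rule f_lim)
        have "approx_on_cells T (\<lambda>n. y \<omega> n) (\<lambda>t. X t \<omega>)"
          unfolding y_def by (rule approx_on_cellsI(1)[OF X_continuous[OF \<omega>] T_pos euler_X_approx[OF \<omega> W0 eq]])
        then show "(\<lambda>n. y \<omega> n (cell_index T n t)) \<longlonglongrightarrow> X t \<omega>" if "t \<in> {0..T}" for t
          by (rule approx_on_cells_at[OF _ that T_pos])
      qed
      have "\<Phi> (\<lambda>t. X t \<omega>) < K" using \<Phi>_le[OF X_continuous[OF \<omega>]] K(2) by simp
      then have "\<forall>\<^sub>F n in sequentially. E (y \<omega> n) n < K"
        using girsanov_exponent_euler_tendsto[OF \<omega> W0 eq qv] unfolding E_def y_def by (intro order_tendstoD(2))
      then have "\<forall>\<^sub>F n in sequentially. F n (y \<omega> n) = ennreal (f (y \<omega> n) n)"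
        by eventually_elim (simp add: F_def)
      then show ?case using tendsto_ennrealI[OF lim1] by (simp add: tendsto_cong)
    qed
  qed (use y_meas in \<open>auto simp: M.emeasure_space_1\<close>)
  moreover have "(\<lambda>n. \<integral>\<^sup>+\<omega>. F n (y \<omega> n) \<partial>M)
      \<longlonglongrightarrow> (\<integral>\<^sup>+\<omega>. ennreal (cylinder_test m J a (\<lambda>t. U t \<omega>) * \<Phi> (\<lambda>t. U t \<omega>)) \<partial>M)"
    unfolding identity
  proof (rule nn_integral_dominated_convergence[where w="\<lambda>_. ennreal K"])
    show "(\<lambda>\<omega>. ennreal (cylinder_test m J a (\<lambda>t. U t \<omega>) * \<Phi> (\<lambda>t. U t \<omega>))) \<in> borel_measurable M"
      using J(2) by (intro measurable_compose[OF _ measurable_ennreal] borel_measurable_times measurable_cylinder_test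
          measurable_\<Phi>_process U_measurable path_U) auto
    show "AE \<omega> in M. F n (u \<omega> n) * ennreal (E (u \<omega> n) n) \<le> ennreal K" for n
    proof (rule AE_I2)
      fix \<omega>
      have "f (u \<omega> n) n * E (u \<omega> n) n \<le> 1 * E (u \<omega> n) n"
        by (intro mult_right_mono) (auto simp: f_def E_def cylinder_test_bounds)
      then have "f (u \<omega> n) n * E (u \<omega> n) n \<le> K" if "E (u \<omega> n) n \<le> K" using that by linarith
      moreover have "0 \<le> f (u \<omega> n) n" "0 \<le> E (u \<omega> n) n" by (simp_all add: f_def E_def cylinder_test_bounds)
      ultimately show "F n (u \<omega> n) * ennreal (E (u \<omega> n) n) \<le> ennreal K"
        by (auto simp: F_def ennreal_mult[symmetric] intro!: ennreal_leI)
    qed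
    show "AE \<omega> in M. (\<lambda>n. F n (u \<omega> n) * ennreal (E (u \<omega> n) n))
        \<longlonglongrightarrow> ennreal (cylinder_test m J a (\<lambda>t. U t \<omega>) * \<Phi> (\<lambda>t. U t \<omega>))"
      using AE_quadratic_variation AE_W0 AE_space
    proof eventually_elim
      case (elim \<omega>)
      note \<omega> = elim(3) and W0 = elim(2) and qv = elim(1)
      have lim1: "(\<lambda>n. f (u \<omega> n) n) \<longlonglongrightarrow> cylinder_test m J a (\<lambda>t. U t \<omega>)"
      proof (rule f_lim)
        have "approx_on_cells T (\<lambda>n. u \<omega> n) (\<lambda>t. U t \<omega>)"
          unfolding u_def by (rule approx_on_cells_grid[OF U_continuous[OF \<omega>] T_pos])
        then show "(\<lambda>n. u \<omega> n (cell_index T n t)) \<longlonglongrightarrow> U t \<omega>" if "t \<in> {0..T}" for t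
          by (rule approx_on_cells_at[OF _ that T_pos])
      qed
      have lim2: "(\<lambda>n. E (u \<omega> n) n) \<longlonglongrightarrow> \<Phi> (\<lambda>t. U t \<omega>)"
        using girsanov_exponent_U_tendsto[OF \<omega> W0 qv] unfolding E_def u_def .
      have "\<Phi> (\<lambda>t. U t \<omega>) < K" using \<Phi>_le[OF U_continuous[OF \<omega>]] K(2) by simp
      then have "\<forall>\<^sub>F n in sequentially. E (u \<omega> n) n < K" using lim2 by (intro order_tendstoD(2))
      then have "\<forall>\<^sub>F n in sequentially. F n (u \<omega> n) * ennreal (E (u \<omega> n) n) = ennreal (f (u \<omega> n) n * E (u \<omega> n) n)"
        by eventually_elim (simp add: F_def ennreal_mult f_def E_def cylinder_test_bounds)
      then show ?case using tendsto_ennrealI[OF tendsto_mult[OF lim1 lim2]] by (simp add: tendsto_cong)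
    qed
  qed (use u_meas in \<open>auto simp: M.emeasure_space_1\<close>)
  ultimately show ?thesis by (rule LIMSEQ_unique)
qed

theorem P_eq_density: "P = density Q (\<lambda>w. ennreal (\<Phi> w))"
proof (rule path_measure_eqI)
  have [measurable]: "\<Phi> \<in> borel_measurable Q"
    using \<Phi>_measurable by (simp add: measurable_cong_sets[OF sets_Q refl])
  have eq: "(\<integral>\<^sup>+w. ennreal (cylinder_test k J a w) \<partial>P)
      = (\<integral>\<^sup>+w. ennreal (cylinder_test k J a w) \<partial>density Q (\<lambda>w. ennreal (\<Phi> w)))"
    if J: "finite J" "J \<subseteq> {0..T}" for k J a
  proof -
    have ct: "(\<lambda>w. cylinder_test k J a w) \<in> borel_measurable (path_space T)"
      using J by (intro measurable_cylinder_test[where f="\<lambda>w. w"] measurable_path_coordinate) auto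
    have ctr: "cylinder_test k J a (\<lambda>t\<in>{0..T}. v t) = cylinder_test k J a v" for v
      unfolding cylinder_test_def using J(2) by (intro prod.cong) auto
    have \<Phi>r: "\<Phi> (\<lambda>t\<in>{0..T}. v t) = \<Phi> v" for v
      unfolding \<Phi>_def using T_pos by (intro girsanov_density_cong) auto
    have "(\<integral>\<^sup>+w. ennreal (cylinder_test k J a w) \<partial>P) = (\<integral>\<^sup>+\<omega>. ennreal (cylinder_test k J a (\<lambda>t. X t \<omega>)) \<partial>M)"
      unfolding P_def path_law_def using ct by (subst nn_integral_distr[OF path_X]) (auto simp: ctr)
    also have "\<dots> = (\<integral>\<^sup>+\<omega>. ennreal (cylinder_test k J a (\<lambda>t. U t \<omega>) * \<Phi> (\<lambda>t. U t \<omega>)) \<partial>M)"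
      by (rule nn_integral_cylinder_test_X[OF J])
    also have "\<dots> = (\<integral>\<^sup>+w. ennreal (cylinder_test k J a w * \<Phi> w) \<partial>Q)"
      unfolding Q_def' using ct \<Phi>_measurable by (subst nn_integral_distr[OF path_U]) (auto simp: ctr \<Phi>r)
    also have "\<dots> = (\<integral>\<^sup>+w. ennreal (cylinder_test k J a w) \<partial>density Q (\<lambda>w. ennreal (\<Phi> w)))"
      using ct \<Phi>_measurable by (subst nn_integral_density)
        (auto simp: measurable_cong_sets[OF sets_Q refl] ennreal_mult mult.commute cylinder_test_bounds less_imp_le[OF \<Phi>_pos])
    finally show ?thesis .
  qed
  show "(\<integral>\<^sup>+w. ennreal (cylinder_test k J a w) \<partial>P)
      = (\<integral>\<^sup>+w. ennreal (cylinder_test k J a w) \<partial>density Q (\<lambda>w. ennreal (\<Phi> w)))"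
    if "finite J" "J \<subseteq> {0..T}" for k J a by (rule eq[OF that])
  show "finite_measure P" by (rule P.finite_measure_axioms)
  \<comment> \<open>For \<open>J = {}\<close> the test is constantly 1, so the identity just proved
    gives the density total mass 1.\<close>
  have "(\<integral>\<^sup>+w. 1 \<partial>density Q (\<lambda>w. ennreal (\<Phi> w))) = (\<integral>\<^sup>+w. 1 \<partial>P)"
    using eq[of "{}"] by (simp add: cylinder_test_def)
  then show "finite_measure (density Q (\<lambda>w. ennreal (\<Phi> w)))"
    using P.emeasure_space_1 by (intro finite_measureI) simp
qed simp_all

end

section \<open>Exponential moments of simple stochastic integrals\<close>

lemma borel_measurable_sum_list:
  fixes f :: "'b \<Rightarrow> 'a \<Rightarrow> real"
  assumes "\<And>e. e \<in> set K \<Longrightarrow> f e \<in> borel_measurable N"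
  shows "(\<lambda>w. \<Sum>e\<leftarrow>K. f e w) \<in> borel_measurable N"
  using assms by (induction K) (simp_all add: borel_measurable_add)

text \<open>The case \<open>\<sigma> = 1\<close> of \<open>normal_density_shift\<close>, after
  translating the variable of integration by \<open>l * h\<close>.\<close>

lemma nn_integral_normal_exp:
  assumes h: "h > 0"
  shows "(\<integral>\<^sup>+z. ennreal (normal_density 0 (sqrt h) z) * ennreal (exp (l * z - h * l\<^sup>2 / 2)) \<partial>lborel) = 1"
proof -
  let ?\<phi> = "normal_density 0 (sqrt h)"
  have "(\<integral>\<^sup>+z. ennreal (?\<phi> z) * ennreal (exp (l * z - h * l\<^sup>2 / 2)) \<partial>lborel)
      = (\<integral>\<^sup>+z. ennreal (?\<phi> z) * ennreal (exp (l * z - h * l\<^sup>2 / 2)) \<partial>distr lborel borel ((+) (l * h)))"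
    by (simp only: lborel_distr_plus)
  also have "\<dots> = (\<integral>\<^sup>+z. ennreal (?\<phi> (l * h + z)) * ennreal (exp (l * (l * h + z) - h * l\<^sup>2 / 2)) \<partial>lborel)"
    by (subst nn_integral_distr) auto
  also have "\<dots> = (\<integral>\<^sup>+z. ennreal (?\<phi> z) \<partial>lborel)"
  proof (rule nn_integral_cong)
    fix z
    have "?\<phi> (l * h + z) * exp (l * (l * h + z) - h * l\<^sup>2 / 2) = ?\<phi> z"
      using normal_density_shift[OF zero_less_one h, of l z] by simp
    then show "ennreal (?\<phi> (l * h + z)) * ennreal (exp (l * (l * h + z) - h * l\<^sup>2 / 2)) = ennreal (?\<phi> z)"
      by (subst ennreal_mult[symmetric]) (simp_all only: normal_density_nonneg exp_ge_zero)
  qed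
  also have "\<dots> = 1"
    using prob_space.emeasure_space_1[OF prob_space_normal_density[of "sqrt h" 0]] h
    by (simp add: emeasure_density)
  finally show ?thesis .
qed

text \<open>The intervals of \<open>K\<close> may overlap and come in any order, so the induction
  runs over their endpoints. Between neighbouring endpoints the integrand is constant in time and
  known at the left one, and the Gaussian exponential moment makes the new factor integrate to
  1.\<close>

theorem simple_exponential_martingale:
  fixes K :: "'a simple_process" and c :: real
  assumes W: "brownian_motion M W" and K: "simple_integrand (natural_filtration M W) T K" and T: "0 < T"
  shows "(\<integral>\<^sup>+w. ennreal (exp (c * simple_integral W K w
      - c\<^sup>2 / 2 * integral {0..T} (\<lambda>t. (simple_value K t w)\<^sup>2))) \<partial>M) = 1"
    and "(\<lambda>w. integral {0..T} (\<lambda>t. (simple_value K t w)\<^sup>2)) \<in> borel_measurable M"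
proof -
  interpret prob_space M by (rule brownian_motion_prob_space[OF W])
  \<comment> \<open>Including 0 and \<open>T\<close> gives the induction its start and its final
    time.\<close>
  define S where "S = {0, T} \<union> fst ` set K \<union> (fst \<circ> snd) ` set K"
  have finS: "finite S" by (simp add: S_def)
  have entry: "0 \<le> s" "s \<le> u" "u \<le> T" "\<xi> \<in> borel_measurable (natural_filtration M W s)" "s \<in> S" "u \<in> S"
    if "(s, u, \<xi>) \<in> set K" for s u \<xi>
    using K that by (auto simp: simple_integrand_def S_def image_iff intro: rev_bexI)
  have S0: "0 \<le> r" if "r \<in> S" for r
    using that T entry(1,2) by (force simp: S_def)
  \<comment> \<open>The integral stopped at time \<open>p\<close>: entries after \<open>p\<close>
    vanish and an entry containing \<open>p\<close> is cut there.\<close>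
  define N where "N p w = (\<Sum>(s, u, \<xi>)\<leftarrow>K. \<xi> w * (W (min u p) w - W (min s p) w))" for p w
  \<comment> \<open>Measurability at time \<open>p\<close> is carried along because the next step
    has to freeze \<open>A\<close> and \<open>N p\<close> as part of the past.\<close>
  have main: "\<exists>A. A \<in> borel_measurable (natural_filtration M W p)
      \<and> (\<forall>w. ((\<lambda>t. (simple_value K t w)\<^sup>2) has_integral A w) {0..p})
      \<and> N p \<in> borel_measurable (natural_filtration M W p)
      \<and> (\<integral>\<^sup>+w. ennreal (exp (c * N p w - c\<^sup>2 / 2 * A w)) \<partial>M) = 1" if "p \<in> S" for p
    using that
  proof (induction "card {r \<in> S. r < p}" arbitrary: p rule: less_induct)
    case less
    show ?case
    proof (cases "p = 0")
      case True
      have "N 0 w = 0" for w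
      proof -
        have "(case e of (s, u, \<xi>) \<Rightarrow> \<xi> w * (W (min u 0) w - W (min s 0) w)) = 0" if "e \<in> set K" for e
          using entry(1,2) that by (cases e) (fastforce simp: min_absorb2)
        then show ?thesis unfolding N_def by (simp add: sum_list_0 cong: map_cong)
      qed
      then have "N 0 = (\<lambda>_. 0)" by auto
      then show ?thesis
        unfolding True by (intro exI[of _ "\<lambda>_. 0"]) (simp add: emeasure_space_1 has_integral_refl)
    next
      case False
      then have p: "0 < p" using S0 less.prems by force
      define R where "R = {r \<in> S. r < p}"
      define q where "q = Max R"
      have R: "finite R" "R \<noteq> {}" using finS p by (auto simp: R_def S_def)
      have q: "q \<in> S" "q < p" using Max_in[OF R] by (auto simp: q_def R_def)
      have gap: "r \<le> q \<or> p \<le> r" if "r \<in> S" for r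
        using Max_ge[OF R(1), of r] that by (auto simp: q_def R_def)
      have "{r \<in> S. r < q} \<subset> {r \<in> S. r < p}" using q by auto
      then have "card {r \<in> S. r < q} < card {r \<in> S. r < p}" using finS by (intro psubset_card_mono) auto
      from less.hyps[OF this q(1)] obtain A where
        A: "A \<in> borel_measurable (natural_filtration M W q)"
        and A_int: "\<And>w. ((\<lambda>t. (simple_value K t w)\<^sup>2) has_integral A w) {0..q}"
        and Nq: "N q \<in> borel_measurable (natural_filtration M W q)"
        and one: "(\<integral>\<^sup>+w. ennreal (exp (c * N q w - c\<^sup>2 / 2 * A w)) \<partial>M) = 1"
        by blast
      have q0: "0 \<le> q" using S0 q by auto
      \<comment> \<open>No endpoint lies strictly between \<open>q\<close> and \<open>p\<close>, so
        an entry either covers the whole gap or misses it; \<open>\<eta>\<close> collects those that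
        cover it.\<close>
      define \<eta> where "\<eta> w = (\<Sum>(s, u, \<xi>)\<leftarrow>K. \<xi> w * (if s \<le> q \<and> p \<le> u then 1 else 0))" for w
      have \<eta>: "\<eta> \<in> borel_measurable (natural_filtration M W q)"
        unfolding \<eta>_def case_prod_beta'
      proof (rule borel_measurable_sum_list)
        fix e assume e: "e \<in> set K"
        obtain s u \<xi> where eq: "e = (s, u, \<xi>)" by (cases e)
        show "(\<lambda>w. snd (snd e) w * (if fst e \<le> q \<and> p \<le> fst (snd e) then 1 else 0)) \<in> borel_measurable (natural_filtration M W q)"
        proof (cases "s \<le> q")
          case True
          then show ?thesis
            using measurable_natural_filtration_mono[OF entry(4)[OF e[unfolded eq]] True] by (simp add: eq)
        qed (simp add: eq)
      qed
      have const_on_gap: "simple_value K t w = \<eta> w" if t: "q < t" "t < p" for t w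
        unfolding simple_value_def \<eta>_def
      proof (intro arg_cong[where f=sum_list] map_cong refl)
        fix e assume e: "e \<in> set K"
        obtain s u \<xi> where eq: "e = (s, u, \<xi>)" by (cases e)
        have "s \<le> q \<or> p \<le> s" "u \<le> q \<or> p \<le> u" using gap entry(5,6)[OF e[unfolded eq]] by auto
        then show "(case e of (s, u, \<xi>) \<Rightarrow> \<xi> w * indicator {s<..u} t)
            = (case e of (s, u, \<xi>) \<Rightarrow> \<xi> w * (if s \<le> q \<and> p \<le> u then 1 else 0))"
          using t by (auto simp: eq indicator_def)
      qed
      have incr: "N p w = N q w + \<eta> w * (W p w - W q w)" for w
      proof -
        have "(case e of (s, u, \<xi>) \<Rightarrow> \<xi> w * (W (min u p) w - W (min s p) w))
          = (case e of (s, u, \<xi>) \<Rightarrow> \<xi> w * (W (min u q) w - W (min s q) w))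
            + (case e of (s, u, \<xi>) \<Rightarrow> \<xi> w * (if s \<le> q \<and> p \<le> u then 1 else 0)) * (W p w - W q w)"
          if e: "e \<in> set K" for e
        proof -
          obtain s u \<xi> where eq: "e = (s, u, \<xi>)" by (cases e)
          have "s \<le> q \<or> p \<le> s" "u \<le> q \<or> p \<le> u" "s \<le> u"
            using gap entry(5,6)[OF e[unfolded eq]] entry(2)[OF e[unfolded eq]] by auto
          then consider "s \<le> q" "u \<le> q" | "s \<le> q" "p \<le> u" | "p \<le> s" "p \<le> u" using q(2) by linarith
          then show ?thesis
            using q(2) by cases (auto simp: eq min_def algebra_simps)
        qed
        then have "map (\<lambda>(s, u, \<xi>). \<xi> w * (W (min u p) w - W (min s p) w)) K
          = map (\<lambda>e. (case e of (s, u, \<xi>) \<Rightarrow> \<xi> w * (W (min u q) w - W (min s q) w))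
            + (case e of (s, u, \<xi>) \<Rightarrow> \<xi> w * (if s \<le> q \<and> p \<le> u then 1 else 0)) * (W p w - W q w)) K"
          by (intro map_cong refl)
        then show ?thesis
          unfolding N_def \<eta>_def by (simp only: sum_list_addf sum_list_mult_const)
      qed
      have A_int': "((\<lambda>t. (simple_value K t w)\<^sup>2) has_integral (A w + (\<eta> w)\<^sup>2 * (p - q))) {0..p}" for w
      proof (rule has_integral_combine[OF q0 less_imp_le[OF q(2)] A_int])
        have "((\<lambda>t. (\<eta> w)\<^sup>2) has_integral ((\<eta> w)\<^sup>2 * (p - q))) {q..p}"
          using has_integral_const_real[of "(\<eta> w)\<^sup>2" q p] q(2) by (simp add: mult.commute)
        \<comment> \<open>The values at \<open>q\<close> and \<open>p\<close> are ignored: the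
          intervals are left-open, so the value at \<open>q\<close> may still come from entries
          ending there.\<close>
        then show "((\<lambda>t. (simple_value K t w)\<^sup>2) has_integral ((\<eta> w)\<^sup>2 * (p - q))) {q..p}"
          by (rule has_integral_spike_finite[of "{q, p}", rotated 2]) (auto simp: const_on_gap)
      qed
      have measW: "W p \<in> borel_measurable (natural_filtration M W p)" "W q \<in> borel_measurable (natural_filtration M W p)"
        using q q0 p by (auto intro!: measurable_natural_filtration_component)
      note up = measurable_natural_filtration_mono[OF _ less_imp_le[OF q(2)], of _ M W]
      define h where "h = p - q"
      let ?a = "\<lambda>w. ennreal (exp (c * N q w - c\<^sup>2 / 2 * A w))"
        and ?b = "\<lambda>w z. ennreal (exp (c * \<eta> w * z - h * (c * \<eta> w)\<^sup>2 / 2))"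
      have h: "h > 0" using q by (simp add: h_def)
      have "(\<integral>\<^sup>+w. ennreal (exp (c * N p w - c\<^sup>2 / 2 * (A w + (\<eta> w)\<^sup>2 * h))) \<partial>M)
        = (\<integral>\<^sup>+w. ?a w
            * ?b w (W p w - W q w) \<partial>M)"
        by (intro nn_integral_cong, subst ennreal_mult[symmetric])
           (auto simp: incr exp_add[symmetric] algebra_simps power_mult_distrib)
      also have "\<dots> = (\<integral>\<^sup>+w. (\<integral>\<^sup>+z. ennreal (normal_density 0 (sqrt h) z) * (?a w
            * ?b w z) \<partial>lborel) \<partial>M)"
      proof -
        note [measurable] = A Nq \<eta>
        show ?thesis
          using nn_integral_brownian_increment[OF W q0 q(2), of "\<lambda>(w, z). ?a w
            * ?b w z"]
          by (simp add: h_def)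
      qed
      also have "\<dots> = (\<integral>\<^sup>+w. ?a w \<partial>M)"
      proof (rule nn_integral_cong)
        fix w
        have "(\<integral>\<^sup>+z. ennreal (normal_density 0 (sqrt h) z) * (?a w
            * ?b w z) \<partial>lborel)
          = (\<integral>\<^sup>+z. ?a w * (ennreal (normal_density 0 (sqrt h) z)
            * ?b w z) \<partial>lborel)"
          by (simp only: mult_ac)
        also have "\<dots> = ?a w"
          using nn_integral_normal_exp[OF h, of "c * \<eta> w"] by (subst nn_integral_cmult) simp_all
        finally show "(\<integral>\<^sup>+z. ennreal (normal_density 0 (sqrt h) z) * (?a w
            * ?b w z) \<partial>lborel)
          = ?a w" .
      qed
      finally have "(\<integral>\<^sup>+w. ennreal (exp (c * N p w - c\<^sup>2 / 2 * (A w + (\<eta> w)\<^sup>2 * h))) \<partial>M) = 1"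
        using one by simp
      moreover have "N p \<in> borel_measurable (natural_filtration M W p)"
      proof -
        note [measurable] = up[OF Nq] up[OF \<eta>] measW
        have "(\<lambda>w. N q w + \<eta> w * (W p w - W q w)) \<in> borel_measurable (natural_filtration M W p)" by measurable
        then show ?thesis by (simp add: incr[symmetric])
      qed
      moreover have "(\<lambda>w. A w + (\<eta> w)\<^sup>2 * h) \<in> borel_measurable (natural_filtration M W p)"
      proof -
        note [measurable] = up[OF A] up[OF \<eta>]
        show ?thesis by measurable
      qed
      ultimately show ?thesis
        using A_int' by (intro exI[of _ "\<lambda>w. A w + (\<eta> w)\<^sup>2 * h"]) (simp add: h_def)
    qed
  qed
  have "T \<in> S" by (simp add: S_def)
  from main[OF this] obtain A where
    A: "\<And>w. ((\<lambda>t. (simple_value K t w)\<^sup>2) has_integral A w) {0..T}"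
    "(\<integral>\<^sup>+w. ennreal (exp (c * N T w - c\<^sup>2 / 2 * A w)) \<partial>M) = 1"
    "A \<in> borel_measurable (natural_filtration M W T)"
    by blast
  have "N T w = simple_integral W K w" for w
    unfolding N_def simple_integral_def
    using entry(2,3) by (intro arg_cong[where f=sum_list] map_cong refl) (force simp: min_absorb1)
  then show "(\<integral>\<^sup>+w. ennreal (exp (c * simple_integral W K w
      - c\<^sup>2 / 2 * integral {0..T} (\<lambda>t. (simple_value K t w)\<^sup>2))) \<partial>M) = 1"
    using A(2) by (simp add: integral_unique[OF A(1)])
  have "A \<in> borel_measurable M"
    using W by (intro measurable_from_natural_filtration[OF A(3)]) (auto simp: brownian_motion_def)
  then show "(\<lambda>w. integral {0..T} (\<lambda>t. (simple_value K t w)\<^sup>2)) \<in> borel_measurable M"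
    by (simp add: integral_unique[OF A(1)])
qed

section \<open>Convergence in probability\<close>

text \<open>The distance capped at 1 is bounded, so convergence in probability becomes convergence
  in mean, which provides an almost surely convergent subsequence.\<close>

lemma conv_in_prob_AE_subseq:
  assumes M: "prob_space M" and conv: "conv_in_prob M Y Y'"
  obtains r where "strict_mono (r :: nat \<Rightarrow> nat)" "AE w in M. (\<lambda>n. Y (r n) w) \<longlonglongrightarrow> Y' w"
proof -
  interpret prob_space M by (rule M)
  note [measurable] = conv[unfolded conv_in_prob_def, THEN conjunct1, rule_format]
    conv[unfolded conv_in_prob_def, THEN conjunct2, THEN conjunct1]
  define u where "u n w = min 1 \<bar>Y n w - Y' w\<bar>" for n w
  have u[measurable]: "u n \<in> borel_measurable M" for n unfolding u_def by measurable
  have int: "integrable M (u n)" for n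
    by (rule integrable_const_bound[where B=1]) (auto simp: u_def)
  have "(\<lambda>n. \<integral>w. norm (u n w) \<partial>M) \<longlonglongrightarrow> 0"
  proof (rule LIMSEQ_I)
    fix e :: real assume e: "e > 0"
    define A where "A n = {w \<in> space M. \<bar>Y n w - Y' w\<bar> > e / 2}" for n
    have A[measurable]: "A n \<in> sets M" for n unfolding A_def by measurable
    have "(\<lambda>n. measure M (A n)) \<longlonglongrightarrow> 0"
      using conv half_gt_zero[OF e] unfolding conv_in_prob_def A_def by blast
    from order_tendstoD(2)[OF this half_gt_zero[OF e]]
    obtain no where no: "\<And>n. no \<le> n \<Longrightarrow> measure M (A n) < e / 2"
      by (auto simp: eventually_sequentially)
    have "norm ((\<integral>w. norm (u n w) \<partial>M) - 0) < e" if n: "no \<le> n" for n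
    proof -
      have "(\<integral>w. norm (u n w) \<partial>M) \<le> (\<integral>w. e / 2 + indicator (A n) w \<partial>M)"
      proof (rule integral_mono)
        show "norm (u n w) \<le> e / 2 + indicator (A n) w" if "w \<in> space M" for w
        proof (cases "w \<in> A n")
          case False
          then have "\<bar>Y n w - Y' w\<bar> \<le> e / 2" using that by (simp add: A_def)
          then have "u n w \<le> e / 2" unfolding u_def by linarith
          then show ?thesis using False by (simp add: u_def)
        qed (use e in \<open>simp add: u_def\<close>)
      qed (use int in \<open>auto intro!: Bochner_Integration.integrable_add integrable_real_indicator simp: emeasure_eq_measure\<close>)
      also have "\<dots> = e / 2 + measure M (A n)"
        by (subst Bochner_Integration.integral_add) (auto simp: prob_space emeasure_eq_measure)
      finally show ?thesis using no[OF n] by simp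
    qed
    then show "\<exists>no. \<forall>n\<ge>no. norm ((\<integral>w. norm (u n w) \<partial>M) - 0) < e" by blast
  qed
  from tendsto_L1_AE_subseq[OF int this] obtain r where
    r: "strict_mono r" "AE w in M. (\<lambda>n. u (r n) w) \<longlonglongrightarrow> 0" by auto
  have "AE w in M. (\<lambda>n. Y (r n) w) \<longlonglongrightarrow> Y' w"
    using r(2)
  proof eventually_elim
    case (elim w)
    show ?case
    proof (rule tendstoI)
      fix e :: real assume e: "e > 0"
      have "\<forall>\<^sub>F n in sequentially. u (r n) w < min 1 e" using elim e by (intro order_tendstoD(2)) auto
      then show "\<forall>\<^sub>F n in sequentially. dist (Y (r n) w) (Y' w) < e"
        by eventually_elim (auto simp: u_def dist_real_def min_less_iff_disj)
    qed
  qed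
  with r(1) show ?thesis by (rule that)
qed

lemma conv_in_prob_subseq:
  assumes "conv_in_prob M Y Y'" "strict_mono r"
  shows "conv_in_prob M (\<lambda>n. Y (r n)) Y'"
  using assms unfolding conv_in_prob_def
  by (auto intro: LIMSEQ_subseq_LIMSEQ[unfolded comp_def])

lemma AE_tendsto_imp_conv_in_prob:
  assumes M: "prob_space M" and [measurable]: "\<And>n. Y n \<in> borel_measurable M" "Y' \<in> borel_measurable M"
    and lim: "AE w in M. (\<lambda>n. Y n w) \<longlonglongrightarrow> Y' w"
  shows "conv_in_prob M Y Y'"
  unfolding conv_in_prob_def
proof (intro conjI allI impI)
  interpret prob_space M by (rule M)
  fix \<epsilon> :: real assume \<epsilon>: "\<epsilon> > 0"
  define A where "A n = {w \<in> space M. \<bar>Y n w - Y' w\<bar> > \<epsilon>}" for n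
  have A[measurable]: "A n \<in> sets M" for n unfolding A_def by measurable
  have "(\<lambda>n. \<integral>w. indicator (A n) w \<partial>M) \<longlonglongrightarrow> (\<integral>w. 0 \<partial>M :: real)"
  proof (rule integral_dominated_convergence[where w="\<lambda>_. 1"])
    show "AE w in M. (\<lambda>n. indicator (A n) w :: real) \<longlonglongrightarrow> 0"
      using lim
    proof eventually_elim
      case (elim w)
      have "\<forall>\<^sub>F n in sequentially. dist (Y n w) (Y' w) < \<epsilon>" using elim \<epsilon> by (rule tendstoD)
      then show ?case
        by (intro tendsto_eventually) (auto elim!: eventually_mono simp: A_def dist_real_def)
    qed
  qed (auto simp: indicator_def)
  then show "(\<lambda>n. measure M {w \<in> space M. \<bar>Y n w - Y' w\<bar> > \<epsilon>}) \<longlonglongrightarrow> 0"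
    by (simp add: A_def[symmetric] integral_indicator)
qed fact+

text \<open>Since \<open>exp v + exp (- v) = 2 + (exp (v/2) - exp (- v/2))\<^sup>2\<close>, two exponential moments suffice.\<close>

lemma AE_zero_if_exp_moments_le_1:
  assumes M: "prob_space M" and [measurable]: "V \<in> borel_measurable M"
    and le: "(\<integral>\<^sup>+w. ennreal (exp (V w)) \<partial>M) \<le> 1" "(\<integral>\<^sup>+w. ennreal (exp (- V w)) \<partial>M) \<le> 1"
  shows "AE w in M. V w = 0"
proof -
  interpret prob_space M by (rule M)
  define G where "G w = exp (V w / 2) - exp (- V w / 2)" for w
  have [measurable]: "G \<in> borel_measurable M" unfolding G_def by measurable
  have id: "exp (V w) + exp (- V w) = 2 + (G w)\<^sup>2" for w
  proof -
    have "exp (V w) = exp (V w / 2) * exp (V w / 2)" "exp (- V w) = exp (- V w / 2) * exp (- V w / 2)"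
      "exp (V w / 2) * exp (- V w / 2) = 1"
      by (simp_all add: exp_add[symmetric])
    then show ?thesis unfolding G_def by (simp add: power2_eq_square algebra_simps)
  qed
  have "2 + (\<integral>\<^sup>+w. ennreal ((G w)\<^sup>2) \<partial>M) = (\<integral>\<^sup>+w. ennreal (2 + (G w)\<^sup>2) \<partial>M)"
    using nn_integral_add[of "\<lambda>_. 2" M "\<lambda>w. ennreal ((G w)\<^sup>2)"] by (simp add: emeasure_space_1 ennreal_plus)
  also have "\<dots> = (\<integral>\<^sup>+w. ennreal (exp (V w)) + ennreal (exp (- V w)) \<partial>M)"
    by (intro nn_integral_cong) (simp add: id[symmetric] ennreal_plus)
  also have "\<dots> \<le> 1 + 1"
    using add_mono[OF le] by (subst nn_integral_add) auto
  finally have "2 + (\<integral>\<^sup>+w. ennreal ((G w)\<^sup>2) \<partial>M) \<le> 2 + 0" by simp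
  then have "(\<integral>\<^sup>+w. ennreal ((G w)\<^sup>2) \<partial>M) = 0"
    by (subst (asm) ennreal_add_left_cancel_le) auto
  then have "AE w in M. G w = 0" by (subst (asm) nn_integral_0_iff_AE) auto
  then show ?thesis by eventually_elim (auto simp: G_def)
qed

section \<open>Pathwise integrals of simple processes\<close>

text \<open>Gauge integrability alone does not pass to products and squares. This class does, it
  contains step functions and continuous functions, and its members are integrable.\<close>

definition bounded_measurable_on :: "real \<Rightarrow> (real \<Rightarrow> real) \<Rightarrow> bool" where
  "bounded_measurable_on T f \<longleftrightarrow>
     f \<in> borel_measurable (lebesgue_on {0..T}) \<and> (\<exists>B. \<forall>t\<in>{0..T}. \<bar>f t\<bar> \<le> B)"

lemma bounded_measurable_onI:
  assumes "f \<in> borel_measurable (lebesgue_on {0..T})" "\<And>t. t \<in> {0..T} \<Longrightarrow> \<bar>f t\<bar> \<le> B"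
  shows "bounded_measurable_on T f"
  unfolding bounded_measurable_on_def using assms by (intro conjI exI[of _ B] ballI)

lemma bounded_measurable_onE:
  assumes "bounded_measurable_on T f"
  obtains B where "f \<in> borel_measurable (lebesgue_on {0..T})" "\<And>t. t \<in> {0..T} \<Longrightarrow> \<bar>f t\<bar> \<le> B"
proof -
  from assms obtain B where B: "f \<in> borel_measurable (lebesgue_on {0..T})" "\<forall>t\<in>{0..T}. \<bar>f t\<bar> \<le> B"
    unfolding bounded_measurable_on_def by (elim conjE exE)
  show thesis by (rule that[OF B(1) bspec[OF B(2)]])
qed

lemma bounded_measurable_on_integrable:
  assumes "bounded_measurable_on T f"
  shows "f integrable_on {0..T}"
  using assms
proof (rule bounded_measurable_onE)
  fix B assume f: "f \<in> borel_measurable (lebesgue_on {0..T})" and B: "\<And>t. t \<in> {0..T} \<Longrightarrow> \<bar>f t\<bar> \<le> B"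
  show ?thesis
    by (rule measurable_bounded_by_integrable_imp_integrable_real[OF f integrable_const_ivl B]) simp_all
qed

lemma bounded_measurable_on_continuous:
  assumes f: "continuous_on {0..T} f"
  shows "bounded_measurable_on T f"
  using f
proof (rule continuous_on_Icc_bounded)
  fix R assume R: "\<And>t. t \<in> {0..T} \<Longrightarrow> \<bar>f t\<bar> \<le> R"
  have "f \<in> borel_measurable (lebesgue_on {0..T})"
    by (rule continuous_imp_measurable_on_sets_lebesgue[OF f]) simp
  then show ?thesis using R by (rule bounded_measurable_onI)
qed

lemma bounded_measurable_on_add:
  assumes "bounded_measurable_on T f" "bounded_measurable_on T g"
  shows "bounded_measurable_on T (\<lambda>t. f t + g t)"
  using assms(1)
proof (rule bounded_measurable_onE)
  fix B assume f: "f \<in> borel_measurable (lebesgue_on {0..T})" and B: "\<And>t. t \<in> {0..T} \<Longrightarrow> \<bar>f t\<bar> \<le> B"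
  from assms(2) show ?thesis
  proof (rule bounded_measurable_onE)
    fix C assume g: "g \<in> borel_measurable (lebesgue_on {0..T})" and C: "\<And>t. t \<in> {0..T} \<Longrightarrow> \<bar>g t\<bar> \<le> C"
    show ?thesis
    proof (rule bounded_measurable_onI[OF borel_measurable_add[OF f g]])
      fix t assume "t \<in> {0..T}"
      from B[OF this] C[OF this] show "\<bar>f t + g t\<bar> \<le> B + C" by linarith
    qed
  qed
qed

lemma bounded_measurable_on_mult:
  assumes "bounded_measurable_on T f" "bounded_measurable_on T g"
  shows "bounded_measurable_on T (\<lambda>t. f t * g t)"
  using assms(1)
proof (rule bounded_measurable_onE)
  fix B assume f: "f \<in> borel_measurable (lebesgue_on {0..T})" and B: "\<And>t. t \<in> {0..T} \<Longrightarrow> \<bar>f t\<bar> \<le> B"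
  from assms(2) show ?thesis
  proof (rule bounded_measurable_onE)
    fix C assume g: "g \<in> borel_measurable (lebesgue_on {0..T})" and C: "\<And>t. t \<in> {0..T} \<Longrightarrow> \<bar>g t\<bar> \<le> C"
    show ?thesis
    proof (rule bounded_measurable_onI[OF borel_measurable_times[OF f g]])
      fix t assume "t \<in> {0..T}"
      from mult_mono[OF B[OF this] C[OF this] order_trans[OF abs_ge_zero B[OF this]] abs_ge_zero]
      show "\<bar>f t * g t\<bar> \<le> B * C" by (simp only: abs_mult)
    qed
  qed
qed

lemma bounded_measurable_on_const: "bounded_measurable_on T (\<lambda>_. c)"
  by (rule bounded_measurable_on_continuous) simp

lemma bounded_measurable_on_diff:
  assumes "bounded_measurable_on T f" "bounded_measurable_on T g"
  shows "bounded_measurable_on T (\<lambda>t. f t - g t)"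
  using bounded_measurable_on_add[OF assms(1) bounded_measurable_on_mult[OF bounded_measurable_on_const assms(2), of "-1"]]
  by simp

lemma bounded_measurable_on_square:
  "bounded_measurable_on T f \<Longrightarrow> bounded_measurable_on T (\<lambda>t. (f t)\<^sup>2)"
  unfolding power2_eq_square by (rule bounded_measurable_on_mult)

section \<open>Algebra of simple processes and their drift\<close>

lemma simple_value_Nil [simp]: "simple_value [] t w = 0"
  by (simp add: simple_value_def)

lemma simple_value_Cons:
  "simple_value ((s, u, \<xi>) # K) t w = \<xi> w * indicator {s<..u} t + simple_value K t w"
  by (simp add: simple_value_def)

lemma bounded_measurable_on_simple_value: "bounded_measurable_on T (\<lambda>t. simple_value K t w)"
proof (induction K)
  case Nil
  then show ?case using bounded_measurable_on_const[of T 0] by simp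
next
  case (Cons e K)
  obtain s u \<xi> where e: "e = (s, u, \<xi>)" by (cases e)
  have "bounded_measurable_on T (\<lambda>t. indicator {s<..u} t :: real)"
  proof -
    have "(indicator {s<..u} :: real \<Rightarrow> real) \<in> borel_measurable lborel" by simp
    then have "(indicator {s<..u} :: real \<Rightarrow> real) \<in> borel_measurable (lebesgue_on {0..T})"
      by (intro measurable_restrict_space1) (rule measurable_completion)
    then show ?thesis by (rule bounded_measurable_onI[where B=1]) (simp add: indicator_def)
  qed
  then show ?case unfolding e simple_value_Cons
    by (intro bounded_measurable_on_add bounded_measurable_on_mult bounded_measurable_on_const Cons.IH)
qed

lemmas bounded_measurable_intros =
  bounded_measurable_on_integrable bounded_measurable_on_add bounded_measurable_on_diff bounded_measurable_on_mult
  bounded_measurable_on_square bounded_measurable_on_const bounded_measurable_on_simple_value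

text \<open>Since lists stand for sums, appending this list subtracts a simple process.\<close>

definition neg_process :: "'a simple_process \<Rightarrow> 'a simple_process" where
  "neg_process K = map (\<lambda>(s, u, \<xi>). (s, u, \<lambda>w. - \<xi> w)) K"

lemma simple_value_diff: "simple_value (K @ neg_process L) t w = simple_value K t w - simple_value L t w"
proof -
  have "simple_value (neg_process L) t w = - simple_value L t w"
    by (induction L) (auto simp: neg_process_def simple_value_def)
  then show ?thesis by (simp add: simple_value_def)
qed

lemma simple_integral_diff: "simple_integral W (K @ neg_process L) w = simple_integral W K w - simple_integral W L w"
proof -
  have "simple_integral W (neg_process L) w = - simple_integral W L w"
    by (induction L) (auto simp: neg_process_def simple_integral_def)
  then show ?thesis by (simp add: simple_integral_def)
qed

lemma simple_integrand_diff:
  assumes "simple_integrand F T K" "simple_integrand F T L"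
  shows "simple_integrand F T (K @ neg_process L)"
  unfolding simple_integrand_def
proof
  fix e assume "e \<in> set (K @ neg_process L)"
  then consider "e \<in> set K" | s u \<xi> where "(s, u, \<xi>) \<in> set L" "e = (s, u, \<lambda>w. - \<xi> w)"
    by (auto simp: neg_process_def)
  then show "case e of (s, u, \<xi>) \<Rightarrow> 0 \<le> s \<and> s \<le> u \<and> u \<le> T \<and>
      \<xi> \<in> borel_measurable (F s) \<and> (\<exists>B. \<forall>w\<in>space (F s). \<bar>\<xi> w\<bar> \<le> B)"
  proof cases
    case 1
    then show ?thesis using assms(1) unfolding simple_integrand_def by blast
  next
    case 2
    then have "0 \<le> s \<and> s \<le> u \<and> u \<le> T \<and> \<xi> \<in> borel_measurable (F s) \<and> (\<exists>B. \<forall>w\<in>space (F s). \<bar>\<xi> w\<bar> \<le> B)"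
      using assms(2) unfolding simple_integrand_def by blast
    then show ?thesis by (auto simp: 2)
  qed
qed

lemma integral_indicator_Ioc:
  assumes g: "continuous_on {0..T} g" and su: "0 \<le> s" "s \<le> u" "u \<le> T"
  shows "integral {0..T} (\<lambda>t. indicator {s<..u} t * g t) = integral {0..u} g - integral {0..s} (g :: real \<Rightarrow> real)"
proof -
  have gi: "g integrable_on {0..u}"
    using su by (intro integrable_continuous_real continuous_on_subset[OF g]) auto
  have "integral {0..T} (\<lambda>t. indicator {s<..u} t * g t) = integral {0..T} (\<lambda>t. if t \<in> {s..u} then g t else 0)"
    by (rule integral_spike[of "{s}"]) (auto simp: indicator_def)
  also have "\<dots> = integral {s..u} g"
  proof -
    have "{s..u} \<inter> {0..T} = {s..u}" using su by auto
    then show ?thesis unfolding Henstock_Kurzweil_Integration.integral_restrict_Int by (simp only:)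
  qed
  also have "\<dots> = integral {0..u} g - integral {0..s} g"
    using Henstock_Kurzweil_Integration.integral_combine[OF su(1,2) gi] by simp
  finally show ?thesis .
qed

text \<open>Changing the integrator by \<open>integral {0..s} g\<close> costs an ordinary integral
  over time. This links \<open>driving_bm\<close> to the scaled coordinate process, which under
  \<open>Q\<close> has the law of \<open>W\<close>.\<close>

lemma simple_integral_drift:
  assumes "\<And>s u \<xi>. (s, u, \<xi>) \<in> set K \<Longrightarrow> 0 \<le> s \<and> s \<le> u \<and> u \<le> T"
    and g: "continuous_on {0..T} g"
    and B: "\<And>s. B s w = \<beta> s w - integral {0..s} g"
  shows "simple_integral B K w = simple_integral \<beta> K w - integral {0..T} (\<lambda>t. simple_value K t w * g t)"
  using assms(1)
proof (induction K)
  case Nil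
  then show ?case by (simp add: simple_integral_def)
next
  case (Cons e K)
  obtain s u \<xi> where e: "e = (s, u, \<xi>)" by (cases e)
  have su: "0 \<le> s" "s \<le> u" "u \<le> T" using Cons.prems[of s u \<xi>] by (auto simp: e)
  have IH: "simple_integral B K w = simple_integral \<beta> K w - integral {0..T} (\<lambda>t. simple_value K t w * g t)"
    using Cons by auto
  have bm: "bounded_measurable_on T (\<lambda>t. indicator {s<..u} t * g t)"
    using bounded_measurable_on_mult[OF bounded_measurable_on_simple_value[of T "[(s, u, \<lambda>_. 1)]" w]
        bounded_measurable_on_continuous[OF g]]
    by (simp add: simple_value_Cons)
  have "integral {0..T} (\<lambda>t. simple_value (e # K) t w * g t)
      = integral {0..T} (\<lambda>t. \<xi> w * (indicator {s<..u} t * g t) + simple_value K t w * g t)"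
    by (simp add: e simple_value_Cons algebra_simps)
  also have "\<dots> = integral {0..T} (\<lambda>t. \<xi> w * (indicator {s<..u} t * g t)) + integral {0..T} (\<lambda>t. simple_value K t w * g t)"
    by (intro Henstock_Kurzweil_Integration.integral_add bounded_measurable_on_integrable
        bounded_measurable_on_mult[OF bounded_measurable_on_const bm]
        bounded_measurable_on_mult[OF bounded_measurable_on_simple_value bounded_measurable_on_continuous[OF g]])
  also have "integral {0..T} (\<lambda>t. \<xi> w * (indicator {s<..u} t * g t)) = \<xi> w * (integral {0..u} g - integral {0..s} g)"
    by (simp add: integral_indicator_Ioc[OF g su])
  finally show ?case
    using IH by (simp add: e simple_integral_def B algebra_simps)
qed

definition dyadic_process :: "real \<Rightarrow> nat \<Rightarrow> (nat \<Rightarrow> 'a \<Rightarrow> real) \<Rightarrow> 'a simple_process" where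
  "dyadic_process T n c = map (\<lambda>k. (grid T n k, grid T n (Suc k), c k)) [0..<2^n]"

lemma simple_integral_dyadic:
  "simple_integral B (dyadic_process T n c) w = (\<Sum>k<2^n. c k w * (B (grid T n (Suc k)) w - B (grid T n k) w))"
  by (simp add: simple_integral_def dyadic_process_def comp_def interv_sum_list_conv_sum_set_nat atLeast0LessThan)

lemma simple_value_dyadic:
  assumes T: "0 < T" and k: "k < 2 ^ n" and t: "grid T n k < t" "t \<le> grid T n (Suc k)"
  shows "simple_value (dyadic_process T n c) t w = c k w"
proof -
  have "indicator {grid T n j<..grid T n (Suc j)} t = (if j = k then 1 else 0 :: real)" for j
  proof (cases j k rule: linorder_cases)
    case less
    then have "grid T n (Suc j) \<le> grid T n k" using T by (intro grid_mono) auto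
    then show ?thesis using t less by (auto simp: indicator_def)
  next
    case greater
    then have "grid T n (Suc k) \<le> grid T n j" using T by (intro grid_mono) auto
    then show ?thesis using t greater by (auto simp: indicator_def)
  qed (use t in \<open>auto simp: indicator_def\<close>)
  then have "(\<Sum>j<2^n. c j w * indicator {grid T n j<..grid T n (Suc j)} t) = (\<Sum>j<2^n. if j = k then c j w else 0)"
    by (intro sum.cong) auto
  also have "\<dots> = c k w" using k by (subst sum.delta) auto
  finally show ?thesis
    by (simp add: simple_value_def dyadic_process_def comp_def interv_sum_list_conv_sum_set_nat atLeast0LessThan)
qed

text \<open>The cells are left-open here, to match the intervals \<open>{s<..u}\<close> of simple
  processes.\<close>

lemma grid_cell_exists:
  assumes T: "0 < T" and t: "0 < t" "t \<le> T"
  shows "\<exists>k<2 ^ n. grid T n k < t \<and> t \<le> grid T n (Suc k)"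
proof -
  define P where "P k \<longleftrightarrow> t \<le> grid T n (Suc k)" for k
  have ex: "P (2 ^ n - 1)" using t by (simp add: P_def)
  have k: "P (Least P)" "Least P \<le> 2 ^ n - 1" using LeastI[of P, OF ex] Least_le[of P, OF ex] by auto
  have "grid T n (Least P) < t"
  proof (cases "Least P")
    case (Suc j)
    then have "\<not> P j" using not_less_Least[of j P] by simp
    then show ?thesis unfolding Suc P_def by simp
  qed (use t in simp)
  moreover have "Least P < 2 ^ n" using order_le_less_trans[OF k(2), of "2 ^ n"] by simp
  ultimately show ?thesis using k(1) unfolding P_def by blast
qed

lemma dyadic_L2_tendsto_0:
  assumes c: "approx_on_cells T (\<lambda>n k. c n k w) g" and g: "continuous_on {0..T} g" and T: "0 < T"
  shows "(\<lambda>n. integral {0..T} (\<lambda>t. (simple_value (dyadic_process T n (c n)) t w - g t)\<^sup>2)) \<longlonglongrightarrow> 0"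
proof (rule LIMSEQ_eventuallyI)
  fix e :: real assume e: "e > 0"
  define d where "d = sqrt (e / (2 * T))"
  have d: "d > 0" "d\<^sup>2 * T < e" using e T by (auto simp: d_def)
  show "\<forall>\<^sub>F n in sequentially. norm (integral {0..T} (\<lambda>t. (simple_value (dyadic_process T n (c n)) t w - g t)\<^sup>2) - 0) < e"
    using approx_on_cellsD[OF c d(1)]
  proof eventually_elim
    case (elim n)
    let ?f = "\<lambda>t. (simple_value (dyadic_process T n (c n)) t w - g t)\<^sup>2"
    have int: "?f integrable_on {0..T}"
      by (intro bounded_measurable_intros bounded_measurable_on_continuous g)
    \<comment> \<open>Time 0 lies in no left-open cell, so the simple process vanishes there
      whatever \<open>g 0\<close> is; the point is removed as a null set.\<close>
    have "?f t \<le> d\<^sup>2" if "t \<in> {0..T} - {0}" for t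
    proof -
      have "0 < t" "t \<le> T" using that by auto
      from grid_cell_exists[OF T this]
      obtain k where k: "k < 2 ^ n" "grid T n k < t" "t \<le> grid T n (Suc k)" by blast
      then have "\<bar>simple_value (dyadic_process T n (c n)) t w - g t\<bar> < d"
        using elim by (simp add: simple_value_dyadic[OF T k])
      then show ?thesis by (metis abs_ge_zero less_imp_le power2_abs power_mono)
    qed
    moreover have "(\<lambda>t. if t = 0 then 0 else ?f t) integrable_on {0..T}"
      by (rule integrable_spike[OF int, of "{0}"]) auto
    ultimately have "integral {0..T} (\<lambda>t. if t = 0 then 0 else ?f t) \<le> integral {0..T} (\<lambda>_. d\<^sup>2)"
      by (intro integral_le integrable_const_ivl) auto
    moreover have "integral {0..T} (\<lambda>t. if t = 0 then 0 else ?f t) = integral {0..T} ?f"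
      by (rule integral_spike[of "{0}"]) auto
    moreover have "0 \<le> integral {0..T} ?f" using int by (intro Henstock_Kurzweil_Integration.integral_nonneg) auto
    ultimately show ?case using d T by (simp add: mult.commute)
  qed
qed

text \<open>Rewrites the squared distance by integrals of continuous functions started at 0, to
  which \<open>measurable_pathwise_integral\<close> applies.\<close>

lemma integral_square_dyadic:
  assumes g: "continuous_on {0..T} g" and T: "0 < T"
  shows "integral {0..T} (\<lambda>t. (simple_value (dyadic_process T n c) t w - g t)\<^sup>2)
    = (\<Sum>k<2^n. integral {0..grid T n (Suc k)} (\<lambda>t. (c k w - g t)\<^sup>2) - integral {0..grid T n k} (\<lambda>t. (c k w - g t)\<^sup>2))"
proof -
  let ?f = "\<lambda>t. (simple_value (dyadic_process T n c) t w - g t)\<^sup>2"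
  have "?f integrable_on {0..T}"
    by (intro bounded_measurable_intros bounded_measurable_on_continuous g)
  from sum_integral_cells[OF this, of "2^n" n] T
  have "integral {0..T} ?f = (\<Sum>k<2^n. integral {grid T n k..grid T n (Suc k)} ?f)" by simp
  also have "\<dots> = (\<Sum>k<2^n. integral {0..grid T n (Suc k)} (\<lambda>t. (c k w - g t)\<^sup>2) - integral {0..grid T n k} (\<lambda>t. (c k w - g t)\<^sup>2))"
  proof (rule sum.cong)
    fix k :: nat assume "k \<in> {..<2 ^ n}"
    then have k: "k < 2 ^ n" "Suc k \<le> 2 ^ n" by auto
    let ?g = "\<lambda>t. (c k w - g t)\<^sup>2"
    have "integral {grid T n k..grid T n (Suc k)} ?f = integral {grid T n k..grid T n (Suc k)} ?g"
      by (rule integral_spike[of "{grid T n k}"]) (auto simp: simple_value_dyadic[OF T k(1)])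
    moreover have "?g integrable_on {0..grid T n (Suc k)}"
      using T grid_le[OF _ k(2), of T]
      by (intro integrable_continuous_real continuous_intros continuous_on_subset[OF g]) auto
    then have "integral {0..grid T n k} ?g + integral {grid T n k..grid T n (Suc k)} ?g = integral {0..grid T n (Suc k)} ?g"
      using T by (intro Henstock_Kurzweil_Integration.integral_combine grid_mono) auto
    ultimately show "integral {grid T n k..grid T n (Suc k)} ?f
      = integral {0..grid T n (Suc k)} ?g - integral {0..grid T n k} ?g" by simp
  qed simp
  finally show ?thesis .
qed

text \<open>Young's inequality with a parameter \<open>r\<close>: \<open>\<bar>f * g\<bar>\<close>
  is at most \<open>f\<^sup>2 / (2 * r) + r * g\<^sup>2 / 2\<close>.\<close>

lemma integral_mult_tendsto_0:
  assumes f: "\<And>n. bounded_measurable_on T (f n)" and g: "bounded_measurable_on T g"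
    and lim: "(\<lambda>n. integral {0..T} (\<lambda>t. (f n t)\<^sup>2)) \<longlonglongrightarrow> 0"
  shows "(\<lambda>n. integral {0..T} (\<lambda>t. f n t * g t)) \<longlonglongrightarrow> 0"
proof (rule LIMSEQ_eventuallyI)
  fix e :: real assume e: "e > 0"
  define G where "G = integral {0..T} (\<lambda>t. (g t)\<^sup>2)"
  have G: "0 \<le> G"
    unfolding G_def by (intro Henstock_Kurzweil_Integration.integral_nonneg bounded_measurable_intros g) auto
  \<comment> \<open>This makes the second term less than \<open>e / 2\<close>, also when
    \<open>G\<close> is 0; requiring the integral of \<open>(f n t)\<^sup>2\<close> to be below
    \<open>e * r\<close> does the same for the first.\<close>
  define r where "r = e / (G + 1)"
  have r: "r > 0" "r * G < e" using e G by (auto simp: r_def field_simps)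
  have "\<forall>\<^sub>F n in sequentially. integral {0..T} (\<lambda>t. (f n t)\<^sup>2) < e * r"
    using lim e r(1) by (intro order_tendstoD(2)) auto
  then show "\<forall>\<^sub>F n in sequentially. norm (integral {0..T} (\<lambda>t. f n t * g t) - 0) < e"
  proof eventually_elim
    case (elim n)
    have "norm (integral {0..T} (\<lambda>t. f n t * g t)) \<le> integral {0..T} (\<lambda>t. (1 / (2 * r)) * (f n t)\<^sup>2 + (r / 2) * (g t)\<^sup>2)"
    proof (rule integral_norm_bound_integral)
      fix t
      have "0 \<le> (\<bar>f n t\<bar> - r * \<bar>g t\<bar>)\<^sup>2" by simp
      then have "2 * r * \<bar>f n t * g t\<bar> \<le> (f n t)\<^sup>2 + r\<^sup>2 * (g t)\<^sup>2"
        by (simp add: power2_diff abs_mult power_mult_distrib algebra_simps)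
      then show "norm (f n t * g t) \<le> (1 / (2 * r)) * (f n t)\<^sup>2 + (r / 2) * (g t)\<^sup>2"
        using r(1) by (simp add: field_simps power2_eq_square)
    qed (intro bounded_measurable_intros f g)+
    also have "\<dots> = integral {0..T} (\<lambda>t. (1 / (2 * r)) * (f n t)\<^sup>2) + integral {0..T} (\<lambda>t. (r / 2) * (g t)\<^sup>2)"
      by (intro Henstock_Kurzweil_Integration.integral_add bounded_measurable_intros f g)
    also have "\<dots> = (1 / (2 * r)) * integral {0..T} (\<lambda>t. (f n t)\<^sup>2) + (r / 2) * G"
      unfolding G_def by (simp only: Henstock_Kurzweil_Integration.integral_mult_right)
    also have "\<dots> < (1 / (2 * r)) * (e * r) + e / 2"
      using elim r by (intro add_strict_mono mult_strict_left_mono) auto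
    also have "\<dots> = e" using r(1) by simp
    finally show ?case by simp
  qed
qed

section \<open>Identification of the Ito integral\<close>

context drifted_brownian_motion
begin

definition "H t w = lam (w t) / \<sigma>"
definition "B = driving_bm \<sigma> lam x"
definition "F = natural_filtration P (\<lambda>t w. w t)"
definition "J w = ln (\<Phi> w) - 1 / 2 * integral {0..T} (\<lambda>r. (H r w)\<^sup>2)"

section \<open>Equivalence of the two laws and measurability of the integrand\<close>

lemma space_F: "space (F t) = space (path_space T)"
  by (simp add: F_def)

lemma measurable_P: "borel_measurable P = borel_measurable (path_space T)"
  and measurable_Q: "borel_measurable Q = borel_measurable (path_space T)"
  by (rule measurable_cong_sets[OF sets_P refl], rule measurable_cong_sets[OF sets_Q refl])

text \<open>Positivity of the density makes the null sets of the two laws coincide.\<close>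

lemma AE_P_iff_Q: "(AE w in P. R w) \<longleftrightarrow> (AE w in Q. R w)"
proof -
  have "\<Phi> \<in> borel_measurable Q" using \<Phi>_measurable by (simp add: measurable_Q)
  then have "(AE w in density Q (\<lambda>w. ennreal (\<Phi> w)). R w) \<longleftrightarrow> (AE w in Q. 0 < ennreal (\<Phi> w) \<longrightarrow> R w)"
    by (intro AE_density) simp
  then show ?thesis unfolding P_eq_density[symmetric] by (simp add: \<Phi>_pos)
qed

lemma F_component: "0 \<le> s \<Longrightarrow> s \<le> t \<Longrightarrow> (\<lambda>w. w s) \<in> borel_measurable (F t)"
  unfolding F_def by (rule measurable_natural_filtration_component)

lemma F_measurable:
  assumes "f \<in> borel_measurable (F t)" "t \<le> T"
  shows "f \<in> borel_measurable (path_space T)"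
  unfolding measurable_P[symmetric]
proof (rule measurable_from_natural_filtration)
  show "f \<in> borel_measurable (natural_filtration P (\<lambda>t w. w t) t)" using assms(1) by (simp only: F_def)
  fix r assume "0 \<le> r" "r \<le> t"
  then show "(\<lambda>w. w r) \<in> borel_measurable P"
    unfolding measurable_P using assms(2) by (intro measurable_path_coordinate) simp
qed

lemma H_adapted: "0 \<le> t \<Longrightarrow> (\<lambda>w. H t w) \<in> borel_measurable (F t)"
  unfolding H_def by (intro real_measurable_intros measurable_compose[OF F_component measurable_lam]) auto

lemma H_measurable: "0 \<le> t \<Longrightarrow> t \<le> T \<Longrightarrow> (\<lambda>w. H t w) \<in> borel_measurable (path_space T)"
  by (rule F_measurable[OF H_adapted])

lemma H_continuous: "w \<in> space (path_space T) \<Longrightarrow> continuous_on {0..T} (\<lambda>t. H t w)"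
  unfolding H_def using sigma_pos
  by (intro continuous_intros continuous_on_compose2[OF continuous_lam]) (auto simp: space_path_space)

lemma integral_H_measurable:
  assumes "0 \<le> t" "t \<le> T"
  shows "(\<lambda>w. integral {0..t} (\<lambda>s. H s w)) \<in> borel_measurable (path_space T)"
proof (rule measurable_pathwise_integral[OF assms(1)])
  show "continuous_on {0..t} (\<lambda>s. H s w)" if "w \<in> space (path_space T)" for w
    using assms by (intro continuous_on_subset[OF H_continuous[OF that]]) auto
qed (use assms in \<open>auto intro: H_measurable\<close>)

lemma integral_H_square_measurable:
  "(\<lambda>w. integral {0..T} (\<lambda>s. (H s w)\<^sup>2)) \<in> borel_measurable (path_space T)"
proof (rule measurable_pathwise_integral)
  show "continuous_on {0..T} (\<lambda>s. (H s w)\<^sup>2)" if "w \<in> space (path_space T)" for w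
    by (intro continuous_intros H_continuous[OF that])
qed (use T_pos in \<open>auto intro: borel_measurable_power H_measurable\<close>)

lemma J_measurable: "J \<in> borel_measurable (path_space T)"
  unfolding J_def
  by (intro real_measurable_intros integral_H_square_measurable
      borel_measurable_ln \<Phi>_measurable)

lemma B_eq: "B s w = (w s - x) / \<sigma> - integral {0..s} (\<lambda>r. H r w)"
  by (simp add: B_def driving_bm_def H_def diff_divide_distrib)

lemma B_measurable: "0 \<le> s \<Longrightarrow> s \<le> T \<Longrightarrow> B s \<in> borel_measurable (path_space T)"
  unfolding B_eq[abs_def]
  by (intro real_measurable_intros measurable_path_coordinate
      integral_H_measurable) auto

lemma AE_Q_girsanov_exponent:
  "AE w in Q. (\<lambda>n. exp (log_density n (\<lambda>k. w (grid T n k)))) \<longlonglongrightarrow> \<Phi> w"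
proof -
  \<comment> \<open>Cutting at \<open>2 ^ n\<close> makes the grid values of the restricted path and
    of \<open>U\<close> equal as sequences; beyond \<open>T\<close> the restricted path is
    \<open>undefined\<close>.\<close>
  let ?E = "\<lambda>n w. exp (log_density n (stopped_sequence (2 ^ n) (\<lambda>k. w (grid T n k))))"
  have meas: "?E n \<in> borel_measurable (path_space T)" for n
    unfolding girsanov_exponent_stopped using T_pos
    by (intro measurable_compose[OF _ borel_measurable_exp]
        measurable_girsanov_exponent[where f="\<lambda>w k. w (grid T n k)", OF _ measurable_lam] measurable_path_coordinate)
      (auto intro: grid_le)
  have set: "{w \<in> space (path_space T). (\<lambda>n. ?E n w) \<longlonglongrightarrow> \<Phi> w} \<in> sets (path_space T)"
    using measurable_limit2[OF meas \<Phi>_measurable] by (simp add: pred_def)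
  have "AE \<omega> in M. (\<lambda>n. ?E n (U_path \<omega>)) \<longlonglongrightarrow> \<Phi> (U_path \<omega>)"
    using AE_quadratic_variation AE_W0 AE_space
  proof eventually_elim
    case (elim \<omega>)
    have "stopped_sequence (2 ^ n) (\<lambda>k. (U_path \<omega>) (grid T n k))
        = stopped_sequence (2 ^ n) (\<lambda>k. U (grid T n k) \<omega>)" for n
      using T_pos grid_le[of T _ n] by (auto simp: stopped_sequence_def fun_eq_iff)
    moreover have "\<Phi> (U_path \<omega>) = \<Phi> (\<lambda>t. U t \<omega>)"
      unfolding \<Phi>_def using T_pos by (intro girsanov_density_cong) auto
    ultimately show ?case
      using girsanov_exponent_U_tendsto[OF elim(3,2,1)] by (simp add: girsanov_exponent_stopped)
  qed
  then show ?thesis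
    unfolding Q_def' AE_distr_iff[OF path_U set, symmetric] by (simp only: girsanov_exponent_stopped)
qed

text \<open>Simple integrands need bounded coefficients, while \<open>H\<close> may be unbounded
  over path space. The level grows with \<open>n\<close>, so on each path clamping eventually has no
  effect.\<close>

definition clamp :: "nat \<Rightarrow> real \<Rightarrow> real" where
  "clamp n y = max (- real n) (min (real n) y)"

definition "K n = dyadic_process T n (\<lambda>k w. clamp n (H (grid T n k) w))"

lemma clamp_bound: "\<bar>clamp n y\<bar> \<le> real n"
  by (auto simp: clamp_def)

lemma clamp_eq: "\<bar>y\<bar> \<le> real n \<Longrightarrow> clamp n y = y"
  by (auto simp: clamp_def)

lemma eventually_unclamped:
  assumes w: "w \<in> space (path_space T)"
  shows "\<forall>\<^sub>F n in sequentially. \<forall>k\<le>2^n. clamp n (H (grid T n k) w) = H (grid T n k) w"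
proof -
  obtain R where R: "\<And>r. r \<in> {0..T} \<Longrightarrow> \<bar>H r w\<bar> \<le> R" using continuous_on_Icc_bounded[OF H_continuous[OF w]] by blast
  have "\<forall>\<^sub>F n in sequentially. R \<le> real n"
    using filterlim_real_sequentially by (simp add: filterlim_at_top)
  then show ?thesis
  proof eventually_elim
    case (elim n)
    show ?case
    proof (intro allI impI clamp_eq)
      fix k :: nat assume "k \<le> 2 ^ n"
      then have "grid T n k \<in> {0..T}" using T_pos by (simp add: grid_le)
      from R[OF this] elim show "\<bar>H (grid T n k) w\<bar> \<le> real n" by linarith
    qed
  qed
qed

lemma clamp_approx:
  assumes w: "w \<in> space (path_space T)"
  shows "approx_on_cells T (\<lambda>n k. clamp n (H (grid T n k) w)) (\<lambda>t. H t w)"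
proof (rule approx_on_cellsI(1)[OF H_continuous[OF w] T_pos])
  fix e :: real assume e: "e > 0"
  from eventually_unclamped[OF w]
  show "\<forall>\<^sub>F n in sequentially. \<forall>k\<le>2 ^ n. \<bar>clamp n (H (grid T n k) w) - H (grid T n k) w\<bar> < e"
    by eventually_elim (simp add: e)
qed

lemma clamp_measurable: "clamp n \<in> borel_measurable borel"
  unfolding clamp_def[abs_def] by measurable

lemma simple_integrand_K: "simple_integrand F T (K n)"
  unfolding simple_integrand_def K_def dyadic_process_def
proof
  fix e assume "e \<in> set (map (\<lambda>k. (grid T n k, grid T n (Suc k), \<lambda>w. clamp n (H (grid T n k) w))) [0..<2 ^ n])"
  then obtain k where k: "k < 2 ^ n" "e = (grid T n k, grid T n (Suc k), \<lambda>w. clamp n (H (grid T n k) w))" by auto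
  have "0 \<le> grid T n k" "grid T n k \<le> grid T n (Suc k)" "grid T n (Suc k) \<le> T"
    using T_pos k(1) by (auto intro: grid_mono grid_le)
  moreover have "(\<lambda>w. clamp n (H (grid T n k) w)) \<in> borel_measurable (F (grid T n k))"
    using T_pos by (intro measurable_compose[OF H_adapted clamp_measurable]) auto
  moreover have "\<forall>w. \<bar>clamp n (H (grid T n k) w)\<bar> \<le> real n" by (simp add: clamp_bound)
  ultimately show "case e of (s, u, \<xi>) \<Rightarrow> 0 \<le> s \<and> s \<le> u \<and> u \<le> T \<and>
      \<xi> \<in> borel_measurable (F s) \<and> (\<exists>B. \<forall>\<omega>\<in>space (F s). \<bar>\<xi> \<omega>\<bar> \<le> B)"
    unfolding k(2) by auto
qed

lemma simple_integrandD:
  assumes "simple_integrand F T L" "(s, u, \<xi>) \<in> set L"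
  shows "0 \<le> s" "s \<le> u" "u \<le> T" "\<xi> \<in> borel_measurable (F s)" "\<exists>b. \<forall>\<omega>\<in>space (path_space T). \<bar>\<xi> \<omega>\<bar> \<le> b"
  using assms unfolding simple_integrand_def space_F by auto

lemma K_L2_tendsto_0:
  assumes w: "w \<in> space (path_space T)"
  shows "(\<lambda>n. integral {0..T} (\<lambda>t. (simple_value (K n) t w - H t w)\<^sup>2)) \<longlonglongrightarrow> 0"
  unfolding K_def
  by (rule dyadic_L2_tendsto_0[where c="\<lambda>n k w. clamp n (H (grid T n k) w)",
        OF clamp_approx[OF w] H_continuous[OF w] T_pos])

lemma K_L2_measurable:
  "(\<lambda>w. integral {0..T} (\<lambda>t. (simple_value (K n) t w - H t w)\<^sup>2)) \<in> borel_measurable (path_space T)"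
proof -
  have i: "(\<lambda>w. integral {0..t} (\<lambda>s. (clamp n (H r w) - H s w)\<^sup>2)) \<in> borel_measurable (path_space T)"
    if rt: "0 \<le> r" "r \<le> T" "0 \<le> t" "t \<le> T" for r t
  proof (rule measurable_pathwise_integral[OF rt(3)])
    fix s assume s: "0 \<le> s" "s \<le> t"
    show "(\<lambda>w. (clamp n (H r w) - H s w)\<^sup>2) \<in> borel_measurable (path_space T)"
      using rt s by (intro real_measurable_intros measurable_compose[OF H_measurable clamp_measurable] H_measurable) auto
  next
    fix w assume w: "w \<in> space (path_space T)"
    show "continuous_on {0..t} (\<lambda>s. (clamp n (H r w) - H s w)\<^sup>2)"
      using rt by (intro continuous_intros continuous_on_subset[OF H_continuous[OF w]]) auto
  qed
  have "(\<lambda>w. \<Sum>k<2^n. integral {0..grid T n (Suc k)} (\<lambda>t. (clamp n (H (grid T n k) w) - H t w)\<^sup>2)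
      - integral {0..grid T n k} (\<lambda>t. (clamp n (H (grid T n k) w) - H t w)\<^sup>2)) \<in> borel_measurable (path_space T)"
    using T_pos by (intro borel_measurable_sum borel_measurable_diff i grid_le) auto
  then show ?thesis
    unfolding K_def
    by (rule measurable_cong[THEN iffD1, rotated]) (simp add: integral_square_dyadic[OF H_continuous T_pos])
qed

lemma simple_integral_B_measurable:
  assumes "simple_integrand F T L"
  shows "simple_integral B L \<in> borel_measurable (path_space T)"
proof -
  have "(\<lambda>w. \<Sum>e\<leftarrow>L. (case e of (s, u, \<xi>) \<Rightarrow> \<xi> w * (B u w - B s w))) \<in> borel_measurable (path_space T)"
  proof (rule borel_measurable_sum_list)
    fix e assume e: "e \<in> set L"
    obtain s u \<xi> where eq: "e = (s, u, \<xi>)" by (cases e)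
    note f = simple_integrandD[OF assms e[unfolded eq]]
    have "\<xi> \<in> borel_measurable (path_space T)" using f by (intro F_measurable[OF f(4)]) auto
    then show "(\<lambda>w. case e of (s, u, \<xi>) \<Rightarrow> \<xi> w * (B u w - B s w)) \<in> borel_measurable (path_space T)"
      using f by (simp add: eq real_measurable_intros B_measurable)
  qed
  then show ?thesis by (simp add: simple_integral_def[abs_def])
qed

text \<open>Once clamping is inactive, the simple integral is the log density, plus half the Riemann
  sum of \<open>H\<^sup>2\<close>, minus the drift sum. The last two tend to \<open>1/2\<close> and
  \<open>1\<close> times the integral of \<open>H\<^sup>2\<close>, which leaves
  \<open>J\<close>.\<close>

lemma AE_Q_simple_integral_K: "AE w in Q. (\<lambda>n. simple_integral B (K n) w) \<longlonglongrightarrow> J w"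
  using AE_Q_girsanov_exponent AE_space
proof eventually_elim
  case (elim w)
  have w: "w \<in> space (path_space T)" using elim(2) by simp
  let ?g = "\<lambda>n. log_density n (\<lambda>k. w (grid T n k))"
  let ?H = "\<lambda>t. H t w"
  note Hc = H_continuous[OF w]
  have H2c: "continuous_on {0..T} (\<lambda>t. (?H t)\<^sup>2)" by (intro continuous_intros Hc)
  have "(\<lambda>n. ln (exp (?g n))) \<longlonglongrightarrow> ln (\<Phi> w)"
    using elim(1) \<Phi>_pos[of w] by (intro tendsto_ln) (auto simp: girsanov_exponent_stopped)
  then have g: "?g \<longlonglongrightarrow> ln (\<Phi> w)" by simp
  have R: "(\<lambda>n. \<Sum>k<2^n. (?H (grid T n k))\<^sup>2 * (T / 2 ^ n)) \<longlonglongrightarrow> integral {0..T} (\<lambda>t. (?H t)\<^sup>2)"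
    by (rule riemann_sum_tendsto[OF approx_on_cells_grid[OF H2c T_pos] H2c T_pos])
  have S: "(\<lambda>n. \<Sum>k<2^n. clamp n (?H (grid T n k)) * integral {grid T n k..grid T n (Suc k)} ?H)
      \<longlonglongrightarrow> integral {0..T} (\<lambda>t. ?H t * ?H t)"
    by (rule weighted_integral_sum_tendsto[OF clamp_approx[OF w] Hc Hc T_pos])
  have "(\<lambda>n. ?g n + 1 / 2 * (\<Sum>k<2^n. (?H (grid T n k))\<^sup>2 * (T / 2 ^ n))
        - (\<Sum>k<2^n. clamp n (?H (grid T n k)) * integral {grid T n k..grid T n (Suc k)} ?H))
      \<longlonglongrightarrow> ln (\<Phi> w) + 1 / 2 * integral {0..T} (\<lambda>t. (?H t)\<^sup>2) - integral {0..T} (\<lambda>t. ?H t * ?H t)"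
    by (intro tendsto_intros g R S)
  also have "ln (\<Phi> w) + 1 / 2 * integral {0..T} (\<lambda>t. (?H t)\<^sup>2) - integral {0..T} (\<lambda>t. ?H t * ?H t) = J w"
    by (simp add: J_def power2_eq_square)
  finally have lim: "(\<lambda>n. ?g n + 1 / 2 * (\<Sum>k<2^n. (?H (grid T n k))\<^sup>2 * (T / 2 ^ n))
        - (\<Sum>k<2^n. clamp n (?H (grid T n k)) * integral {grid T n k..grid T n (Suc k)} ?H)) \<longlonglongrightarrow> J w" .
  have "\<forall>\<^sub>F n in sequentially. ?g n + 1 / 2 * (\<Sum>k<2^n. (?H (grid T n k))\<^sup>2 * (T / 2 ^ n))
        - (\<Sum>k<2^n. clamp n (?H (grid T n k)) * integral {grid T n k..grid T n (Suc k)} ?H) = simple_integral B (K n) w"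
    using eventually_unclamped[OF w]
  proof eventually_elim
    case (elim n)
    have B_inc: "B (grid T n (Suc k)) w - B (grid T n k) w
        = (w (grid T n (Suc k)) - w (grid T n k)) / \<sigma> - integral {grid T n k..grid T n (Suc k)} ?H" if k: "k < 2 ^ n" for k
    proof -
      have "?H integrable_on {0..grid T n (Suc k)}"
        using k T_pos grid_le[of T "Suc k" n] by (intro integrable_continuous_real continuous_on_subset[OF Hc]) auto
      then have "integral {0..grid T n k} ?H + integral {grid T n k..grid T n (Suc k)} ?H = integral {0..grid T n (Suc k)} ?H"
        using T_pos by (intro Henstock_Kurzweil_Integration.integral_combine grid_mono) auto
      then show ?thesis by (simp add: B_eq diff_divide_distrib)
    qed
    have gn: "?g n + 1 / 2 * (\<Sum>k<2^n. (?H (grid T n k))\<^sup>2 * (T / 2 ^ n))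
        = (\<Sum>k<2^n. ?H (grid T n k) * ((w (grid T n (Suc k)) - w (grid T n k)) / \<sigma>))"
      unfolding girsanov_exponent_def sum_distrib_left sum.distrib[symmetric] H_def
      using sigma_pos by (intro sum.cong) (auto simp: power2_eq_square field_simps)
    have "simple_integral B (K n) w
        = (\<Sum>k<2^n. clamp n (?H (grid T n k)) * (B (grid T n (Suc k)) w - B (grid T n k) w))"
      by (simp add: K_def simple_integral_dyadic)
    also have "\<dots> = (\<Sum>k<2^n. ?H (grid T n k) * ((w (grid T n (Suc k)) - w (grid T n k)) / \<sigma>)
        - clamp n (?H (grid T n k)) * integral {grid T n k..grid T n (Suc k)} ?H)"
    proof (rule sum.cong)
      fix k :: nat assume "k \<in> {..<2 ^ n}"
      then have k: "k < 2 ^ n" by simp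
      have "clamp n (?H (grid T n k)) = ?H (grid T n k)" using elim k by simp
      then show "clamp n (?H (grid T n k)) * (B (grid T n (Suc k)) w - B (grid T n k) w)
          = ?H (grid T n k) * ((w (grid T n (Suc k)) - w (grid T n k)) / \<sigma>)
            - clamp n (?H (grid T n k)) * integral {grid T n k..grid T n (Suc k)} ?H"
        unfolding B_inc[OF k] by (simp only: right_diff_distrib)
    qed simp
    finally show ?case unfolding gn sum_subtractf by simp
  qed
  from Lim_transform_eventually[OF lim this] show ?case .
qed

text \<open>Provides a version, so that the choice made in \<open>ito_integral\<close> has its
  defining property. Almost sure convergence under \<open>Q\<close> passes to \<open>P\<close> and
  there implies convergence in probability.\<close>

theorem is_ito_integral_J: "is_ito_integral P F B T H J"
  unfolding is_ito_integral_def
proof (intro conjI exI[of _ K])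
  show "\<forall>t\<in>{0..T}. H t \<in> borel_measurable (F t)" using H_adapted by auto
  show "\<forall>w\<in>space P. continuous_on {0..T} (\<lambda>t. H t w)" using H_continuous by simp
  show "\<forall>n. simple_integrand F T (K n)" by (simp add: simple_integrand_K)
  show "conv_in_prob P (\<lambda>n w. integral {0..T} (\<lambda>t. (simple_value (K n) t w - H t w)\<^sup>2)) (\<lambda>_. 0)"
  proof (rule AE_tendsto_imp_conv_in_prob[OF P.prob_space_axioms])
    show "AE w in P. (\<lambda>n. integral {0..T} (\<lambda>t. (simple_value (K n) t w - H t w)\<^sup>2)) \<longlonglongrightarrow> 0"
      using AE_space
    proof eventually_elim
      case (elim w)
      then have w: "w \<in> space (path_space T)" by simp
      show ?case by (rule K_L2_tendsto_0[OF w])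
    qed
  qed (simp_all add: measurable_P K_L2_measurable)
  show "conv_in_prob P (\<lambda>n. simple_integral B (K n)) J"
    using AE_Q_simple_integral_K
    by (intro AE_tendsto_imp_conv_in_prob[OF P.prob_space_axioms])
      (simp_all add: measurable_P AE_P_iff_Q simple_integral_B_measurable simple_integrand_K J_measurable)
qed

text \<open>Moves a simple process from path space back to \<open>M\<close>, where its integral
  against \<open>W\<close> has an exponential martingale.\<close>

definition "pullback L = map (\<lambda>(s, u, \<xi>). (s, u, \<lambda>\<omega>. \<xi> (U_path \<omega>))) L"

lemma simple_value_pullback: "simple_value (pullback L) t \<omega> = simple_value L t (U_path \<omega>)"
  by (simp add: simple_value_def pullback_def comp_def case_prod_beta')

lemma simple_integral_pullback:
  assumes "simple_integrand F T L"
  shows "simple_integral W (pullback L) \<omega> = simple_integral (\<lambda>s w. (w s - x) / \<sigma>) L (U_path \<omega>)"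
  unfolding simple_integral_def pullback_def map_map comp_def
proof (intro arg_cong[where f=sum_list] map_cong refl)
  fix e assume e: "e \<in> set L"
  obtain s u \<xi> where eq: "e = (s, u, \<xi>)" by (cases e)
  note f = simple_integrandD[OF assms e[unfolded eq]]
  have "s \<in> {0..T}" "u \<in> {0..T}" using f by auto
  then show "(case case e of (s, u, \<xi>) \<Rightarrow> (s, u, \<lambda>\<omega>. \<xi> (U_path \<omega>)) of (s, u, \<xi>) \<Rightarrow> \<xi> \<omega> * (W u \<omega> - W s \<omega>))
      = (case e of (s, u, \<xi>) \<Rightarrow> \<xi> (U_path \<omega>) *
        (((U_path \<omega>) u - x) / \<sigma> - ((U_path \<omega>) s - x) / \<sigma>))"
    using sigma_pos by (simp add: eq U_def)
qed

lemma simple_integrand_pullback: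
  assumes "simple_integrand F T L"
  shows "simple_integrand (natural_filtration M W) T (pullback L)"
  unfolding simple_integrand_def
proof
  fix e assume "e \<in> set (pullback L)"
  then obtain s u \<xi> where e: "(s, u, \<xi>) \<in> set L" "e = (s, u, \<lambda>\<omega>. \<xi> (U_path \<omega>))"
    by (auto simp: pullback_def)
  note f = simple_integrandD[OF assms e(1)]
  have into: "(U_path \<omega>) \<in> space (path_space T)" if "\<omega> \<in> space M" for \<omega>
    using measurable_space[OF path_U that] .
  have "(\<lambda>\<omega>. U_path \<omega>) \<in> measurable (natural_filtration M W s) (F s)"
    unfolding F_def
  proof (rule measurable_natural_filtrationI)
    show "(\<lambda>\<omega>. U_path \<omega>) \<in> space (natural_filtration M W s) \<rightarrow> space P" using into by simp
    fix r assume r: "0 \<le> r" "r \<le> s"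
    then have "(\<lambda>\<omega>. (U_path \<omega>) r) = (\<lambda>\<omega>. x + \<sigma> * W r \<omega>)" using f by (auto simp: U_def)
    then show "(\<lambda>\<omega>. (U_path \<omega>) r) \<in> borel_measurable (natural_filtration M W s)"
      using measurable_natural_filtration_component[OF r, of W M] by simp
  qed
  from measurable_compose[OF this f(4)]
  have "(\<lambda>\<omega>. \<xi> (U_path \<omega>)) \<in> borel_measurable (natural_filtration M W s)" .
  moreover obtain b where "\<forall>\<omega>\<in>space (path_space T). \<bar>\<xi> \<omega>\<bar> \<le> b" using f(5) by blast
  then have "\<forall>\<omega>\<in>space M. \<bar>\<xi> (U_path \<omega>)\<bar> \<le> b" using into by blast
  ultimately show "case e of (s, u, \<xi>) \<Rightarrow> 0 \<le> s \<and> s \<le> u \<and> u \<le> T \<and>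
      \<xi> \<in> borel_measurable (natural_filtration M W s)
      \<and> (\<exists>B. \<forall>\<omega>\<in>space (natural_filtration M W s). \<bar>\<xi> \<omega>\<bar> \<le> B)"
    using f(1-3) unfolding e(2) by auto
qed

text \<open>Two simple approximations of the same integrand differ by \<open>L n\<close> with vanishing quadratic
  variation, so \<open>exp (c * \<integral> L n dW - c\<^sup>2 / 2 * \<integral> (L n)\<^sup>2 dt)\<close> tends to \<open>exp (c * (I - J))\<close>; Fatou's lemma bounds
  the exponential moments of the difference of the limits.\<close>

theorem ito_integral_unique:
  assumes I: "is_ito_integral P F B T H I"
  shows "AE w in Q. I w = J w"
proof -
  obtain K' where K': "\<And>n. simple_integrand F T (K' n)"
    and c1: "conv_in_prob P (\<lambda>n w. integral {0..T} (\<lambda>t. (simple_value (K' n) t w - H t w)\<^sup>2)) (\<lambda>_. 0)"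
    and c2: "conv_in_prob P (\<lambda>n. simple_integral B (K' n)) I"
    using I unfolding is_ito_integral_def by blast
  have I_meas: "I \<in> borel_measurable (path_space T)"
    using c2 by (simp add: conv_in_prob_def measurable_P)
  obtain r1 where r1: "strict_mono r1"
    "AE w in P. (\<lambda>n. integral {0..T} (\<lambda>t. (simple_value (K' (r1 n)) t w - H t w)\<^sup>2)) \<longlonglongrightarrow> 0"
    using conv_in_prob_AE_subseq[OF P.prob_space_axioms c1] by blast
  obtain r2 where r2: "strict_mono r2" "AE w in P. (\<lambda>n. simple_integral B (K' (r1 (r2 n))) w) \<longlonglongrightarrow> I w"
    using conv_in_prob_AE_subseq[OF P.prob_space_axioms conv_in_prob_subseq[OF c2 r1(1)]] by blast
  \<comment> \<open>Two successive subsequences make the given approximation converge almost surely,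
    first in mean square over time and then as an integral. The sequence \<open>K n\<close>
    converges without thinning, so the two can be paired index by index.\<close>
  define L where "L n = K' (r1 (r2 n)) @ neg_process (K n)" for n
  have L: "simple_integrand F T (L n)" for n
    unfolding L_def by (intro simple_integrand_diff K' simple_integrand_K)
  define A where "A n w = integral {0..T} (\<lambda>t. (simple_value (L n) t w)\<^sup>2)" for n w
  define N where "N n w = simple_integral (\<lambda>s w. (w s - x) / \<sigma>) (L n) w" for n w
  have conv: "AE w in Q. (\<lambda>n. A n w) \<longlonglongrightarrow> 0 \<and> (\<lambda>n. N n w) \<longlonglongrightarrow> I w - J w"
    using r1(2)[unfolded AE_P_iff_Q] r2(2)[unfolded AE_P_iff_Q] AE_Q_simple_integral_K AE_space
  proof eventually_elim
    case (elim w)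
    have w: "w \<in> space (path_space T)" using elim(4) by simp
    let ?v' = "\<lambda>n t. simple_value (K' (r1 (r2 n))) t w" and ?v = "\<lambda>n t. simple_value (K n) t w"
    note bH = bounded_measurable_on_continuous[OF H_continuous[OF w]]
    note b = bounded_measurable_on_simple_value
    have 1: "(\<lambda>n. integral {0..T} (\<lambda>t. (?v' n t - H t w)\<^sup>2)) \<longlonglongrightarrow> 0"
      using LIMSEQ_subseq_LIMSEQ[OF elim(1) r2(1)] by (simp add: comp_def)
    have 2: "(\<lambda>n. integral {0..T} (\<lambda>t. (?v n t - H t w)\<^sup>2)) \<longlonglongrightarrow> 0"
      by (rule K_L2_tendsto_0[OF w])
    have A_lim: "(\<lambda>n. A n w) \<longlonglongrightarrow> 0"
    proof (rule tendsto_sandwich)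
      show "\<forall>\<^sub>F n in sequentially. 0 \<le> A n w"
        unfolding A_def
        by (intro always_eventually allI Henstock_Kurzweil_Integration.integral_nonneg bounded_measurable_intros b) auto
      show "\<forall>\<^sub>F n in sequentially. A n w \<le> 2 * integral {0..T} (\<lambda>t. (?v' n t - H t w)\<^sup>2)
          + 2 * integral {0..T} (\<lambda>t. (?v n t - H t w)\<^sup>2)"
      proof (intro always_eventually allI)
        fix n
        have "A n w \<le> integral {0..T} (\<lambda>t. 2 * (?v' n t - H t w)\<^sup>2 + 2 * (?v n t - H t w)\<^sup>2)"
          unfolding A_def
        proof (rule integral_le)
          fix t
          have "2 * (a - c)\<^sup>2 + 2 * (b - c)\<^sup>2 - (a - b)\<^sup>2 = (a + b - 2 * c)\<^sup>2" for a b c :: real by algebra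
          from this[of "?v' n t" "H t w" "?v n t"] zero_le_power2[of "?v' n t + ?v n t - 2 * H t w"]
          show "(simple_value (L n) t w)\<^sup>2 \<le> 2 * (?v' n t - H t w)\<^sup>2 + 2 * (?v n t - H t w)\<^sup>2"
            unfolding L_def simple_value_diff by linarith
        qed (intro bounded_measurable_intros b bH)+
        also have "\<dots> = integral {0..T} (\<lambda>t. 2 * (?v' n t - H t w)\<^sup>2) + integral {0..T} (\<lambda>t. 2 * (?v n t - H t w)\<^sup>2)"
          by (intro Henstock_Kurzweil_Integration.integral_add bounded_measurable_intros b bH)
        finally show "A n w \<le> 2 * integral {0..T} (\<lambda>t. (?v' n t - H t w)\<^sup>2)
          + 2 * integral {0..T} (\<lambda>t. (?v n t - H t w)\<^sup>2)"
          by (simp only: Henstock_Kurzweil_Integration.integral_mult_right)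
      qed
      show "(\<lambda>n. 2 * integral {0..T} (\<lambda>t. (?v' n t - H t w)\<^sup>2)
          + 2 * integral {0..T} (\<lambda>t. (?v n t - H t w)\<^sup>2)) \<longlonglongrightarrow> 0"
        using tendsto_add[OF tendsto_mult_right_zero[OF 1, of 2] tendsto_mult_right_zero[OF 2, of 2]] by simp
    qed simp
    \<comment> \<open>Under \<open>Q\<close> the Brownian integrator is the scaled coordinate
      process, not \<open>B\<close>. The correction is an integral of \<open>L n\<close> against
      \<open>H\<close>, and it vanishes together with \<open>A n w\<close>.\<close>
    have drift: "N n w = simple_integral B (L n) w + integral {0..T} (\<lambda>t. simple_value (L n) t w * H t w)" for n
    proof -
      have "simple_integral B (L n) w = N n w - integral {0..T} (\<lambda>t. simple_value (L n) t w * H t w)"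
        unfolding N_def
      proof (rule simple_integral_drift[OF _ H_continuous[OF w]])
        show "0 \<le> s \<and> s \<le> u \<and> u \<le> T" if "(s, u, \<xi>) \<in> set (L n)" for s u \<xi>
          using simple_integrandD(1-3)[OF L that] by simp
      qed (rule B_eq)
      then show ?thesis by simp
    qed
    have "(\<lambda>n. simple_integral B (L n) w + integral {0..T} (\<lambda>t. simple_value (L n) t w * H t w)) \<longlonglongrightarrow> (I w - J w) + 0"
    proof (rule tendsto_add)
      show "(\<lambda>n. simple_integral B (L n) w) \<longlonglongrightarrow> I w - J w"
        unfolding L_def simple_integral_diff by (rule tendsto_diff[OF elim(2,3)])
      show "(\<lambda>n. integral {0..T} (\<lambda>t. simple_value (L n) t w * H t w)) \<longlonglongrightarrow> 0"
        by (rule integral_mult_tendsto_0[OF b bH A_lim[unfolded A_def]])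
    qed
    then show ?case using A_lim by (simp add: drift)
  qed
  let ?p = "\<lambda>\<omega>. U_path \<omega>"
  define V where "V w = I w - J w" for w
  have V_meas: "(\<lambda>\<omega>. V (?p \<omega>)) \<in> borel_measurable M"
    unfolding V_def by (intro measurable_compose[OF path_U] borel_measurable_diff I_meas J_measurable)
  have conv_M: "AE \<omega> in M. (\<lambda>n. A n (?p \<omega>)) \<longlonglongrightarrow> 0 \<and> (\<lambda>n. N n (?p \<omega>)) \<longlonglongrightarrow> V (?p \<omega>)"
    using AE_distrD[OF path_U conv[unfolded Q_def']] by (simp only: V_def)
  \<comment> \<open>The factor \<open>c\<close> is kept general so that both signs of the exponent
    come from one argument.\<close>
  have moment: "(\<integral>\<^sup>+\<omega>. ennreal (exp (c * V (?p \<omega>))) \<partial>M) \<le> 1" for c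
  proof -
    define G where "G n \<omega> = ennreal (exp (c * N n (?p \<omega>) - c\<^sup>2 / 2 * A n (?p \<omega>)))" for n \<omega>
    have W_int: "simple_integral W (pullback (L n)) \<omega> = N n (?p \<omega>)" for n \<omega>
      unfolding N_def by (rule simple_integral_pullback[OF L])
    have W_val: "integral {0..T} (\<lambda>t. (simple_value (pullback (L n)) t \<omega>)\<^sup>2) = A n (?p \<omega>)" for n \<omega>
      by (simp add: A_def simple_value_pullback)
    have one: "(\<integral>\<^sup>+\<omega>. G n \<omega> \<partial>M) = 1" for n
      using simple_exponential_martingale(1)[OF bm simple_integrand_pullback[OF L[of n]] T_pos, of c]
      unfolding G_def W_int W_val .
    have A_meas: "(\<lambda>\<omega>. A n (?p \<omega>)) \<in> borel_measurable M" for n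
      using simple_exponential_martingale(2)[OF bm simple_integrand_pullback[OF L[of n]] T_pos] unfolding W_val .
    have N_meas: "(\<lambda>\<omega>. N n (?p \<omega>)) \<in> borel_measurable M" for n
    proof -
      have "(\<lambda>w. \<Sum>e\<leftarrow>L n. (case e of (s, u, \<xi>) \<Rightarrow> \<xi> w * ((w u - x) / \<sigma> - (w s - x) / \<sigma>))) \<in> borel_measurable (path_space T)"
      proof (rule borel_measurable_sum_list)
        fix e assume e: "e \<in> set (L n)"
        obtain s u \<xi> where eq: "e = (s, u, \<xi>)" by (cases e)
        note f = simple_integrandD[OF L e[unfolded eq]]
        have m: "\<xi> \<in> borel_measurable (path_space T)" using f by (intro F_measurable[OF f(4)]) auto
        have "(\<lambda>w. \<xi> w * ((w u - x) / \<sigma> - (w s - x) / \<sigma>)) \<in> borel_measurable (path_space T)"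
          using f by (intro real_measurable_intros
              measurable_path_coordinate m) auto
        then show "(\<lambda>w. case e of (s, u, \<xi>) \<Rightarrow> \<xi> w * ((w u - x) / \<sigma> - (w s - x) / \<sigma>)) \<in> borel_measurable (path_space T)"
          by (simp add: eq)
      qed
      from measurable_compose[OF path_U this] show ?thesis by (simp add: N_def simple_integral_def)
    qed
    have G_meas: "G n \<in> borel_measurable M" for n
      unfolding G_def
      by (intro measurable_compose[OF _ measurable_ennreal] measurable_compose[OF _ borel_measurable_exp]
          real_measurable_intros A_meas N_meas)
    have "AE \<omega> in M. ennreal (exp (c * V (?p \<omega>))) = liminf (\<lambda>n. G n \<omega>)"
      using conv_M
    proof eventually_elim
      case (elim \<omega>)
      have "(\<lambda>n. exp (c * N n (?p \<omega>) - c\<^sup>2 / 2 * A n (?p \<omega>))) \<longlonglongrightarrow> exp (c * V (?p \<omega>) - c\<^sup>2 / 2 * 0)"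
        using elim by (intro tendsto_intros) auto
      then have "(\<lambda>n. G n \<omega>) \<longlonglongrightarrow> ennreal (exp (c * V (?p \<omega>)))"
        unfolding G_def by (intro tendsto_ennrealI) simp
      from lim_imp_Liminf[OF _ this] show ?case by simp
    qed
    then have "(\<integral>\<^sup>+\<omega>. ennreal (exp (c * V (?p \<omega>))) \<partial>M) = (\<integral>\<^sup>+\<omega>. liminf (\<lambda>n. G n \<omega>) \<partial>M)"
      by (rule nn_integral_cong_AE)
    also have "\<dots> \<le> liminf (\<lambda>n. \<integral>\<^sup>+\<omega>. G n \<omega> \<partial>M)" by (rule nn_integral_liminf[OF G_meas])
    also have "\<dots> = 1" by (simp add: one Liminf_const)
    finally show ?thesis .
  qed
  have "AE \<omega> in M. V (?p \<omega>) = 0"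
    using moment[of 1] moment[of "-1"] by (intro AE_zero_if_exp_moments_le_1[OF M.prob_space_axioms V_meas]) simp_all
  moreover have "{w \<in> space (path_space T). V w = 0} \<in> sets (path_space T)"
    using borel_measurable_diff[OF I_meas J_measurable] unfolding V_def by measurable
  ultimately have "AE w in Q. V w = 0"
    unfolding Q_def' by (simp only: AE_distr_iff[OF path_U])
  then show ?thesis by eventually_elim (simp add: V_def)
qed

section \<open>Identification of the density process and the Radon-Nikodym derivative\<close>

lemma AE_Z: "AE w in Q. Z \<sigma> lam x T P w = inverse (\<Phi> w)"
proof -
  \<comment> \<open>Existence of a version gives the chosen one its defining property; uniqueness
    then determines its values almost surely.\<close>
  have "is_ito_integral P F B T H (ito_integral P F B T H)"
    unfolding ito_integral_def by (rule someI[of "is_ito_integral P F B T H", OF is_ito_integral_J])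
  from ito_integral_unique[OF this] show ?thesis
  proof eventually_elim
    case (elim w)
    have "Z \<sigma> lam x T P w = exp (- ito_integral P F B T H w - 1 / 2 * integral {0..T} (\<lambda>r. (H r w)\<^sup>2))"
      by (simp add: Z_def F_def B_def H_def[abs_def])
    also have "\<dots> = exp (- ln (\<Phi> w))" unfolding elim J_def by simp
    also have "\<dots> = inverse (\<Phi> w)" using \<Phi>_pos[of w] by (simp add: exp_minus)
    finally show ?case .
  qed
qed

lemma AE_RN_deriv: "AE w in Q. enn2real (RN_deriv Q P w) = \<Phi> w"
proof -
  have "(\<lambda>w. ennreal (\<Phi> w)) \<in> borel_measurable Q" using \<Phi>_measurable by (simp add: measurable_Q)
  from Q.RN_deriv_unique[OF this P_eq_density[symmetric]] show ?thesis
    by eventually_elim (metis \<Phi>_pos enn2real_ennreal less_imp_le)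
qed

lemma AE_\<Phi>_le: "AE w in Q. \<Phi> w \<le> C"
  using AE_space by eventually_elim (rule \<Phi>_le, simp add: space_path_space)

lemma absolutely_continuous_P: "absolutely_continuous Q P"
proof -
  have "(\<lambda>w. ennreal (\<Phi> w)) \<in> borel_measurable Q" using \<Phi>_measurable by (simp add: measurable_Q)
  from absolutely_continuousI_density[OF this] show ?thesis unfolding P_eq_density[symmetric] .
qed

end

theorem proposition5p2:
  fixes \<sigma> T x \<theta> :: real and lam Lam :: "real \<Rightarrow> real"
    and M :: "'a measure" and W X :: "real \<Rightarrow> 'a \<Rightarrow> real"
    and P Q :: "(real \<Rightarrow> real) measure" and D :: "(real \<Rightarrow> real) \<Rightarrow> real"
  assumes "\<sigma> > 0"
    and "lam \<in> drift_class" and "lam \<theta> = 0" and "rho \<sigma> lam < 1"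
    and "\<And>y. (Lam has_real_derivative lam y) (at y)"
    and "T > 0"
    and "brownian_motion M W" and "strong_solution M W \<sigma> lam x X"
  defines "P \<equiv> path_law M X T"
    and "Q \<equiv> path_law M (\<lambda>t \<omega>. x + \<sigma> * W t \<omega>) T"
    and "D \<equiv> (\<lambda>w. enn2real (RN_deriv Q P w))"
  shows "absolutely_continuous Q P \<and>
    (AE w in Q. D w = inverse (Z \<sigma> lam x T P w)) \<and>
    bdd_above (range (Psi0 \<sigma> lam)) \<and>
    (AE w in Q. 0 < D w \<and>
       D w \<le> exp ((Lam \<theta> - Lam x) / \<sigma>\<^sup>2 + T * (SUP y. Psi0 \<sigma> lam y))) \<and>
    D \<in> borel_measurable Q \<and> esssup Q (\<lambda>w. ereal \<bar>D w\<bar>) < \<infinity> \<and>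
    (\<forall>m>0. (\<integral>\<^sup>+ w. ennreal (D w powr m) \<partial>Q) < \<infinity>)"
proof -
  interpret dbm: drifted_brownian_motion \<sigma> T x \<theta> lam Lam M W X
    using assms(1-8) by unfold_locales auto
  have P: "P = dbm.P" and Q: "Q = dbm.Q" by (simp_all add: P_def Q_def dbm.P_def dbm.Q_def)
  have D: "AE w in Q. D w = dbm.\<Phi> w" unfolding D_def P Q by (rule dbm.AE_RN_deriv)
  have D_le: "AE w in Q. 0 < D w \<and> D w \<le> dbm.C"
    using D dbm.AE_\<Phi>_le[folded Q] by eventually_elim (simp add: dbm.\<Phi>_pos)
  have meas: "D \<in> borel_measurable Q" unfolding D_def by simp
  have "AE w in Q. D w = inverse (Z \<sigma> lam x T P w)"
    using D dbm.AE_Z[folded P Q] by eventually_elim simp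
  moreover have "esssup Q (\<lambda>w. ereal \<bar>D w\<bar>) \<le> ereal dbm.C"
    by (rule esssup_I) (use D_le meas in \<open>auto elim: eventually_mono\<close>)
  then have "esssup Q (\<lambda>w. ereal \<bar>D w\<bar>) < \<infinity>" by (rule order_le_less_trans) simp
  moreover have "(\<integral>\<^sup>+ w. ennreal (D w powr m) \<partial>Q) < \<infinity>" if "m > 0" for m
  proof -
    have "(\<integral>\<^sup>+ w. ennreal (D w powr m) \<partial>Q) \<le> (\<integral>\<^sup>+ w. ennreal (dbm.C powr m) \<partial>Q)"
    proof (rule nn_integral_mono_AE)
      show "AE w in Q. ennreal (D w powr m) \<le> ennreal (dbm.C powr m)"
        using D_le by eventually_elim (use that in \<open>auto intro!: ennreal_leI powr_mono2\<close>)
    qed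
    also have "\<dots> = ennreal (dbm.C powr m)" by (simp add: Q dbm.Q.emeasure_space_1[unfolded dbm.space_Q])
    finally show ?thesis by (rule order_le_less_trans) simp
  qed
  ultimately show ?thesis
    using dbm.absolutely_continuous_P bdd_above_Psi0[OF assms(1,2,4)] D_le meas
    by (simp add: P Q dbm.C_def)
qed

end
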